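(* Let $k$ be a number field and let $f\colon\mathbb{P}^N\dashrightarrow\mathbb{P}^N$ be a dominant rational self-map defined over $k$ whose restriction to $\mathbb{A}^N$ is a morphism of the form $$f(x_1,\dots,x_N)=(f_1(x_1,\dots,x_N),f_2(x_2,\dots,x_N),\dots,f_N(x_N))$$ with $f_i\in k[x_i,x_{i+1},\dots,x_N]$ for $i=1,\dots,N$. Assume at least one of the following: (1) $\deg_{x_i}f_i>\deg_{x_{i+1}}f_{i+1}$ for every $i=1,\dots,N-1$; or (2) $N=2$. Then the set $\{P\in\mathbb{A}^N(\overline{k}):\alpha_f(P)\text{ exists and equals }\delta_f\}$ contains a subset $S$ which is Zariski dense in $\mathbb{P}^N$ and whose points have pairwise disjoint forward $f$-orbits.
   Context: For a hyperplane (ample divisor) $H$ on $\mathbb{P}^N$, the dynamical degree is $\delta_f=\lim_{n\to\infty}\big(((f^n)^*H)\cdot H^{N-1}\big)^{1/n}$; equivalently, writing $f^n$ in homogeneous coordinates by homogeneous polynomials of a common degree $\deg(f^n)$ without common nontrivial factor, $\delta_f=\lim_n\deg(f^n)^{1/n}$. Let $h_H$ be an absolute logarithmic Weil height associated with $H$ and $h_H^+=\max\{h_H,1\}$. For a point $P$ whose forward orbit avoids the indeterminacy locus (e.g. $P\in\mathbb{A}^N(\overline{k})$), the arithmetic degree is $\alpha_f(P)=\lim_{n\to\infty}h_H^+(f^n(P))^{1/n}$ when the limit exists. The forward orbit of $P$ is $\{f^n(P):n\ge0\}$. *)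

theory Defs
  imports
    "HOL-Analysis.Analysis"
    "HOL-Library.Poly_Mapping"
    "HOL-Computational_Algebra.Polynomial"
begin

section \<open>Number fields inside the complex numbers\<close>

interpretation rat_vs: vector_space "\<lambda>(q::rat) (x::complex). of_rat q * x"
  by unfold_locales (simp_all add: algebra_simps of_rat_add of_rat_mult)

definition complex_subfield :: "complex set \<Rightarrow> bool" where
  "complex_subfield K \<longleftrightarrow> 0 \<in> K \<and> 1 \<in> K \<and>
     (\<forall>x\<in>K. \<forall>y\<in>K. x + y \<in> K \<and> x - y \<in> K \<and> x * y \<in> K) \<and> (\<forall>x\<in>K. inverse x \<in> K)"

definition number_field :: "complex set \<Rightarrow> bool" where
  "number_field K \<longleftrightarrow> complex_subfield K \<and> (\<exists>B. finite B \<and> K \<subseteq> rat_vs.span B)"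

definition rat_adjoin :: "complex set \<Rightarrow> complex set" where
  "rat_adjoin X = \<Inter> {L. complex_subfield L \<and> X \<subseteq> L}"

definition alg_closure_of :: "complex set \<Rightarrow> complex set" where
  "alg_closure_of k = {z. \<exists>p. p \<noteq> 0 \<and> (\<forall>i. coeff p i \<in> k) \<and> poly p z = 0}"


section \<open>Multivariate polynomials\<close>

text \<open>Polynomials in the variables $x_0, x_1, x_2, \dots$; the outer keys are exponent vectors.\<close>

type_synonym mpoly = "(nat \<Rightarrow>\<^sub>0 nat) \<Rightarrow>\<^sub>0 complex"

definition mp_const :: "complex \<Rightarrow> mpoly" where
  "mp_const c = Poly_Mapping.single 0 c"

definition mp_var :: "nat \<Rightarrow> mpoly" where
  "mp_var i = Poly_Mapping.single (Poly_Mapping.single i 1) 1"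

definition mp_vars :: "mpoly \<Rightarrow> nat set" where
  "mp_vars p = (\<Union>m\<in>Poly_Mapping.keys p. Poly_Mapping.keys m)"

definition mp_over :: "complex set \<Rightarrow> mpoly \<Rightarrow> bool" where
  "mp_over K p \<longleftrightarrow> (\<forall>m. Poly_Mapping.lookup p m \<in> K)"

definition mp_homogeneous :: "nat \<Rightarrow> mpoly \<Rightarrow> bool" where
  "mp_homogeneous d p \<longleftrightarrow>
     (\<forall>m\<in>Poly_Mapping.keys p. (\<Sum>i\<in>Poly_Mapping.keys m. Poly_Mapping.lookup m i) = d)"

definition mp_degree_in :: "nat \<Rightarrow> mpoly \<Rightarrow> nat" where
  "mp_degree_in i p = Max (insert 0 ((\<lambda>m. Poly_Mapping.lookup m i) ` Poly_Mapping.keys p))"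

definition mp_insertion :: "(complex \<Rightarrow> 'b::comm_semiring_1) \<Rightarrow> (nat \<Rightarrow> 'b) \<Rightarrow> mpoly \<Rightarrow> 'b" where
  "mp_insertion \<phi> g p =
     (\<Sum>m\<in>Poly_Mapping.keys p. \<phi> (Poly_Mapping.lookup p m) *
        (\<Prod>i\<in>Poly_Mapping.keys m. g i ^ Poly_Mapping.lookup m i))"

definition mp_eval :: "mpoly \<Rightarrow> (nat \<Rightarrow> complex) \<Rightarrow> complex" where
  "mp_eval p x = mp_insertion (\<lambda>c. c) x p"

definition mp_subst :: "mpoly \<Rightarrow> (nat \<Rightarrow> mpoly) \<Rightarrow> mpoly" where
  "mp_subst p G = mp_insertion mp_const G p"


section \<open>Projective space and the Zariski topology\<close>

text \<open>
  A point of $\mathbb P^N(K)$ is the set of all its homogeneous coordinate vectors over $K$;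
  such a vector is a function on the naturals that vanishes beyond index $N$.
\<close>

definition proj_pt :: "complex set \<Rightarrow> (nat \<Rightarrow> complex) \<Rightarrow> (nat \<Rightarrow> complex) set" where
  "proj_pt K x = {\<lambda>i. c * x i | c. c \<in> K \<and> c \<noteq> 0}"

definition proj_space :: "nat \<Rightarrow> complex set \<Rightarrow> (nat \<Rightarrow> complex) set set" where
  "proj_space N K =
     proj_pt K ` {x. (\<forall>i\<le>N. x i \<in> K) \<and> (\<forall>i>N. x i = 0) \<and> (\<exists>i\<le>N. x i \<noteq> 0)}"

definition affine_space :: "nat \<Rightarrow> complex set \<Rightarrow> (nat \<Rightarrow> complex) set" where
  "affine_space N K = {x. (\<forall>i\<in>{1..N}. x i \<in> K) \<and> (\<forall>i. i \<notin> {1..N} \<longrightarrow> x i = 0)}"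

text \<open>The inclusion $(x_1, \dots, x_N) \mapsto [1 : x_1 : \dots : x_N]$.\<close>

definition aff_pt :: "complex set \<Rightarrow> (nat \<Rightarrow> complex) \<Rightarrow> (nat \<Rightarrow> complex) set" where
  "aff_pt K x = proj_pt K (x(0 := 1))"

definition zariski_closed :: "nat \<Rightarrow> complex set \<Rightarrow> (nat \<Rightarrow> complex) set set \<Rightarrow> bool" where
  "zariski_closed N K Z \<longleftrightarrow>
     (\<exists>I. (\<forall>p\<in>I. mp_over K p \<and> mp_vars p \<subseteq> {..N} \<and> (\<exists>d. mp_homogeneous d p)) \<and>
          Z = {P \<in> proj_space N K. \<forall>p\<in>I. \<forall>x\<in>P. mp_eval p x = 0})"

definition zariski_dense :: "nat \<Rightarrow> complex set \<Rightarrow> (nat \<Rightarrow> complex) set set \<Rightarrow> bool" where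
  "zariski_dense N K S \<longleftrightarrow> S \<subseteq> proj_space N K \<and>
     (\<forall>Z. zariski_closed N K Z \<and> S \<subseteq> Z \<longrightarrow> Z = proj_space N K)"


section \<open>Rational self-maps of projective space\<close>

text \<open>
  A rational self-map is given by $N+1$ homogeneous polynomials of common degree $d$ without
  nontrivial common factor.
\<close>

definition rational_self_map :: "nat \<Rightarrow> nat \<Rightarrow> (nat \<Rightarrow> mpoly) \<Rightarrow> bool" where
  "rational_self_map N d F \<longleftrightarrow>
     (\<forall>i\<le>N. mp_vars (F i) \<subseteq> {..N} \<and> mp_homogeneous d (F i)) \<and> (\<forall>i>N. F i = 0) \<and>
     (\<exists>i\<le>N. F i \<noteq> 0) \<and> (\<forall>q. (\<forall>i\<le>N. q dvd F i) \<longrightarrow> q dvd 1)"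

definition indeterminacy_locus ::
  "nat \<Rightarrow> complex set \<Rightarrow> (nat \<Rightarrow> mpoly) \<Rightarrow> (nat \<Rightarrow> complex) set set" where
  "indeterminacy_locus N K F = {P \<in> proj_space N K. \<forall>x\<in>P. \<forall>i\<le>N. mp_eval (F i) x = 0}"

text \<open>All members of the union below coincide, by homogeneity of \<open>F\<close>.\<close>

definition rat_app ::
  "complex set \<Rightarrow> (nat \<Rightarrow> mpoly) \<Rightarrow> (nat \<Rightarrow> complex) set \<Rightarrow> (nat \<Rightarrow> complex) set" where
  "rat_app K F P = (\<Union>x\<in>P. proj_pt K (\<lambda>i. mp_eval (F i) x))"

definition dominant :: "nat \<Rightarrow> complex set \<Rightarrow> (nat \<Rightarrow> mpoly) \<Rightarrow> bool" where
  "dominant N K F \<longleftrightarrow>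
     zariski_dense N K (rat_app K F ` (proj_space N K - indeterminacy_locus N K F))"

definition forward_orbit ::
  "complex set \<Rightarrow> (nat \<Rightarrow> mpoly) \<Rightarrow> (nat \<Rightarrow> complex) set \<Rightarrow> (nat \<Rightarrow> complex) set set" where
  "forward_orbit K F P = {(rat_app K F ^^ n) P | n. True}"

text \<open>Iterated substitution; the resulting polynomials may have a common factor.\<close>

primrec unreduced_iterate :: "nat \<Rightarrow> (nat \<Rightarrow> mpoly) \<Rightarrow> nat \<Rightarrow> nat \<Rightarrow> mpoly" where
  "unreduced_iterate N F 0 = (\<lambda>i. if i \<le> N then mp_var i else 0)"
| "unreduced_iterate N F (Suc n) = (\<lambda>i. mp_subst (F i) (unreduced_iterate N F n))"

text \<open>
  The degree of the \<open>n\<close>-th iterate: the common degree of a coprime tuple \<open>G\<close> that is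
  proportional to the unreduced one.
\<close>

definition iterate_degree :: "nat \<Rightarrow> (nat \<Rightarrow> mpoly) \<Rightarrow> nat \<Rightarrow> nat" where
  "iterate_degree N F n = (THE d. \<exists>G. rational_self_map N d G \<and>
     (\<forall>i\<le>N. \<forall>j\<le>N. G i * unreduced_iterate N F n j = G j * unreduced_iterate N F n i))"

definition dynamical_degree :: "nat \<Rightarrow> (nat \<Rightarrow> mpoly) \<Rightarrow> real" where
  "dynamical_degree N F = lim (\<lambda>n. real (iterate_degree N F n) powr (1 / real n))"


section \<open>Heights\<close>

definition embeddings :: "complex set \<Rightarrow> (complex \<Rightarrow> complex) set" where
  "embeddings K = {\<sigma> \<in> extensional K. \<sigma> 1 = 1 \<and>
     (\<forall>x\<in>K. \<forall>y\<in>K. \<sigma> (x + y) = \<sigma> x + \<sigma> y \<and> \<sigma> (x * y) = \<sigma> x * \<sigma> y)}"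

definition residue_card :: "complex set \<Rightarrow> (complex \<Rightarrow> real) \<Rightarrow> nat" where
  "residue_card K v = (let R = {x \<in> K. v x \<le> 1} in
     card (R // {(x, y). x \<in> R \<and> y \<in> R \<and> v (x - y) < 1}))"

text \<open>
  The finite places of a number field \<open>K\<close>, each represented by its normalized absolute value
  $\|x\|_v = q_v^{-\mathrm{ord}_v(x)} = |x|_v^{[K_v : \mathbb Q_v]}$, where $q_v$ is the
  cardinality of the residue field. The trivial absolute value is excluded by the condition on
  the value group: its residue field \<open>K\<close> is infinite.
\<close>

definition finite_places :: "complex set \<Rightarrow> (complex \<Rightarrow> real) set" where
  "finite_places K = {v \<in> extensional K.
     (\<forall>x\<in>K. v x \<ge> 0 \<and> (v x = 0 \<longleftrightarrow> x = 0)) \<and>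
     (\<forall>x\<in>K. \<forall>y\<in>K. v (x * y) = v x * v y \<and> v (x + y) \<le> max (v x) (v y)) \<and>
     v ` (K - {0}) = range (\<lambda>z::int. real (residue_card K v) powi z)}"

text \<open>
  The height relative to \<open>K\<close>. A complex place corresponds to two embeddings, which accounts for
  its local degree 2.
\<close>

definition relative_height :: "complex set \<Rightarrow> nat \<Rightarrow> (nat \<Rightarrow> complex) \<Rightarrow> real" where
  "relative_height K N x =
     (\<Sum>\<sigma>\<in>embeddings K. ln (Max ((\<lambda>i. cmod (\<sigma> (x i))) ` {..N}))) +
     (\<Sum>\<^sub>\<infinity>v\<in>finite_places K. ln (Max ((\<lambda>i. v (x i)) ` {..N})))"

definition normalized_coords :: "(nat \<Rightarrow> complex) set \<Rightarrow> nat \<Rightarrow> complex" where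
  "normalized_coords P = (THE x. x \<in> P \<and> x (LEAST i. x i \<noteq> 0) = 1)"

text \<open>
  The absolute logarithmic height does not depend on the homogeneous coordinates nor on the number
  field containing them. Here the first nonzero coordinate is scaled to 1, so that the
  coordinates generate the field of definition of the point.
\<close>

definition standard_height :: "nat \<Rightarrow> (nat \<Rightarrow> complex) set \<Rightarrow> real" where
  "standard_height N P =
     (let x = normalized_coords P; K = rat_adjoin (x ` {..N})
      in relative_height K N x / real (rat_vs.dim K))"

text \<open>
  Weil heights associated with a divisor are determined only up to a bounded function; for a
  hyperplane they form the class of the standard height.
\<close>

definition hyperplane_weil_height ::
  "nat \<Rightarrow> complex set \<Rightarrow> ((nat \<Rightarrow> complex) set \<Rightarrow> real) \<Rightarrow> bool" where
  "hyperplane_weil_height N K h \<longleftrightarrow>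
     (\<exists>C. \<forall>P\<in>proj_space N K. \<bar>h P - standard_height N P\<bar> \<le> C)"

definition has_arithmetic_degree ::
  "complex set \<Rightarrow> ((nat \<Rightarrow> complex) set \<Rightarrow> real) \<Rightarrow> (nat \<Rightarrow> mpoly) \<Rightarrow>
     (nat \<Rightarrow> complex) set \<Rightarrow> real \<Rightarrow> bool" where
  "has_arithmetic_degree K h F P a \<longleftrightarrow>
     (\<lambda>n. max (h ((rat_app K F ^^ n) P)) 1 powr (1 / real n)) \<longlonglongrightarrow> a"

end

theory Submission
  imports Defs "HOL-Computational_Algebra.Primes"
begin

text \<open>
  Write \<open>d\<^sub>i\<close> for the degree of \<open>f\<^sub>i\<close> in \<open>x\<^sub>i\<close>. The recursion
  \<open>E\<^sub>n\<^sub>+\<^sub>1(i) = d\<^sub>i E\<^sub>n(i) + C (1 + \<Sum>\<^sub>l\<^sub>>\<^sub>i E\<^sub>n(l))\<close> bounds both the degrees of the coordinates of \<open>f\<^sup>n\<close> and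
  the heights of the coordinates of \<open>f\<^sup>n(P)\<close>, so both grow at most like \<open>max d\<^sub>i\<close>. For the lower bounds
  let \<open>j\<close> maximise \<open>d\<^sub>j\<close>. In the strictly decreasing case \<open>j = 1\<close>, and the coordinates are chosen from
  the last one backwards: once the leading coefficient of \<open>f\<^sub>i\<close> in \<open>x\<^sub>i\<close> does not vanish along the
  orbit, Liouville's inequality bounds it below by \<open>exp (- C \<rho>\<^sup>n)\<close> with \<open>\<rho> < d\<^sub>i\<close>, and every sufficiently
  large \<open>x\<^sub>i\<close> escapes like \<open>exp (c d\<^sub>i\<^sup>n)\<close>. In the remaining case \<open>N = j = 2\<close> a large last
  coordinate suffices.

  Disjointness of the orbits is read off the last coordinate alone: given finitely many points over a
  number field \<open>L\<close>, the next point is chosen so that the last coordinate of its orbit never lies in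
  \<open>L\<close>. Since there are only countably many polynomials over the algebraic closure, one point off
  each hypersurface can be picked in this way, which gives Zariski density.
\<close>

section \<open>Evaluation and substitution of multivariate polynomials\<close>

text \<open>All height estimates pass through integer relations. An element of a fixed lattice with
  denominator D^M and numerator at most A^M satisfies a nontrivial integer polynomial relation of
  degree at most n + 1 with coefficients exp (O(M)) (\<open>int_rel\<close>). Its nonzero leading
  coefficient bounds all conjugates and clears the denominators at all finite places, and the
  reversed relation does the same for the inverse. Of the product formula only an inequality for
  rational integers is then required. Heights are bounded below through the given embedding into the
  complex numbers alone, where one coordinate of the orbit is made large. The obstacle is the
  leading coefficient of f_i in x_i, a polynomial in the later coordinates: along a whole orbit it
  must neither vanish nor decay too fast. Strict decrease of the degrees makes its decay negligible
  against the growth d_i^n, and its non-vanishing is handed on as a condition in fewer variables. If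
  N = 2 and d_1 \<le> d_2, the difficulty disappears, as the last coordinate follows a polynomial in
  one variable with constant leading coefficient.\<close>

abbreviation lookup :: "('a \<Rightarrow>\<^sub>0 'b::zero) \<Rightarrow> 'a \<Rightarrow> 'b" where
  "lookup \<equiv> Poly_Mapping.lookup"

abbreviation keys :: "('a \<Rightarrow>\<^sub>0 'b::zero) \<Rightarrow> 'a set" where
  "keys \<equiv> Poly_Mapping.keys"

definition mon_eval :: "(nat \<Rightarrow> 'b::comm_semiring_1) \<Rightarrow> (nat \<Rightarrow>\<^sub>0 nat) \<Rightarrow> 'b" where
  "mon_eval g m = (\<Prod>i\<in>keys m. g i ^ lookup m i)"

lemma mon_eval_superset:
  assumes "finite I" "keys m \<subseteq> I"
  shows "mon_eval g m = (\<Prod>i\<in>I. g i ^ lookup m i)"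
  unfolding mon_eval_def
  by (rule prod.mono_neutral_left) (use assms in \<open>auto simp: in_keys_iff\<close>)

lemma mon_eval_0 [simp]: "mon_eval g 0 = 1"
  by (simp add: mon_eval_def)

lemma mon_eval_add: "mon_eval g (m + m') = mon_eval g m * mon_eval g m'"
proof -
  let ?I = "keys m \<union> keys m'"
  have "mon_eval g (m + m') = (\<Prod>i\<in>?I. g i ^ lookup (m + m') i)"
    by (rule mon_eval_superset) (simp_all add: keys_add)
  also have "\<dots> = (\<Prod>i\<in>?I. g i ^ lookup m i) * (\<Prod>i\<in>?I. g i ^ lookup m' i)"
    by (simp add: lookup_add power_add prod.distrib)
  also have "\<dots> = mon_eval g m * mon_eval g m'"
    by (simp add: mon_eval_superset[of ?I])
  finally show ?thesis .
qed

lemma mon_eval_single: "mon_eval g (Poly_Mapping.single i n) = g i ^ n"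
  by (simp add: mon_eval_superset[of "{i}"])

lemma mp_insertion_mon: "mp_insertion \<phi> g p = (\<Sum>m\<in>keys p. \<phi> (lookup p m) * mon_eval g m)"
  by (simp add: mp_insertion_def mon_eval_def)

lemma mp_insertion_superset:
  assumes "finite A" "keys p \<subseteq> A" "\<phi> 0 = 0"
  shows "mp_insertion \<phi> g p = (\<Sum>m\<in>A. \<phi> (lookup p m) * mon_eval g m)"
  unfolding mp_insertion_mon
  by (rule sum.mono_neutral_left) (use assms in \<open>auto simp: in_keys_iff\<close>)

lemma mp_sum_singles: "p = (\<Sum>m\<in>keys p. Poly_Mapping.single m (lookup p m))"
proof (rule poly_mapping_eqI)
  fix k
  have "(\<Sum>m\<in>keys p. lookup (Poly_Mapping.single m (lookup p m)) k)
      = (\<Sum>m\<in>keys p. if m = k then lookup p k else 0)"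
    by (rule sum.cong) (auto simp: lookup_single)
  then show "lookup p k = lookup (\<Sum>m\<in>keys p. Poly_Mapping.single m (lookup p m)) k"
    by (simp add: lookup_sum in_keys_iff)
qed

lemma mp_times_singles:
  "p * q = (\<Sum>m\<in>keys p. \<Sum>m'\<in>keys q. Poly_Mapping.single (m + m') (lookup p m * lookup q m'))"
proof -
  have "p * q = (\<Sum>m\<in>keys p. Poly_Mapping.single m (lookup p m))
      * (\<Sum>m\<in>keys q. Poly_Mapping.single m (lookup q m))"
    by (rule arg_cong2[of _ _ _ _ "(*)", OF mp_sum_singles mp_sum_singles])
  then show ?thesis by (simp add: sum_product mult_single)
qed

locale insertion_hom =
  fixes \<phi> :: "complex \<Rightarrow> 'b::comm_semiring_1"
  assumes hom_0: "\<phi> 0 = 0" and hom_1: "\<phi> 1 = 1"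
    and hom_add: "\<phi> (a + b) = \<phi> a + \<phi> b" and hom_mult: "\<phi> (a * b) = \<phi> a * \<phi> b"
begin

lemma ins_0 [simp]: "mp_insertion \<phi> g 0 = 0"
  by (simp add: mp_insertion_def)

lemma ins_single: "mp_insertion \<phi> g (Poly_Mapping.single m c) = \<phi> c * mon_eval g m"
  by (subst mp_insertion_superset[of "{m}"]) (auto simp: hom_0)

lemma ins_1 [simp]: "mp_insertion \<phi> g 1 = 1"
  using ins_single[of g 0 1] by (simp add: hom_1)

lemma ins_add: "mp_insertion \<phi> g (p + q) = mp_insertion \<phi> g p + mp_insertion \<phi> g q"
proof -
  let ?A = "keys p \<union> keys q"
  have "mp_insertion \<phi> g (p + q) = (\<Sum>m\<in>?A. \<phi> (lookup (p + q) m) * mon_eval g m)"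
    by (rule mp_insertion_superset) (simp_all add: keys_add hom_0)
  also have "\<dots> = (\<Sum>m\<in>?A. \<phi> (lookup p m) * mon_eval g m)
      + (\<Sum>m\<in>?A. \<phi> (lookup q m) * mon_eval g m)"
    by (simp add: lookup_add hom_add distrib_right sum.distrib)
  also have "\<dots> = mp_insertion \<phi> g p + mp_insertion \<phi> g q"
    by (simp add: mp_insertion_superset[of ?A] hom_0)
  finally show ?thesis .
qed

lemma ins_sum: "mp_insertion \<phi> g (\<Sum>a\<in>A. P a) = (\<Sum>a\<in>A. mp_insertion \<phi> g (P a))"
  by (induction A rule: infinite_finite_induct) (auto simp: ins_add)

lemma ins_mult: "mp_insertion \<phi> g (p * q) = mp_insertion \<phi> g p * mp_insertion \<phi> g q"
proof -
  have "mp_insertion \<phi> g (p * q) = (\<Sum>m\<in>keys p. \<Sum>m'\<in>keys q.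
      \<phi> (lookup p m * lookup q m') * mon_eval g (m + m'))"
    by (subst mp_times_singles) (simp add: ins_sum ins_single)
  also have "\<dots> = mp_insertion \<phi> g p * mp_insertion \<phi> g q"
    unfolding mp_insertion_mon sum_product
    by (intro sum.cong refl) (simp add: hom_mult mon_eval_add mult.assoc mult.left_commute)
  finally show ?thesis .
qed

lemma ins_power: "mp_insertion \<phi> g (p ^ n) = mp_insertion \<phi> g p ^ n"
  by (induction n) (auto simp: ins_mult)

lemma ins_prod: "mp_insertion \<phi> g (\<Prod>a\<in>A. P a) = (\<Prod>a\<in>A. mp_insertion \<phi> g (P a))"
  by (induction A rule: infinite_finite_induct) (auto simp: ins_mult)

end

interpretation mp_eval_hom: insertion_hom "\<lambda>c::complex. c"
  by unfold_locales auto

interpretation mp_subst_hom: insertion_hom mp_const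
  by unfold_locales (auto simp: mp_const_def single_add mult_single)

lemma mp_eval_0 [simp]: "mp_eval 0 x = 0"
  by (simp add: mp_eval_def)

lemma mp_eval_add: "mp_eval (p + q) x = mp_eval p x + mp_eval q x"
  by (simp add: mp_eval_def mp_eval_hom.ins_add)

lemma mp_eval_mult: "mp_eval (p * q) x = mp_eval p x * mp_eval q x"
  by (simp add: mp_eval_def mp_eval_hom.ins_mult)

lemma mp_eval_single: "mp_eval (Poly_Mapping.single m c) x = c * mon_eval x m"
  by (simp add: mp_eval_def mp_eval_hom.ins_single)

lemma mp_eval_diff: "mp_eval (p - q) x = mp_eval p x - mp_eval q x"
  using mp_eval_add[of "p - q" q x] by simp

lemma mp_eval_var: "mp_eval (mp_var i) x = x i"
  by (simp add: mp_var_def mp_eval_single mon_eval_single)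

lemma mp_eval_const: "mp_eval (mp_const c) x = c"
  by (simp add: mp_const_def mp_eval_single)

lemma mp_eval_subst: "mp_eval (mp_subst p G) x = mp_eval p (\<lambda>i. mp_eval (G i) x)"
proof -
  have "mp_eval (mp_subst p G) x
      = (\<Sum>m\<in>keys p. mp_eval (mp_const (lookup p m)) x * mp_eval (mon_eval G m) x)"
    unfolding mp_subst_def mp_insertion_mon[of mp_const]
    by (simp add: mp_eval_def mp_eval_hom.ins_sum mp_eval_hom.ins_mult)
  moreover have "mp_eval (mon_eval G m) x = mon_eval (\<lambda>i. mp_eval (G i) x) m" for m
    by (simp add: mon_eval_def mp_eval_def mp_eval_hom.ins_prod mp_eval_hom.ins_power)
  ultimately show ?thesis
    by (simp add: mp_eval_const) (simp add: mp_eval_def mp_insertion_mon)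
qed

lemma mp_insertion_cong:
  assumes "\<And>i. i \<in> mp_vars p \<Longrightarrow> g i = h i"
  shows "mp_insertion \<phi> g p = mp_insertion \<phi> h p"
  unfolding mp_insertion_def
proof (intro sum.cong prod.cong arg_cong2[where f = "(*)"] refl)
  fix m i assume "m \<in> keys p" "i \<in> keys m"
  then have "i \<in> mp_vars p" by (auto simp: mp_vars_def)
  then show "g i ^ lookup m i = h i ^ lookup m i" by (simp add: assms)
qed

lemma mp_eval_cong: "(\<And>i. i \<in> mp_vars p \<Longrightarrow> x i = y i) \<Longrightarrow> mp_eval p x = mp_eval p y"
  unfolding mp_eval_def by (rule mp_insertion_cong)

lemma mp_eval_zero_point: "mp_eval p (\<lambda>_. 0) = lookup p 0"
proof -
  have *: "mon_eval (\<lambda>_. 0 :: complex) m = 0" if "m \<noteq> 0" for m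
    using that unfolding mon_eval_def
    by (intro prod_zero) (auto simp: in_keys_iff poly_mapping_eq_iff fun_eq_iff power_0_left)
  have "mp_eval p (\<lambda>_. 0) = (\<Sum>m\<in>insert 0 (keys p). lookup p m * mon_eval (\<lambda>_. 0) m)"
    unfolding mp_eval_def by (rule mp_insertion_superset) auto
  also have "\<dots> = (\<Sum>m\<in>{0}. lookup p m * mon_eval (\<lambda>_. 0) m)"
    by (rule sum.mono_neutral_right) (auto simp: *)
  finally show ?thesis by simp
qed

lemma finite_mp_vars [simp]: "finite (mp_vars p)"
  by (simp add: mp_vars_def)

lemma mp_insertion_closed:
  assumes add: "\<And>a b. a \<in> R \<Longrightarrow> b \<in> R \<Longrightarrow> a + b \<in> R"
    and mult: "\<And>a b. a \<in> R \<Longrightarrow> b \<in> R \<Longrightarrow> a * b \<in> R"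
    and zero: "0 \<in> R" and one: "1 \<in> R"
    and coeffs: "\<And>m. m \<in> keys p \<Longrightarrow> \<phi> (lookup p m) \<in> R"
    and vars: "\<And>i. i \<in> mp_vars p \<Longrightarrow> g i \<in> R"
  shows "mp_insertion \<phi> g p \<in> R"
proof -
  have sum: "sum F A \<in> R" if "\<And>a. a \<in> A \<Longrightarrow> F a \<in> R" for F :: "(nat \<Rightarrow>\<^sub>0 nat) \<Rightarrow> 'a" and A
    using that by (induction A rule: infinite_finite_induct) (auto simp: zero add)
  have pow: "a ^ n \<in> R" if "a \<in> R" for a n
    by (induction n) (auto simp: one that mult)
  have prod: "prod F A \<in> R" if "\<And>a. a \<in> A \<Longrightarrow> F a \<in> R" for F :: "nat \<Rightarrow> 'a" and A
    using that by (induction A rule: infinite_finite_induct) (auto simp: one mult)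
  show ?thesis
    unfolding mp_insertion_def
    by (intro sum mult prod pow coeffs vars) (auto simp: mp_vars_def)
qed

text \<open>The predicate \<open>B M\<close> plays the role of a filtration: indices add under
  products, and every addition costs one unit, because adding two fractions of size M doubles the
  numerator. The summand \<open>card (keys p)\<close> pays for one addition per monomial. Degrees of
  polynomials and sizes of algebraic numbers are both of this kind.\<close>

lemma mp_insertion_filtered:
  fixes B :: "nat \<Rightarrow> 'b::comm_semiring_1 \<Rightarrow> bool"
  assumes mono: "\<And>M M' x. B M x \<Longrightarrow> M \<le> M' \<Longrightarrow> B M' x"
    and mult: "\<And>M M' x y. B M x \<Longrightarrow> B M' y \<Longrightarrow> B (M + M') (x * y)"
    and add: "\<And>M x y. B M x \<Longrightarrow> B M y \<Longrightarrow> B (M + 1) (x + y)"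
    and zero: "B 0 0"
    and coeffs: "\<And>m. m \<in> keys p \<Longrightarrow> B C (\<phi> (lookup p m))"
    and vars: "\<And>i. i \<in> mp_vars p \<Longrightarrow> B (s i) (g i)"
    and bound: "\<And>m. m \<in> keys p \<Longrightarrow> C + (\<Sum>i\<in>keys m. lookup m i * s i) \<le> T"
  shows "B (T + card (keys p)) (mp_insertion \<phi> g p)"
proof -
  have pow: "B (M + n * l) (c * a ^ n)" if "B l a" "B M c" for l M n a c
  proof (induction n)
    case (Suc n)
    from mult[OF Suc that(1)] show ?case by (simp add: algebra_simps)
  qed (use that in auto)
  have prod: "B (M + (\<Sum>i\<in>I. e i * s i)) (c * (\<Prod>i\<in>I. g i ^ e i))"
    if "finite I" "I \<subseteq> mp_vars p" "B M c" for I M c e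
    using that(1,2)
  proof (induction I rule: finite_induct)
    case (insert i I)
    then have "B (M + (\<Sum>i\<in>I. e i * s i)) (c * (\<Prod>i\<in>I. g i ^ e i))"
      by blast
    from pow[OF vars this, of i "e i"] insert.hyps insert.prems show ?case by (simp add: algebra_simps)
  qed (use that in auto)
  have sum: "B (T + card A) (\<Sum>m\<in>A. F m)"
    if "finite A" "\<And>m. m \<in> A \<Longrightarrow> B T (F m)" for A and F :: "(nat \<Rightarrow>\<^sub>0 nat) \<Rightarrow> 'b"
    using that
  proof (induction A rule: finite_induct)
    case (insert a A)
    have a: "B (T + card A) (F a)"
      by (rule mono[of T]) (use insert.prems in auto)
    have "B (T + card A) (\<Sum>m\<in>A. F m)"
      using insert by blast
    from add[OF a this] insert.hyps show ?case by simp
  qed (use mono[OF zero] in auto)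
  show ?thesis
    unfolding mp_insertion_def
  proof (rule sum)
    fix m assume m: "m \<in> keys p"
    from prod[OF _ _ coeffs[OF m], of "keys m" "lookup m"] m
    have "B (C + (\<Sum>i\<in>keys m. lookup m i * s i))
        (\<phi> (lookup p m) * (\<Prod>i\<in>keys m. g i ^ lookup m i))"
      by (auto simp: mp_vars_def)
    then show "B T (\<phi> (lookup p m) * (\<Prod>i\<in>keys m. g i ^ lookup m i))"
      by (rule mono) (rule bound[OF m])
  qed simp
qed

text \<open>The coefficient of x_j^t when p is read as a polynomial in x_j alone; the guard
  \<open>lookup m j = 0\<close> makes the coefficient free of x_j.\<close>

definition mp_coeff_in :: "nat \<Rightarrow> nat \<Rightarrow> mpoly \<Rightarrow> mpoly" where
  "mp_coeff_in j t p = Abs_poly_mapping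
     (\<lambda>m. if lookup m j = 0 then lookup p (m + Poly_Mapping.single j t) else 0)"

lemma lookup_mp_coeff_in:
  "lookup (mp_coeff_in j t p) m =
     (if lookup m j = 0 then lookup p (m + Poly_Mapping.single j t) else 0)"
proof -
  have "{m. (if lookup m j = 0 then lookup p (m + Poly_Mapping.single j t) else 0) \<noteq> 0}
      \<subseteq> (\<lambda>m. m - Poly_Mapping.single j t) ` keys p"
  proof
    fix m assume "m \<in> {m. (if lookup m j = 0 then lookup p (m + Poly_Mapping.single j t) else 0) \<noteq> 0}"
    then have "m + Poly_Mapping.single j t \<in> keys p"
      by (auto simp: in_keys_iff split: if_splits)
    then show "m \<in> (\<lambda>m. m - Poly_Mapping.single j t) ` keys p"
      by (metis add_diff_cancel_right' image_eqI)
  qed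
  then have "finite {m. (if lookup m j = 0 then lookup p (m + Poly_Mapping.single j t) else 0) \<noteq> 0}"
    by (rule finite_subset) simp
  then show ?thesis
    unfolding mp_coeff_in_def by (subst lookup_Abs_poly_mapping) simp_all
qed

lemma mp_degree_in_ge: "m \<in> keys p \<Longrightarrow> lookup m j \<le> mp_degree_in j p"
  unfolding mp_degree_in_def by (intro Max_ge) auto

lemma mp_degree_in_attained:
  assumes "p \<noteq> 0"
  obtains m where "m \<in> keys p" "lookup m j = mp_degree_in j p"
proof -
  have "mp_degree_in j p \<in> insert 0 ((\<lambda>m. lookup m j) ` keys p)"
    unfolding mp_degree_in_def by (rule Max_in) auto
  moreover obtain m0 where "m0 \<in> keys p"
    using assms by (metis all_not_in_conv keys_eq_empty)
  ultimately show thesis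
    using that mp_degree_in_ge[of m0 p j] by fastforce
qed

lemma poly_mapping_split_var:
  fixes m :: "nat \<Rightarrow>\<^sub>0 nat"
  obtains m' where "m = m' + Poly_Mapping.single j (lookup m j)" "lookup m' j = 0"
    "keys m' = keys m - {j}"
proof -
  let ?m = "m - Poly_Mapping.single j (lookup m j)"
  have l: "lookup ?m i = (if i = j then 0 else lookup m i)" for i
    by (auto simp: lookup_minus lookup_single when_def)
  have "m = ?m + Poly_Mapping.single j (lookup m j)"
    by (rule poly_mapping_eqI) (simp only: lookup_add l, simp add: lookup_single when_def)
  moreover have "keys ?m = keys m - {j}"
    unfolding set_eq_iff in_keys_iff l by (simp add: in_keys_iff)
  ultimately show thesis using that l by simp
qed

lemma mp_coeff_in_degree_nonzero:
  assumes "p \<noteq> 0"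
  shows "mp_coeff_in j (mp_degree_in j p) p \<noteq> 0"
proof -
  obtain m where m: "m \<in> keys p" "lookup m j = mp_degree_in j p"
    using mp_degree_in_attained[OF assms] .
  obtain m' where "m = m' + Poly_Mapping.single j (lookup m j)" "lookup m' j = 0"
    by (rule poly_mapping_split_var[of m j])
  with m have "lookup (mp_coeff_in j (mp_degree_in j p) p) m' \<noteq> 0"
    by (simp add: lookup_mp_coeff_in in_keys_iff)
  then show ?thesis by auto
qed

lemma mp_vars_coeff_in: "mp_vars (mp_coeff_in j t p) \<subseteq> mp_vars p - {j}"
proof
  fix i assume "i \<in> mp_vars (mp_coeff_in j t p)"
  then obtain m where m: "m \<in> keys (mp_coeff_in j t p)" "i \<in> keys m"
    by (auto simp: mp_vars_def)
  then have *: "lookup m j = 0" "m + Poly_Mapping.single j t \<in> keys p"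
    by (auto simp: in_keys_iff lookup_mp_coeff_in split: if_splits)
  moreover have "i \<in> keys (m + Poly_Mapping.single j t)" "i \<noteq> j"
    using m(2) *(1) by (auto simp: in_keys_iff lookup_add)
  ultimately show "i \<in> mp_vars p - {j}"
    by (auto simp: mp_vars_def)
qed

lemma mp_over_coeff_in: "mp_over K p \<Longrightarrow> 0 \<in> K \<Longrightarrow> mp_over K (mp_coeff_in j t p)"
  by (simp add: mp_over_def lookup_mp_coeff_in)

lemma mp_eval_coeff_in:
  assumes "mp_degree_in j p \<le> n"
  shows "mp_eval p x = (\<Sum>t\<le>n. mp_eval (mp_coeff_in j t p) x * x j ^ t)"
proof -
  have "mp_eval (mp_coeff_in j t p) x * x j ^ t
      = (\<Sum>m\<in>{m \<in> keys p. lookup m j = t}. lookup p m * mon_eval x m)" for t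
  proof -
    have "mp_eval (mp_coeff_in j t p) x * x j ^ t
        = (\<Sum>m\<in>keys (mp_coeff_in j t p). lookup p (m + Poly_Mapping.single j t)
            * mon_eval x (m + Poly_Mapping.single j t))"
      unfolding mp_eval_def mp_insertion_mon sum_distrib_right
      by (rule sum.cong)
        (auto simp: mon_eval_add mon_eval_single in_keys_iff lookup_mp_coeff_in)
    also have "\<dots> = (\<Sum>m\<in>{m \<in> keys p. lookup m j = t}. lookup p m * mon_eval x m)"
    proof (rule sum.reindex_bij_betw)
      show "bij_betw (\<lambda>m. m + Poly_Mapping.single j t) (keys (mp_coeff_in j t p))
          {m \<in> keys p. lookup m j = t}"
      proof (rule bij_betw_imageI)
        show "(\<lambda>m. m + Poly_Mapping.single j t) ` keys (mp_coeff_in j t p)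
            = {m \<in> keys p. lookup m j = t}"
        proof (intro equalityI subsetI)
          fix m assume "m \<in> {m \<in> keys p. lookup m j = t}"
          moreover obtain m' where "m = m' + Poly_Mapping.single j (lookup m j)" "lookup m' j = 0"
            by (rule poly_mapping_split_var[of m j])
          ultimately show "m \<in> (\<lambda>m. m + Poly_Mapping.single j t) ` keys (mp_coeff_in j t p)"
            by (intro image_eqI[of _ _ m']) (auto simp: in_keys_iff lookup_mp_coeff_in)
        qed (auto simp: in_keys_iff lookup_mp_coeff_in lookup_add split: if_splits)
      qed (auto simp: inj_on_def)
    qed
    finally show ?thesis .
  qed
  then have "(\<Sum>t\<le>n. mp_eval (mp_coeff_in j t p) x * x j ^ t)
      = (\<Sum>t\<le>n. \<Sum>m\<in>{m \<in> keys p. lookup m j = t}. lookup p m * mon_eval x m)"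
    by simp
  also have "\<dots> = (\<Sum>m\<in>keys p. lookup p m * mon_eval x m)"
    using assms mp_degree_in_ge[of _ p j] by (intro sum.group) (auto intro: le_trans)
  finally show ?thesis by (simp add: mp_eval_def mp_insertion_mon)
qed

text \<open>By induction on the variables: once the leading coefficient in one variable is nonzero
  at a point, only finitely many values of that variable are roots. The set X is arbitrary because
  later test points must have nonzero or positive integer coordinates.\<close>

lemma mp_nonzero_value:
  assumes "infinite X" "p \<noteq> 0"
  shows "\<exists>x. (\<forall>i. x i \<in> X) \<and> mp_eval p x \<noteq> 0"
proof -
  have "\<exists>x. (\<forall>i. x i \<in> X) \<and> mp_eval p x \<noteq> 0" if "finite V" "mp_vars p \<subseteq> V" "p \<noteq> 0" for V p
    using that
  proof (induction V arbitrary: p rule: finite_induct)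
    case empty
    obtain x0 where "x0 \<in> X" using assms(1) by (metis finite.emptyI ex_in_conv)
    obtain m where m: "m \<in> keys p" using empty by (metis all_not_in_conv keys_eq_empty)
    have "keys p \<subseteq> {0}" using empty by (auto simp: mp_vars_def)
    with m have "keys p = {0}" by auto
    then have "mp_eval p (\<lambda>_. x0) \<noteq> 0"
      by (auto simp: mp_eval_def mp_insertion_mon dest: in_keys_iff[THEN iffD1, of 0 p])
    with \<open>x0 \<in> X\<close> show ?case by (intro exI[of _ "\<lambda>_. x0"]) auto
  next
    case (insert j V)
    let ?n = "mp_degree_in j p"
    have "mp_vars (mp_coeff_in j ?n p) \<subseteq> V" using mp_vars_coeff_in[of j ?n p] insert.prems by auto
    from insert.IH[OF this mp_coeff_in_degree_nonzero[OF insert.prems(2)]]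
    obtain x where x: "\<forall>i. x i \<in> X" "mp_eval (mp_coeff_in j ?n p) x \<noteq> 0" by blast
    define c where "c t = mp_eval (mp_coeff_in j t p) x" for t
    have "finite {z. (\<Sum>t\<le>?n. c t * z ^ t) = 0}"
      by (rule polyfun_roots_finite[of c ?n ?n]) (use x in \<open>auto simp: c_def\<close>)
    with assms(1) obtain z where z: "z \<in> X" "(\<Sum>t\<le>?n. c t * z ^ t) \<noteq> 0"
      by (metis (mono_tags, lifting) finite_subset mem_Collect_eq subsetI)
    have "mp_eval (mp_coeff_in j t p) (x(j := z)) = c t" for t
      unfolding c_def by (rule mp_eval_cong) (use mp_vars_coeff_in[of j t p] in auto)
    with z have "mp_eval p (x(j := z)) \<noteq> 0"
      by (simp add: mp_eval_coeff_in[of j p ?n, OF order_refl])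
    with x z show ?case by (intro exI[of _ "x(j := z)"] conjI allI) (simp_all del: fun_upd_apply, simp)
  qed
  from this[of "mp_vars p"] assms(2) show ?thesis by simp
qed

section \<open>Degrees of iterates\<close>

lemma mpoly_no_zero_divisors:
  fixes p q :: mpoly
  shows "p * q = 0 \<longleftrightarrow> p = 0 \<or> q = 0"
  by simp

definition tdeg :: "(nat \<Rightarrow>\<^sub>0 nat) \<Rightarrow> nat" where
  "tdeg m = (\<Sum>i\<in>keys m. lookup m i)"

lemma tdeg_superset: "finite I \<Longrightarrow> keys m \<subseteq> I \<Longrightarrow> tdeg m = (\<Sum>i\<in>I. lookup m i)"
  unfolding tdeg_def by (rule sum.mono_neutral_left) (auto simp: in_keys_iff)

lemma tdeg_add: "tdeg (m + m') = tdeg m + tdeg m'"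
proof -
  let ?I = "keys m \<union> keys m'"
  have "tdeg (m + m') = (\<Sum>i\<in>?I. lookup (m + m') i)"
    by (rule tdeg_superset) (simp_all add: keys_add)
  then show ?thesis
    by (simp add: lookup_add sum.distrib tdeg_superset[of ?I])
qed

lemma tdeg_single [simp]: "tdeg (Poly_Mapping.single i n) = n"
  by (simp add: tdeg_superset[of "{i}"])

lemma mp_homogeneous_iff_tdeg: "mp_homogeneous d p \<longleftrightarrow> (\<forall>m\<in>keys p. tdeg m = d)"
  by (simp add: mp_homogeneous_def tdeg_def)

lemma keys_times_subset: "keys (p * q :: mpoly) \<subseteq> {m + m' | m m'. m \<in> keys p \<and> m' \<in> keys q}"
  using keys_mult[of p q] by auto

lemma mp_vars_plus: "mp_vars (p + q) \<subseteq> mp_vars p \<union> mp_vars q"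
  using keys_add[of p q] by (fastforce simp: mp_vars_def)

lemma mp_vars_times: "mp_vars (p * q) \<subseteq> mp_vars p \<union> mp_vars q"
proof
  fix i assume "i \<in> mp_vars (p * q)"
  then obtain m where "m \<in> keys (p * q)" "i \<in> keys m" by (auto simp: mp_vars_def)
  then obtain a b where "a \<in> keys p" "b \<in> keys q" "m = a + b" "i \<in> keys (a + b)"
    using keys_times_subset[of p q] by blast
  then show "i \<in> mp_vars p \<union> mp_vars q"
    using keys_add[of a b] by (auto simp: mp_vars_def)
qed

lemma mp_vars_subst:
  assumes "\<And>i. i \<in> mp_vars p \<Longrightarrow> mp_vars (G i) \<subseteq> V"
  shows "mp_vars (mp_subst p G) \<subseteq> V"
proof -
  have "mp_subst p G \<in> {q. mp_vars q \<subseteq> V}"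
    unfolding mp_subst_def
  proof (rule mp_insertion_closed)
    fix p q assume *: "p \<in> {q. mp_vars q \<subseteq> V}" "q \<in> {q. mp_vars q \<subseteq> V}"
    show "p + q \<in> {q. mp_vars q \<subseteq> V}" "p * q \<in> {q. mp_vars q \<subseteq> V}"
      using * mp_vars_plus[of p q] mp_vars_times[of p q] by auto
  qed (use assms in \<open>auto simp: mp_vars_def mp_const_def split: if_splits\<close>)
  then show ?thesis by simp
qed

lemma mp_eval_homogeneous:
  assumes "mp_homogeneous d p"
  shows "mp_eval p (\<lambda>i. c * x i) = c ^ d * mp_eval p x"
proof -
  have "mon_eval (\<lambda>i. c * x i) m = c ^ tdeg m * mon_eval x m" for m
    by (simp add: mon_eval_def tdeg_def power_mult_distrib prod.distrib power_sum)
  with assms show ?thesis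
    by (simp add: mp_eval_def mp_insertion_mon mp_homogeneous_iff_tdeg sum_distrib_left
        mult.left_commute)
qed

lemma mp_eval_at_zero_var:
  assumes "x j = 0"
  shows "mp_eval p x = mp_eval (mp_coeff_in j 0 p) x"
proof -
  have "mp_eval p x = (\<Sum>t\<le>mp_degree_in j p. mp_eval (mp_coeff_in j t p) x * x j ^ t)"
    by (rule mp_eval_coeff_in) simp
  also have "\<dots> = (\<Sum>t\<in>{0}. mp_eval (mp_coeff_in j t p) x * x j ^ t)"
    by (rule sum.mono_neutral_right) (use assms in auto)
  finally show ?thesis by simp
qed

section \<open>Divisibility by a variable\<close>

lemma mp_var_dvdI:
  assumes "\<And>m. m \<in> keys p \<Longrightarrow> lookup m j > 0"
  shows "mp_var j dvd p"
proof -
  have "mp_var j dvd Poly_Mapping.single m (lookup p m)" if "m \<in> keys p" for m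
  proof -
    have "Poly_Mapping.single j 1 + (m - Poly_Mapping.single j 1) = m"
      by (rule poly_mapping_eqI)
        (use assms[OF that] in \<open>auto simp: lookup_add lookup_minus lookup_single when_def\<close>)
    then have "Poly_Mapping.single m (lookup p m)
        = mp_var j * Poly_Mapping.single (m - Poly_Mapping.single j 1) (lookup p m)"
      by (simp add: mp_var_def mult_single)
    then show ?thesis by (rule dvdI)
  qed
  then have "mp_var j dvd (\<Sum>m\<in>keys p. Poly_Mapping.single m (lookup p m))"
    by (intro dvd_sum)
  then show ?thesis using mp_sum_singles by metis
qed

lemma mp_var_dvdD:
  assumes "mp_var j dvd p" "m \<in> keys p"
  shows "lookup m j > 0"
proof -
  from assms(1) obtain q where "p = mp_var j * q" by (elim dvdE)
  with assms(2) obtain a b where "a \<in> keys (mp_var j)" "m = a + b"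
    using keys_times_subset[of "mp_var j" q] by blast
  then show ?thesis by (simp add: mp_var_def lookup_add)
qed

text \<open>Setting x_j = 0 is multiplicative and kills a polynomial only if x_j divides it; as
  there are no zero divisors, x_j is prime.\<close>

lemma mp_var_dvd_mult:
  assumes "mp_var j dvd p * q"
  shows "mp_var j dvd p \<or> mp_var j dvd q"
proof (rule ccontr)
  have *: "mp_coeff_in j 0 r \<noteq> 0" if "\<not> mp_var j dvd r" for r
  proof -
    from that obtain m where "m \<in> keys r" "lookup m j = 0"
      using mp_var_dvdI by blast
    then have "lookup (mp_coeff_in j 0 r) m \<noteq> 0"
      by (simp add: lookup_mp_coeff_in in_keys_iff)
    then show ?thesis by auto
  qed
  assume "\<not> ?thesis"
  then have "mp_coeff_in j 0 p * mp_coeff_in j 0 q \<noteq> 0"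
    using * by (simp add: mpoly_no_zero_divisors)
  then obtain x where x: "mp_eval (mp_coeff_in j 0 p * mp_coeff_in j 0 q) x \<noteq> 0"
    using mp_nonzero_value[OF infinite_UNIV_char_0] by blast
  have "mp_eval (mp_coeff_in j 0 r) (x(j := 0)) = mp_eval (mp_coeff_in j 0 r) x" for r
    by (rule mp_eval_cong) (use mp_vars_coeff_in[of j 0 r] in auto)
  moreover have "mp_eval r (x(j := 0)) = mp_eval (mp_coeff_in j 0 r) (x(j := 0))" for r
    by (rule mp_eval_at_zero_var) simp
  ultimately have "mp_eval r (x(j := 0)) = mp_eval (mp_coeff_in j 0 r) x" for r
    by metis
  with x have "mp_eval (p * q) (x(j := 0)) \<noteq> 0"
    unfolding mp_eval_mult by (simp del: fun_upd_apply)
  moreover from assms obtain r where "p * q = mp_var j * r" by (elim dvdE)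
  ultimately show False by (simp add: mp_eval_mult mp_eval_var)
qed

lemma mp_var_nonzero [simp]: "mp_var j \<noteq> 0"
proof -
  have "lookup (mp_var j) (Poly_Mapping.single j 1) \<noteq> 0" by (simp add: mp_var_def)
  then show ?thesis by auto
qed

lemma mp_var_power_dvd_mult:
  assumes "mp_var j ^ D dvd p * q" "\<not> mp_var j dvd q"
  shows "mp_var j ^ D dvd p"
  using assms(1)
proof (induction D arbitrary: p)
  case (Suc D)
  then have "mp_var j dvd p * q" by (metis dvd_mult_left power_Suc)
  then obtain r where r: "p = mp_var j * r"
    using mp_var_dvd_mult assms(2) by (metis dvdE)
  with Suc.prems have "mp_var j * mp_var j ^ D dvd mp_var j * (r * q)"
    by (simp add: mult.assoc)
  then have "mp_var j ^ D dvd r * q" by (simp only: dvd_mult_cancel_left) simp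
  from Suc.IH[OF this] r show ?case by (simp add: mult_dvd_mono)
qed simp

text \<open>If q r = x_j^D and x_j does not divide q, all D factors x_j sit in r, and cancelling
  them leaves q a unit.\<close>

lemma dvd_mp_var_power_unit:
  assumes "q dvd mp_var j ^ D" "\<not> mp_var j dvd q"
  shows "q dvd 1"
proof -
  from assms(1) obtain r where r: "mp_var j ^ D = r * q" by (metis dvdE mult.commute)
  then have "mp_var j ^ D dvd r * q" by simp
  then have "mp_var j ^ D dvd r" using assms(2) by (rule mp_var_power_dvd_mult)
  then obtain s where "r = mp_var j ^ D * s" by (elim dvdE)
  with r have "mp_var j ^ D * 1 = mp_var j ^ D * (s * q)" by (simp add: mult.assoc)
  then have "1 = s * q" by (subst (asm) mult_left_cancel) auto
  then show ?thesis by (metis dvd_triv_right)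
qed

lemma lookup_single_times:
  "lookup (Poly_Mapping.single a 1 * (q :: mpoly)) (a + m) = lookup q m"
proof -
  have "Poly_Mapping.single a 1 * q
      = Poly_Mapping.single a 1 * (\<Sum>m'\<in>keys q. Poly_Mapping.single m' (lookup q m'))"
    by (rule arg_cong[OF mp_sum_singles])
  then have "lookup (Poly_Mapping.single a 1 * q) (a + m)
      = (\<Sum>m'\<in>keys q. if m' = m then lookup q m else 0)"
    by (simp add: sum_distrib_left mult_single lookup_sum lookup_single when_def)
  then show ?thesis by (simp add: in_keys_iff)
qed

lemma mp_var_power: "mp_var j ^ D = Poly_Mapping.single (Poly_Mapping.single j D) 1"
  by (induction D) (simp_all add: mp_var_def mult_single flip: single_add)

text \<open>The padding by x_0 uses truncated subtraction, so the result is homogeneous of degree D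
  only when D bounds the degree of p.\<close>

definition homogenize :: "nat \<Rightarrow> mpoly \<Rightarrow> mpoly" where
  "homogenize D p =
     (\<Sum>m\<in>keys p. Poly_Mapping.single (m + Poly_Mapping.single 0 (D - tdeg m)) (lookup p m))"

lemma keys_homogenize:
  assumes "m \<in> keys (homogenize D p)"
  obtains m' where "m' \<in> keys p" "m = m' + Poly_Mapping.single 0 (D - tdeg m')"
proof -
  let ?s = "\<lambda>m'. Poly_Mapping.single (m' + Poly_Mapping.single 0 (D - tdeg m')) (lookup p m')"
  from assms have "(\<Sum>m'\<in>keys p. lookup (?s m') m) \<noteq> 0"
    by (simp add: homogenize_def in_keys_iff lookup_sum)
  then obtain m' where m': "m' \<in> keys p" "lookup (?s m') m \<noteq> 0"
    by (meson sum.neutral)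
  from m'(2) have "m' + Poly_Mapping.single 0 (D - tdeg m') = m"
    by (simp add: lookup_single when_def split: if_splits)
  with m'(1) show thesis by (intro that) auto
qed

lemma mp_homogeneous_homogenize:
  assumes "\<And>m. m \<in> keys p \<Longrightarrow> tdeg m \<le> D"
  shows "mp_homogeneous D (homogenize D p)"
  unfolding mp_homogeneous_iff_tdeg
  by (auto elim!: keys_homogenize simp: tdeg_add assms)

lemma mp_vars_homogenize: "mp_vars (homogenize D p) \<subseteq> insert 0 (mp_vars p)"
proof
  fix i assume "i \<in> mp_vars (homogenize D p)"
  then obtain m where m: "m \<in> keys (homogenize D p)" "i \<in> keys m" by (auto simp: mp_vars_def)
  then obtain m' where "m' \<in> keys p" "m = m' + Poly_Mapping.single 0 (D - tdeg m')"
    by (rule_tac keys_homogenize)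
  then show "i \<in> insert 0 (mp_vars p)"
    using m(2) keys_add[of m' "Poly_Mapping.single 0 (D - tdeg m')"]
    by (auto simp: mp_vars_def split: if_splits)
qed

lemma mp_eval_homogenize:
  assumes "\<And>m. m \<in> keys p \<Longrightarrow> tdeg m \<le> D" "y 0 \<noteq> 0"
  shows "mp_eval (homogenize D p) y = y 0 ^ D * mp_eval p (\<lambda>i. y i / y 0)"
proof -
  have 1: "mon_eval (\<lambda>i. y i / y 0) m = mon_eval y m / y 0 ^ tdeg m" for m
    by (simp add: mon_eval_def tdeg_def power_divide prod_dividef power_sum)
  have "mp_eval (homogenize D p) y
      = (\<Sum>m\<in>keys p. lookup p m * (mon_eval y m * y 0 ^ (D - tdeg m)))"
    unfolding homogenize_def mp_eval_def mp_eval_hom.ins_sum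
    by (simp add: mp_eval_hom.ins_single mon_eval_add mon_eval_single)
  also have "\<dots> = (\<Sum>m\<in>keys p. y 0 ^ D * (lookup p m * mon_eval (\<lambda>i. y i / y 0) m))"
    by (rule sum.cong) (use assms in \<open>auto simp: 1 power_diff field_simps\<close>)
  finally show ?thesis by (simp add: mp_eval_def mp_insertion_mon sum_distrib_left)
qed

text \<open>A monomial of top degree receives no padding, and no other monomial can be padded into
  it, since it is free of x_0; so it survives and is not divisible by x_0.\<close>

lemma not_dvd_homogenize:
  assumes "m \<in> keys p" "tdeg m = D" "0 \<notin> mp_vars p"
  shows "\<not> mp_var 0 dvd homogenize D p"
proof
  assume dvd: "mp_var 0 dvd homogenize D p"
  have m0: "lookup m 0 = 0" using assms(1,3) by (auto simp: mp_vars_def in_keys_iff)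
  have "(m' + Poly_Mapping.single 0 (D - tdeg m') = m) \<longleftrightarrow> m' = m" if "m' \<in> keys p" for m'
  proof
    assume eq: "m' + Poly_Mapping.single 0 (D - tdeg m') = m"
    from arg_cong[OF this, of "\<lambda>m. lookup m 0"] m0 have "D - tdeg m' = 0"
      by (simp add: lookup_add)
    with eq show "m' = m" by simp
  qed (use assms in simp)
  then have "lookup (homogenize D p) m = (\<Sum>m'\<in>keys p. if m' = m then lookup p m else 0)"
    unfolding homogenize_def lookup_sum
    by (intro sum.cong) (auto simp: lookup_single when_def)
  then have "m \<in> keys (homogenize D p)"
    using assms(1) by (simp add: in_keys_iff)
  from mp_var_dvdD[OF dvd this] m0 show False by simp
qed

text \<open>The tuple of x_0^D and the homogenized A_i is coprime: a common divisor divides a power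
  of x_0, while x_0 does not divide the coordinate of top degree. Its proportionality to the
  unreduced iterate is a polynomial identity, so testing it at points over the infinite set X
  suffices.\<close>

theorem iterate_degree_eqI:
  fixes A :: "nat \<Rightarrow> mpoly"
  assumes vars: "\<And>i. i \<in> {1..N} \<Longrightarrow> mp_vars (A i) \<subseteq> {1..N}"
    and deg: "\<And>i m. i \<in> {1..N} \<Longrightarrow> m \<in> keys (A i) \<Longrightarrow> tdeg m \<le> D"
    and attained: "i0 \<in> {1..N}" "m0 \<in> keys (A i0)" "tdeg m0 = D"
    and X: "infinite X" "0 \<notin> X"
    and proportional: "\<And>y. (\<forall>i. y i \<in> X) \<Longrightarrow> \<exists>c. c \<noteq> 0 \<and> mp_eval (unreduced_iterate N F n 0) y = c \<and>
      (\<forall>i\<in>{1..N}. mp_eval (unreduced_iterate N F n i) y = c * mp_eval (A i) (\<lambda>i. y i / y 0))"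
  shows "iterate_degree N F n = D"
proof -
  define U where "U = unreduced_iterate N F n"
  define G where "G i = (if i = 0 then mp_var 0 ^ D else if i \<le> N then homogenize D (A i) else 0)" for i
  have G_eval: "mp_eval (G i) y = y 0 ^ D * (if i = 0 then 1 else mp_eval (A i) (\<lambda>i. y i / y 0))"
    if "i \<le> N" "y 0 \<noteq> 0" for i y
  proof (cases "i = 0")
    case False
    then have "mp_eval (homogenize D (A i)) y = y 0 ^ D * mp_eval (A i) (\<lambda>i. y i / y 0)"
      using that deg[of i] by (intro mp_eval_homogenize) auto
    with False that show ?thesis by (simp add: G_def)
  qed (simp add: G_def mp_var_power mp_eval_single mon_eval_single)
  have nd: "\<not> mp_var 0 dvd G i0"
  proof -
    have "0 \<notin> mp_vars (A i0)" using vars[OF attained(1)] by auto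
    from not_dvd_homogenize[OF attained(2,3) this] attained(1) show ?thesis by (simp add: G_def)
  qed
  have G: "rational_self_map N D G"
    unfolding rational_self_map_def
  proof (intro conjI allI impI)
    fix i assume "i \<le> N"
    then show "mp_vars (G i) \<subseteq> {..N}"
    proof (cases "i = 0")
      case False
      then have "mp_vars (A i) \<subseteq> {1..N}" using \<open>i \<le> N\<close> vars[of i] by simp
      then have "insert 0 (mp_vars (A i)) \<subseteq> {..N}" by auto
      with mp_vars_homogenize[of D "A i"] have "mp_vars (homogenize D (A i)) \<subseteq> {..N}" by blast
      with False \<open>i \<le> N\<close> show ?thesis by (simp add: G_def)
    qed (simp add: G_def mp_var_power mp_vars_def)
    show "mp_homogeneous D (G i)"
    proof (cases "i = 0")
      case False
      with \<open>i \<le> N\<close> deg[of i] have "mp_homogeneous D (homogenize D (A i))"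
        by (intro mp_homogeneous_homogenize) auto
      with False \<open>i \<le> N\<close> show ?thesis by (simp add: G_def)
    qed (simp add: G_def mp_var_power mp_homogeneous_iff_tdeg)
  next
    show "\<exists>i\<le>N. G i \<noteq> 0" by (rule exI[of _ 0]) (simp add: G_def)
  next
    fix q assume q: "\<forall>i\<le>N. q dvd G i"
    have "\<not> mp_var 0 dvd q"
      using q nd attained(1) dvd_trans by auto
    moreover have "q dvd mp_var 0 ^ D" using q by (auto simp: G_def dest: spec[of _ 0])
    ultimately show "q dvd 1" by (rule_tac dvd_mp_var_power_unit)
  qed (simp add: G_def)
  have proportional': "\<exists>c. c \<noteq> 0 \<and> (\<forall>i\<le>N. mp_eval (U i) y = c * (if i = 0 then 1 else mp_eval (A i) (\<lambda>i. y i / y 0)))"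
    if "\<forall>i. y i \<in> X" for y
  proof -
    from proportional[OF that] obtain c where "c \<noteq> 0" "mp_eval (U 0) y = c"
      "\<forall>i\<in>{1..N}. mp_eval (U i) y = c * mp_eval (A i) (\<lambda>i. y i / y 0)"
      unfolding U_def by blast
    then show ?thesis by (intro exI[of _ c]) auto
  qed
  have GU: "G i * U j = G j * U i" if "i \<le> N" "j \<le> N" for i j
  proof (rule ccontr)
    assume "\<not> ?thesis"
    then obtain y where y: "\<forall>i. y i \<in> X" "mp_eval (G i * U j - G j * U i) y \<noteq> 0"
      using mp_nonzero_value[OF X(1), of "G i * U j - G j * U i"] by auto
    moreover have "y 0 \<noteq> 0" using y X(2) by metis
    moreover obtain c where "\<forall>i\<le>N. mp_eval (U i) y = c * (if i = 0 then 1 else mp_eval (A i) (\<lambda>i. y i / y 0))"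
      using proportional'[OF y(1)] by blast
    ultimately show False
      using that by (simp add: mp_eval_diff mp_eval_mult G_eval)
  qed
  have U0: "U 0 \<noteq> 0"
  proof
    assume "U 0 = 0"
    moreover obtain a where "a \<in> X" using X(1) by (metis finite.emptyI ex_in_conv)
    moreover from \<open>a \<in> X\<close> obtain c where
      "c \<noteq> 0" "\<forall>i\<le>N. mp_eval (U i) (\<lambda>_. a) = c * (if i = 0 then 1 else mp_eval (A i) (\<lambda>i. a / a))"
      using proportional'[of "\<lambda>_. a"] by blast
    ultimately show False by (auto dest: spec[of _ 0])
  qed
  show ?thesis
    unfolding iterate_degree_def
  proof (rule the_equality)
    show "\<exists>G. rational_self_map N D G \<and>
      (\<forall>i\<le>N. \<forall>j\<le>N. G i * unreduced_iterate N F n j = G j * unreduced_iterate N F n i)"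
      using G GU unfolding U_def by blast
  next
    fix d' assume "\<exists>G. rational_self_map N d' G \<and>
      (\<forall>i\<le>N. \<forall>j\<le>N. G i * unreduced_iterate N F n j = G j * unreduced_iterate N F n i)"
    then obtain H where H: "rational_self_map N d' H" "\<And>i j. i \<le> N \<Longrightarrow> j \<le> N \<Longrightarrow> H i * U j = H j * U i"
      unfolding U_def by blast
    \<comment> \<open>Both tuples are proportional to U; cancelling U 0 makes them proportional to
      each other.\<close>
    have HG: "H i * mp_var 0 ^ D = H 0 * G i" if "i \<le> N" for i
    proof -
      have "(H i * G 0) * U 0 = G 0 * (H i * U 0)" by (simp only: ac_simps)
      also have "\<dots> = H 0 * (G 0 * U i)"
        by (simp only: H(2)[OF that le0]) (simp only: ac_simps)
      also have "\<dots> = (H 0 * G i) * U 0"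
        by (simp only: GU[OF le0 that]) (simp only: ac_simps)
      finally have "(H i * G 0) * U 0 = (H 0 * G i) * U 0" .
      then have "H i * G 0 = H 0 * G i" using U0 by (subst (asm) mult_right_cancel) auto
      then show ?thesis by (simp add: G_def)
    qed
    have "i0 \<le> N" using attained(1) by simp
    have "mp_var 0 ^ D dvd H 0 * G i0"
      using HG[OF \<open>i0 \<le> N\<close>] by (metis dvd_triv_right)
    then have "mp_var 0 ^ D dvd H 0" using nd by (rule mp_var_power_dvd_mult)
    then obtain q where q: "H 0 = mp_var 0 ^ D * q" by (elim dvdE)
    have "H i = q * G i" if "i \<le> N" for i
    proof -
      have "mp_var 0 ^ D * H i = mp_var 0 ^ D * (q * G i)"
        using HG[OF that] unfolding q by (simp only: ac_simps)
      then show ?thesis by (subst (asm) mult_left_cancel) auto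
    qed
    then have "\<forall>i\<le>N. q dvd H i" by auto
    then have "q dvd 1" using H(1) by (auto simp: rational_self_map_def)
    then obtain r where "1 = q * r" by (elim dvdE)
    \<comment> \<open>A unit has a nonzero constant term, so x_0^D really occurs in H 0, and the
      degree of H can be read off from this monomial.\<close>
    then have "mp_eval q (\<lambda>_. 0) * mp_eval r (\<lambda>_. 0) = mp_eval 1 (\<lambda>_. 0)" by (metis mp_eval_mult)
    then have "lookup q 0 \<noteq> 0" by (auto simp: mp_eval_zero_point)
    moreover have "lookup (H 0) (Poly_Mapping.single 0 D) = lookup q 0"
      using q lookup_single_times[of "Poly_Mapping.single 0 D" q 0] by (simp add: mp_var_power)
    ultimately have "Poly_Mapping.single 0 D \<in> keys (H 0)" by (simp add: in_keys_iff)
    moreover have "mp_homogeneous d' (H 0)" using H(1) by (simp add: rational_self_map_def)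
    ultimately have "tdeg (Poly_Mapping.single 0 D) = d'"
      unfolding mp_homogeneous_iff_tdeg by blast
    then show "d' = D" by simp
  qed
qed

section \<open>Number fields\<close>

locale complex_subfield_loc =
  fixes K :: "complex set"
  assumes subfield: "complex_subfield K"
begin

lemma zero_mem: "0 \<in> K" and one_mem: "1 \<in> K"
  and add_mem: "x \<in> K \<Longrightarrow> y \<in> K \<Longrightarrow> x + y \<in> K"
  and diff_mem: "x \<in> K \<Longrightarrow> y \<in> K \<Longrightarrow> x - y \<in> K"
  and mult_mem: "x \<in> K \<Longrightarrow> y \<in> K \<Longrightarrow> x * y \<in> K"
  and inverse_mem: "x \<in> K \<Longrightarrow> inverse x \<in> K"
  using subfield by (auto simp: complex_subfield_def)

lemma uminus_mem: "x \<in> K \<Longrightarrow> - x \<in> K"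
  using diff_mem[OF zero_mem] by auto

lemma divide_mem: "x \<in> K \<Longrightarrow> y \<in> K \<Longrightarrow> x / y \<in> K"
  by (simp add: divide_inverse mult_mem inverse_mem)

lemma power_mem: "x \<in> K \<Longrightarrow> x ^ n \<in> K"
  by (induction n) (auto simp: one_mem mult_mem)

lemma sum_mem: "(\<And>a. a \<in> A \<Longrightarrow> f a \<in> K) \<Longrightarrow> sum f A \<in> K"
  by (induction A rule: infinite_finite_induct) (auto simp: zero_mem add_mem)

lemma of_nat_mem: "of_nat n \<in> K"
  by (induction n) (auto simp: zero_mem one_mem add_mem)

lemma of_int_mem: "of_int n \<in> K"
  by (cases n) (auto simp: of_nat_mem uminus_mem simp del: of_nat_Suc)

lemma of_rat_mem: "of_rat q \<in> K"
  by (induction q) (auto simp: of_rat_rat divide_mem of_int_mem)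

lemma subspace: "rat_vs.subspace K"
  by (auto simp: rat_vs.subspace_def zero_mem add_mem mult_mem of_rat_mem)

end

lemma complex_subfield_locI: "complex_subfield K \<Longrightarrow> complex_subfield_loc K"
  by unfold_locales

lemma number_field_locI: "number_field K \<Longrightarrow> complex_subfield_loc K"
  by unfold_locales (simp add: number_field_def)

section \<open>Linear algebra over the rationals and finite extensions\<close>

lemma rat_span_finite: "finite B \<Longrightarrow> x \<in> rat_vs.span B \<longleftrightarrow> (\<exists>u. x = (\<Sum>b\<in>B. of_rat (u b) * b))"
  by (auto simp: rat_vs.span_finite)

lemma number_field_basis:
  assumes "number_field L"
  obtains B where "finite B" "B \<subseteq> L" "L = rat_vs.span B" "card B = rat_vs.dim L"
proof -
  interpret complex_subfield_loc L using assms by (rule number_field_locI)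
  obtain C where C: "finite C" "L \<subseteq> rat_vs.span C" using assms by (auto simp: number_field_def)
  obtain B where B: "B \<subseteq> L" "rat_vs.independent B" "L \<subseteq> rat_vs.span B" "card B = rat_vs.dim L"
    using rat_vs.basis_exists by blast
  have "finite B" using rat_vs.independent_span_bound[OF C(1) B(2)] B(1) C(2) by blast
  moreover have "rat_vs.span B \<subseteq> L" using B(1) subspace by (rule rat_vs.span_minimal)
  ultimately show thesis using B by (intro that) auto
qed

text \<open>Dependence is a notion for sets, so a repeated value is treated apart: there the
  relation y_i - y_j = 0 does the job. Otherwise n + 1 distinct vectors are too many for the
  spanning set.\<close>

lemma rat_dependent_family:
  assumes "finite B" "\<And>i. i \<le> n \<Longrightarrow> y i \<in> rat_vs.span B" "card B \<le> n"
  shows "\<exists>c :: nat \<Rightarrow> rat. (\<exists>i\<le>n. c i \<noteq> 0) \<and> (\<Sum>i\<le>n. of_rat (c i) * y i) = 0"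
proof (cases "inj_on y {..n}")
  case False
  then obtain i j where ij: "i \<le> n" "j \<le> n" "i \<noteq> j" "y i = y j" by (auto simp: inj_on_def)
  define c :: "nat \<Rightarrow> rat" where "c l = (if l = i then 1 else if l = j then - 1 else 0)" for l
  have "(\<Sum>l\<le>n. of_rat (c l) * y l) = (\<Sum>l\<in>{i, j}. of_rat (c l) * y l)"
    by (rule sum.mono_neutral_right) (use ij in \<open>auto simp: c_def\<close>)
  also have "\<dots> = 0" using ij by (simp add: c_def)
  finally show ?thesis using ij by (intro exI[of _ c]) (auto simp: c_def)
next
  case True
  have "rat_vs.dependent (y ` {..n})"
  proof (rule ccontr)
    assume "rat_vs.independent (y ` {..n})"
    from rat_vs.independent_span_bound[OF assms(1) this] assms(2)
    have "card (y ` {..n}) \<le> card B" by auto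
    with assms(3) card_image[OF True] show False by simp
  qed
  then obtain u where u: "\<exists>v\<in>y ` {..n}. u v \<noteq> 0" "(\<Sum>v\<in>y ` {..n}. of_rat (u v) * v) = 0"
    by (auto simp: rat_vs.dependent_finite)
  then show ?thesis
    by (intro exI[of _ "u \<circ> y"]) (auto simp: sum.reindex[OF True])
qed

text \<open>A rational relation among the powers of x, divided by its lowest power of x, has a
  nonzero constant term; solving for that term writes the inverse as a polynomial in x.\<close>

lemma rat_algebraic_inverse:
  assumes "finite B" "\<And>i. x ^ i \<in> rat_vs.span B" "x \<noteq> 0"
  shows "\<exists>(c :: nat \<Rightarrow> rat) n. inverse x = (\<Sum>i<n. of_rat (c i) * x ^ i)"
proof -
  obtain c :: "nat \<Rightarrow> rat" where c: "\<exists>i\<le>card B. c i \<noteq> 0" "(\<Sum>i\<le>card B. of_rat (c i) * x ^ i) = 0"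
    using rat_dependent_family[OF assms(1), of "card B" "\<lambda>i. x ^ i"] assms(2) by auto
  define r where "r = (LEAST i. c i \<noteq> 0)"
  have r: "c r \<noteq> 0" "r \<le> card B" "\<And>i. i < r \<Longrightarrow> c i = 0"
  proof -
    from c(1) obtain i where i: "i \<le> card B" "c i \<noteq> 0" by blast
    show "c r \<noteq> 0" unfolding r_def by (rule LeastI[of "\<lambda>i. c i \<noteq> 0", OF i(2)])
    show "r \<le> card B" unfolding r_def using Least_le[of "\<lambda>i. c i \<noteq> 0", OF i(2)] i(1) by simp
    show "c i = 0" if "i < r" for i using not_less_Least[of i "\<lambda>i. c i \<noteq> 0"] that by (auto simp: r_def)
  qed
  define n where "n = card B - r"
  have "(\<Sum>i\<le>card B. of_rat (c i) * x ^ i) = (\<Sum>i\<in>{r..card B}. of_rat (c i) * x ^ i)"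
    by (rule sum.mono_neutral_right) (use r(3) in \<open>auto simp: not_le\<close>)
  also have "\<dots> = of_rat (c r) * x ^ r + (\<Sum>i\<in>{Suc r..card B}. of_rat (c i) * x ^ i)"
    by (rule sum.atLeast_Suc_atMost[OF r(2)])
  also have "(\<Sum>i\<in>{Suc r..card B}. of_rat (c i) * x ^ i)
      = (\<Sum>i<n. of_rat (c (i + Suc r)) * x ^ (i + Suc r))"
    by (rule sum.reindex_bij_witness[of _ "\<lambda>i. i + Suc r" "\<lambda>i. i - Suc r"]) (auto simp: n_def)
  also have "\<dots> = x ^ r * (x * (\<Sum>i<n. of_rat (c (i + Suc r)) * x ^ i))"
    by (simp add: sum_distrib_left power_add algebra_simps)
  finally have "x ^ r * (of_rat (c r) + x * (\<Sum>i<n. of_rat (c (i + Suc r)) * x ^ i)) = 0"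
    using c(2) by (simp add: algebra_simps)
  then have "x * (\<Sum>i<n. of_rat (c (i + Suc r)) * x ^ i) = - of_rat (c r)"
    using assms(3) by (simp add: eq_neg_iff_add_eq_0 add.commute)
  then have "inverse x = - inverse (of_rat (c r)) * (\<Sum>i<n. of_rat (c (i + Suc r)) * x ^ i)"
    using r(1) assms(3) by (simp add: field_simps)
  also have "\<dots> = (\<Sum>i<n. of_rat (- inverse (c r) * c (i + Suc r)) * x ^ i)"
    by (simp add: sum_distrib_left of_rat_mult of_rat_minus of_rat_inverse mult.assoc)
  finally show ?thesis by (intro exI[of _ "\<lambda>i. - inverse (c r) * c (i + Suc r)"] exI[of _ n]) simp
qed

text \<open>A finite-dimensional rational algebra of complex numbers is a field, since the inverse
  of an element is a polynomial in it.\<close>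

lemma number_fieldI:
  assumes sub: "rat_vs.subspace R" and mult: "\<And>x y. x \<in> R \<Longrightarrow> y \<in> R \<Longrightarrow> x * y \<in> R"
    and one: "1 \<in> R" and fin: "finite B" "R \<subseteq> rat_vs.span B"
  shows "number_field R"
  unfolding number_field_def complex_subfield_def
proof (intro conjI ballI)
  fix x assume x: "x \<in> R"
  have pow: "x ^ i \<in> R" for i by (induction i) (auto simp: one mult x)
  show "inverse x \<in> R"
  proof (cases "x = 0")
    case False
    have "x ^ i \<in> rat_vs.span B" for i using pow fin(2) by auto
    from rat_algebraic_inverse[OF fin(1) this False] obtain c :: "nat \<Rightarrow> rat" and n
      where "inverse x = (\<Sum>i<n. of_rat (c i) * x ^ i)" by auto
    also have "\<dots> \<in> R"
      by (intro rat_vs.subspace_sum[OF sub] rat_vs.subspace_scale[OF sub] pow)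
    finally show ?thesis .
  qed (use rat_vs.subspace_0[OF sub] in simp)
qed (use assms in \<open>auto simp: rat_vs.subspace_0 rat_vs.subspace_add rat_vs.subspace_diff\<close>)

text \<open>The ring L[z] is spanned by the powers of z below deg p, because p expresses z^n by
  lower powers. The polynomial p may be reducible: finite dimension alone provides the
  inverses.\<close>

lemma number_field_adjoin:
  assumes "number_field L" "p \<noteq> 0" "\<And>i. coeff p i \<in> L" "poly p z = 0"
  shows "\<exists>L'. number_field L' \<and> L \<subseteq> L' \<and> z \<in> L'"
proof -
  interpret complex_subfield_loc L using assms(1) by (rule number_field_locI)
  obtain B where B: "finite B" "L = rat_vs.span B" using number_field_basis[OF assms(1)] by metis
  define n where "n = degree p"
  have n: "n > 0" 
  proof (rule ccontr)
    assume "\<not> n > 0"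
    then obtain c where "p = [:c:]" unfolding n_def by (auto elim: degree_eq_zeroE)
    with assms(2,4) show False by simp
  qed
  define R where "R = {(\<Sum>i<n. a i * z ^ i) | a. \<forall>i. a i \<in> L}"
  have RI: "(\<Sum>i<n. a i * z ^ i) \<in> R" if "\<And>i. a i \<in> L" for a using that by (auto simp: R_def)
  have R_add: "x + y \<in> R" if "x \<in> R" "y \<in> R" for x y
  proof -
    from that obtain a b where "\<forall>i. a i \<in> L" "x = (\<Sum>i<n. a i * z ^ i)" "\<forall>i. b i \<in> L" "y = (\<Sum>i<n. b i * z ^ i)"
      unfolding R_def by auto
    with RI[of "\<lambda>i. a i + b i"] show ?thesis by (simp add: add_mem sum.distrib distrib_right)
  qed
  have R_smult: "c * x \<in> R" if "c \<in> L" "x \<in> R" for c x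
  proof -
    from that obtain a where "\<forall>i. a i \<in> L" "x = (\<Sum>i<n. a i * z ^ i)" unfolding R_def by auto
    with RI[of "\<lambda>i. c * a i"] that show ?thesis by (simp add: mult_mem sum_distrib_left mult.assoc)
  qed
  have R_0: "0 \<in> R" using RI[of "\<lambda>_. 0"] by (simp add: zero_mem)
  have R_sum: "sum g A \<in> R" if "\<And>a. a \<in> A \<Longrightarrow> g a \<in> R" for g :: "nat \<Rightarrow> complex" and A
    using that by (induction A rule: infinite_finite_induct) (auto simp: R_0 R_add)
  have R_pow: "z ^ i \<in> R" if "i < n" for i
  proof -
    have "(\<Sum>j<n. (if j = i then 1 else 0) * z ^ j) \<in> R" by (rule RI) (auto simp: zero_mem one_mem)
    moreover have "(\<Sum>j<n. (if j = i then 1 else 0) * z ^ j) = z ^ i"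
      using that by (simp add: if_distrib[of "\<lambda>x. x * _"] cong: if_cong)
    ultimately show ?thesis by simp
  qed
  have zn: "z ^ n \<in> R"
  proof -
    have lc: "coeff p n \<noteq> 0" using assms(2) by (simp add: n_def)
    have "0 = (\<Sum>i\<le>n. coeff p i * z ^ i)" using assms(4) by (simp add: poly_altdef n_def)
    also have "\<dots> = (\<Sum>i<n. coeff p i * z ^ i) + coeff p n * z ^ n"
      by (simp flip: lessThan_Suc_atMost)
    finally have "z ^ n = (- inverse (coeff p n)) * (\<Sum>i<n. coeff p i * z ^ i)"
      using lc by (simp add: field_simps eq_neg_iff_add_eq_0)
    also have "\<dots> \<in> R" by (intro R_smult RI uminus_mem inverse_mem assms)
    finally show ?thesis .
  qed
  have R_z: "z * x \<in> R" if "x \<in> R" for x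
  proof -
    from that obtain a where a: "\<forall>i. a i \<in> L" "x = (\<Sum>i<n. a i * z ^ i)" unfolding R_def by auto
    have "z * x = (\<Sum>i<n. a i * z ^ Suc i)" by (simp add: a sum_distrib_left algebra_simps)
    also have "\<dots> \<in> R"
    proof (intro R_sum R_smult)
      fix i assume "i \<in> {..<n}"
      then show "z ^ Suc i \<in> R" using R_pow[of "Suc i"] zn by (cases "Suc i = n") auto
    qed (use a in auto)
    finally show ?thesis .
  qed
  have R_zi: "z ^ i * x \<in> R" if "x \<in> R" for i x
    by (induction i) (use that R_z in \<open>auto simp: mult.assoc\<close>)
  have R_mult: "x * y \<in> R" if "x \<in> R" "y \<in> R" for x y
  proof -
    from that obtain a where a: "\<forall>i. a i \<in> L" "x = (\<Sum>i<n. a i * z ^ i)" unfolding R_def by auto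
    have "x * y = (\<Sum>i<n. a i * (z ^ i * y))" by (simp add: a sum_distrib_right mult.assoc)
    also have "\<dots> \<in> R" by (intro R_sum R_smult R_zi) (use a that in auto)
    finally show ?thesis .
  qed
  let ?C = "(\<lambda>(b, i). b * z ^ i) ` (B \<times> {..<n})"
  have "number_field R"
  proof (rule number_fieldI)
    show "rat_vs.subspace R"
      unfolding rat_vs.subspace_def using R_0 R_add R_smult of_rat_mem by auto
    show "R \<subseteq> rat_vs.span ?C"
    proof
      fix x assume "x \<in> R"
      then obtain a where a: "\<forall>i. a i \<in> L" "x = (\<Sum>i<n. a i * z ^ i)" unfolding R_def by auto
      show "x \<in> rat_vs.span ?C"
        unfolding a(2)
      proof (rule rat_vs.span_sum)
        fix i assume i: "i \<in> {..<n}"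
        obtain u where "a i = (\<Sum>b\<in>B. of_rat (u b) * b)"
          using a(1) B rat_span_finite by blast
        then have "a i * z ^ i = (\<Sum>b\<in>B. of_rat (u b) * (b * z ^ i))"
          by (simp add: sum_distrib_right mult.assoc)
        also have "\<dots> \<in> rat_vs.span ?C"
          by (intro rat_vs.span_sum rat_vs.span_scale rat_vs.span_base) (use i in auto)
        finally show "a i * z ^ i \<in> rat_vs.span ?C" .
      qed
    qed
    show "1 \<in> R" using R_pow[OF n] by simp
  qed (use B R_mult in auto)
  moreover have "L \<subseteq> R"
  proof
    fix c assume "c \<in> L"
    with R_smult[OF this R_pow[OF n]] show "c \<in> R" by simp
  qed
  moreover have "z \<in> R" using R_z[OF R_pow[OF n]] by simp
  ultimately show ?thesis by blast
qed

text \<open>Elements of any number field are roots of rational polynomials, and the rationals lie in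
  k; L and k may be incomparable.\<close>

lemma number_field_subset_alg_closure:
  assumes "number_field L" "complex_subfield k"
  shows "L \<subseteq> alg_closure_of k"
proof
  fix z assume z: "z \<in> L"
  interpret complex_subfield_loc L using assms(1) by (rule number_field_locI)
  interpret k: complex_subfield_loc k using assms(2) by (rule complex_subfield_locI)
  obtain B where B: "finite B" "L = rat_vs.span B" using number_field_basis[OF assms(1)] by metis
  obtain c :: "nat \<Rightarrow> rat" where c: "\<exists>i\<le>card B. c i \<noteq> 0" "(\<Sum>i\<le>card B. of_rat (c i) * z ^ i) = 0"
    using rat_dependent_family[OF B(1), of "card B" "\<lambda>i. z ^ i"] power_mem[OF z] B(2) by auto
  define p :: "complex poly" where "p = (\<Sum>i\<le>card B. monom (of_rat (c i)) i)"
  have cf: "coeff p j = (if j \<le> card B then of_rat (c j) else 0)" for j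
    by (simp add: p_def coeff_sum)
  then have "p \<noteq> 0" using c(1) by (metis coeff_0 of_rat_eq_0_iff)
  moreover have "poly p z = 0" using c(2) by (simp add: p_def poly_sum poly_monom)
  ultimately show "z \<in> alg_closure_of k"
    unfolding alg_closure_of_def using cf k.of_rat_mem k.zero_mem by (auto intro!: exI[of _ p])
qed

lemma number_field_adjoin_finite:
  assumes "number_field L" "k \<subseteq> L" "finite X" "X \<subseteq> alg_closure_of k"
  shows "\<exists>L'. number_field L' \<and> L \<subseteq> L' \<and> X \<subseteq> L'"
  using assms(3,4)
proof (induction X rule: finite_induct)
  case (insert z X)
  then obtain L' where L': "number_field L'" "L \<subseteq> L'" "X \<subseteq> L'" by auto
  from insert.prems obtain p where "p \<noteq> 0" "\<forall>i. coeff p i \<in> k" "poly p z = 0"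
    by (auto simp: alg_closure_of_def)
  then obtain L'' where "number_field L''" "L' \<subseteq> L''" "z \<in> L''"
    using number_field_adjoin[OF L'(1), of p z] L'(2) assms(2) by blast
  with L' show ?case by blast
qed (use assms in auto)

text \<open>Any two algebraic elements lie in a common number field inside the closure, where the
  field operations are available.\<close>

lemma alg_closure_subfield:
  assumes "number_field k"
  shows "complex_subfield (alg_closure_of k)"
proof -
  have sf: "complex_subfield k" using assms by (simp add: number_field_def)
  have *: "\<exists>L. complex_subfield_loc L \<and> L \<subseteq> alg_closure_of k \<and> x \<in> L \<and> y \<in> L"
    if "x \<in> alg_closure_of k" "y \<in> alg_closure_of k" for x y
    using number_field_adjoin_finite[OF assms, of k "{x, y}"] that
      number_field_subset_alg_closure[OF _ sf] number_field_locI by blast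
  interpret complex_subfield_loc k using sf by (rule complex_subfield_locI)
  have "k \<subseteq> alg_closure_of k" by (rule number_field_subset_alg_closure[OF assms sf])
  show ?thesis
    unfolding complex_subfield_def
  proof (intro conjI ballI)
    fix x y assume "x \<in> alg_closure_of k" "y \<in> alg_closure_of k"
    from *[OF this] obtain L where L: "complex_subfield_loc L" "L \<subseteq> alg_closure_of k" "x \<in> L" "y \<in> L"
      by blast
    interpret L: complex_subfield_loc L by (rule L(1))
    show "x + y \<in> alg_closure_of k" "x - y \<in> alg_closure_of k" "x * y \<in> alg_closure_of k"
      using L L.add_mem L.diff_mem L.mult_mem by auto
  next
    fix x assume "x \<in> alg_closure_of k"
    from *[OF this this] obtain L where L: "complex_subfield_loc L" "L \<subseteq> alg_closure_of k" "x \<in> L"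
      by blast
    then show "inverse x \<in> alg_closure_of k" using complex_subfield_loc.inverse_mem by blast
  qed (use \<open>k \<subseteq> alg_closure_of k\<close> zero_mem one_mem in auto)
qed

subsection \<open>Square roots outside a number field\<close>

text \<open>Inverses come from the conjugate: for b \<noteq> 0 the norm a^2 - b^2 s^2 could only
  vanish if s = a / b or s = - a / b, which would put s into F.\<close>

lemma quadratic_extension_subfield:
  assumes "complex_subfield F" "s\<^sup>2 \<in> F" "s \<notin> F"
  shows "complex_subfield {a + b * s | a b. a \<in> F \<and> b \<in> F}" (is "complex_subfield ?E")
proof -
  interpret complex_subfield_loc F using assms(1) by (rule complex_subfield_locI)
  have I: "a + b * s \<in> ?E" if "a \<in> F" "b \<in> F" for a b using that by blast
  show ?thesis
    unfolding complex_subfield_def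
  proof (intro conjI ballI)
    show "0 \<in> ?E" using I[OF zero_mem zero_mem] by simp
    show "1 \<in> ?E" using I[OF one_mem zero_mem] by simp
  next
    fix x y assume "x \<in> ?E" "y \<in> ?E"
    then obtain a b c d where abcd: "a \<in> F" "b \<in> F" "c \<in> F" "d \<in> F" "x = a + b * s" "y = c + d * s"
      by blast
    show "x + y \<in> ?E" using I[of "a + c" "b + d"] abcd by (simp add: add_mem algebra_simps)
    show "x - y \<in> ?E" using I[of "a - c" "b - d"] abcd by (simp add: diff_mem algebra_simps)
    have "x * y = (a * c + b * d * s\<^sup>2) + (a * d + b * c) * s"
      unfolding abcd by (simp add: algebra_simps power2_eq_square)
    then show "x * y \<in> ?E" using I[of "a * c + b * d * s\<^sup>2" "a * d + b * c"] abcd assms(2)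
      by (simp add: add_mem mult_mem)
  next
    fix x assume "x \<in> ?E"
    then obtain a b where ab: "a \<in> F" "b \<in> F" "x = a + b * s" by blast
    define D where "D = a\<^sup>2 - b\<^sup>2 * s\<^sup>2"
    have DF: "D \<in> F" unfolding D_def using ab assms(2) by (simp add: diff_mem mult_mem power_mem)
    show "inverse x \<in> ?E"
    proof (cases "b = 0")
      case True
      then show ?thesis using I[of "inverse a" 0] ab by (simp add: inverse_mem zero_mem)
    next
      case b: False
      have fac: "D = (a + b * s) * (a - b * s)" by (simp add: D_def algebra_simps power2_eq_square)
      have "D \<noteq> 0"
      proof
        assume "D = 0"
        then have "a + b * s = 0 \<or> a - b * s = 0" unfolding fac by simp
        then have "s = - (a / b) \<or> s = a / b"
        proof
          assume "a + b * s = 0"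
          then have "b * s = - a" by (simp add: eq_neg_iff_add_eq_0 add.commute)
          with b have "s = - a / b" by (metis nonzero_mult_div_cancel_left)
          then show ?thesis by simp
        next
          assume "a - b * s = 0"
          then have "b * s = a" by simp
          with b have "s = a / b" by (metis nonzero_mult_div_cancel_left)
          then show ?thesis by simp
        qed
        then have "s \<in> F" using ab by (auto simp: uminus_mem divide_mem)
        with assms(3) show False by simp
      qed
      then have "inverse x = a / D + (- b / D) * s"
      proof -
        have "x * (a / D + (- b / D) * s) = (a + b * s) * (a - b * s) / D"
          unfolding ab(3) by (simp add: diff_divide_distrib right_diff_distrib)
        also have "\<dots> = 1" using \<open>D \<noteq> 0\<close> fac by simp
        finally show ?thesis by (rule inverse_unique)
      qed
      then show ?thesis using I[of "a / D" "- b / D"] ab DF by (simp add: divide_mem uminus_mem)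
    qed
  qed
qed

text \<open>For t = a + b s the term 2 a b s of t^2 has to disappear, so a = 0 or b = 0.\<close>

lemma quadratic_extension_sqrt:
  assumes "complex_subfield F" "s\<^sup>2 \<in> F" "s \<notin> F" "t \<in> {a + b * s | a b. a \<in> F \<and> b \<in> F}" "t\<^sup>2 \<in> F"
  shows "t \<in> F \<or> t * s \<in> F"
proof -
  interpret complex_subfield_loc F using assms(1) by (rule complex_subfield_locI)
  obtain a b where ab: "a \<in> F" "b \<in> F" "t = a + b * s" using assms(4) by blast
  have "a = 0 \<or> b = 0"
  proof (rule ccontr)
    assume nz: "\<not> ?thesis"
    have "t\<^sup>2 = a\<^sup>2 + b\<^sup>2 * s\<^sup>2 + 2 * a * b * s" unfolding ab by (simp add: algebra_simps power2_eq_square)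
    then have "s = (t\<^sup>2 - a\<^sup>2 - b\<^sup>2 * s\<^sup>2) / (of_nat 2 * a * b)" using nz by (simp add: field_simps)
    also have "\<dots> \<in> F"
      by (intro divide_mem diff_mem mult_mem of_nat_mem power_mem[OF ab(1)] power_mem[OF ab(2)] ab(1,2) assms(2,5))
    finally show False using assms(3) by simp
  qed
  then show ?thesis
  proof
    assume "a = 0"
    then have "t * s = b * s\<^sup>2" using ab by (simp add: power2_eq_square)
    then show ?thesis using ab assms(2) by (simp add: mult_mem)
  qed (use ab in auto)
qed

text \<open>The prime p divides the radicand exactly once, whereas a rational square root of a
  natural number is an integer.\<close>

lemma sqrt_squarefree_irrational:
  fixes p :: nat
  assumes "prime p" "finite I" "\<And>q. q \<in> I \<Longrightarrow> prime q" "p \<notin> I"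
  shows "complex_of_real (sqrt (real p)) * (\<Prod>q\<in>I. complex_of_real (sqrt (real q))) \<notin> \<rat>"
proof
  let ?n = "p * \<Prod>I"
  have "(\<Prod>q\<in>I. sqrt (real q)) = sqrt (real (\<Prod>I))"
    using assms(2) by (induction I rule: finite_induct) (auto simp: real_sqrt_mult)
  then have eq: "complex_of_real (sqrt (real p)) * (\<Prod>q\<in>I. complex_of_real (sqrt (real q)))
      = complex_of_real (sqrt (real ?n))"
    by (simp add: real_sqrt_mult flip: of_real_prod)
  assume "complex_of_real (sqrt (real p)) * (\<Prod>q\<in>I. complex_of_real (sqrt (real q))) \<in> \<rat>"
  then have "complex_of_real (sqrt (real ?n)) \<in> \<rat>" by (simp only: eq)
  then have "sqrt (real ?n) \<in> \<rat>" by simp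
  then have "sqrt (real ?n) \<in> \<int>"
    by (intro rational_algebraic_int_is_int algebraic_int_sqrt algebraic_int_of_nat)
  then obtain m where m: "sqrt (real ?n) = of_int m" by (auto elim: Ints_cases)
  then have "real_of_int (m\<^sup>2) = real_of_int (int ?n)"
    by (metis of_int_of_nat_eq of_int_power of_nat_0_le_iff real_sqrt_pow2)
  then have "m\<^sup>2 = int ?n" by (simp only: of_int_eq_iff)
  then have "(nat \<bar>m\<bar>)\<^sup>2 = ?n" by (metis nat_int nat_power_eq abs_ge_zero power2_abs)
  then obtain l where l: "l\<^sup>2 = p * \<Prod>I" by metis
  then have "p dvd l\<^sup>2" by simp
  then have "p dvd l" using assms(1) prime_dvd_power by blast
  then have "p\<^sup>2 dvd l\<^sup>2" by (rule dvd_power_same)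
  then have "p * p dvd p * \<Prod>I" unfolding l power2_eq_square[of p] .
  then have "p dvd \<Prod>I" using prime_gt_0_nat[OF assms(1)] by (metis nat_mult_dvd_cancel1)
  then obtain q where "q \<in> I" "p dvd q" using assms(1,2) prime_dvd_prod_iff[of I p "\<lambda>x. x"] by auto
  then show False using assms primes_dvd_imp_eq by blast
qed

text \<open>Adjoining square roots of distinct primes to the rationals one after another produces
  arbitrarily many independent elements, too many for L.\<close>

lemma sqrt_not_in_number_field:
  assumes "number_field L"
  shows "\<exists>w::nat. w > 0 \<and> complex_of_real (sqrt (real w)) \<notin> L"
proof (rule ccontr)
  define s where "s p = complex_of_real (sqrt (real p))" for p :: nat
  assume "\<not> ?thesis"
  then have sL: "s w \<in> L" if "w > 0" for w using that unfolding s_def by blast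
  interpret complex_subfield_loc L using assms by (rule number_field_locI)
  obtain B where B: "finite B" "L = rat_vs.span B" using number_field_basis[OF assms] by metis
  have s2: "(s p)\<^sup>2 = of_nat p" for p by (simp add: s_def flip: of_real_power)
  have Rats: "complex_subfield \<rat>" by (auto simp: complex_subfield_def)
  \<comment> \<open>The condition on t is the invariant that keeps the next root out of F: an
    element of F with rational square is a rational multiple of a product of adjoined roots. One new
    independent element per step is enough.\<close>
  have "\<exists>P F S. finite P \<and> (\<forall>p\<in>P. prime p) \<and> complex_subfield F \<and> F \<subseteq> L \<and>
     (\<forall>t\<in>F. t\<^sup>2 \<in> \<rat> \<longrightarrow> (\<exists>I\<subseteq>P. t * (\<Prod>p\<in>I. s p) \<in> \<rat>)) \<and>
     S \<subseteq> F \<and> finite S \<and> rat_vs.independent S \<and> card S = m" for m :: nat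
  proof (induction m)
    case 0
    have "\<rat> \<subseteq> L" using of_rat_mem by (auto elim: Rats_cases)
    then show ?case using Rats
      by (intro exI[of _ "{}"] exI[of _ \<rat>]) (auto simp: rat_vs.independent_empty)
  next
    case (Suc m)
    then obtain P F S where P: "finite P" "\<forall>p\<in>P. prime p" and F: "complex_subfield F" "F \<subseteq> L"
      and tF: "\<And>t. t \<in> F \<Longrightarrow> t\<^sup>2 \<in> \<rat> \<Longrightarrow> \<exists>I\<subseteq>P. t * (\<Prod>p\<in>I. s p) \<in> \<rat>"
      and S: "S \<subseteq> F" "finite S" "rat_vs.independent S" "card S = m" by blast
    obtain p where p: "prime p" "p \<notin> P"
      using primes_infinite P(1) by (metis (mono_tags, lifting) finite_subset mem_Collect_eq subsetI)
    interpret F: complex_subfield_loc F using F(1) by (rule complex_subfield_locI)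
    have spF: "s p \<notin> F"
    proof
      assume "s p \<in> F"
      with tF[of "s p"] obtain I where I: "I \<subseteq> P" "s p * (\<Prod>p\<in>I. s p) \<in> \<rat>" by (auto simp: s2)
      moreover have "finite I" using I P finite_subset by blast
      ultimately show False
        using sqrt_squarefree_irrational[OF p(1), of I] P p by (auto simp: s_def)
    qed
    define E where "E = {a + b * s p | a b. a \<in> F \<and> b \<in> F}"
    have s2F: "(s p)\<^sup>2 \<in> F" by (simp add: s2 F.of_nat_mem)
    have E: "complex_subfield E" unfolding E_def by (rule quadratic_extension_subfield[OF F(1) s2F spF])
    have FE: "F \<subseteq> E" unfolding E_def using F.zero_mem by (force intro: exI[of _ 0])
    have spE: "s p \<in> E" unfolding E_def using F.zero_mem F.one_mem by (force intro: exI[of _ 1])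
    have EL: "E \<subseteq> L" unfolding E_def using F(2) sL[of p] prime_gt_0_nat[OF p(1)]
      by (auto intro!: add_mem mult_mem)
    have tE: "\<exists>I\<subseteq>insert p P. t * (\<Prod>p\<in>I. s p) \<in> \<rat>" if t: "t \<in> E" "t\<^sup>2 \<in> \<rat>" for t
    proof -
      have "t\<^sup>2 \<in> F" using t(2) F.of_rat_mem by (auto elim: Rats_cases)
      with t quadratic_extension_sqrt[OF F(1) s2F spF] consider "t \<in> F" | "t * s p \<in> F"
        unfolding E_def by blast
      then show ?thesis
      proof cases
        case 1
        with tF[OF this t(2)] show ?thesis by blast
      next
        case 2
        have "(t * s p)\<^sup>2 \<in> \<rat>" using t(2) by (simp add: power_mult_distrib s2)
        from tF[OF 2 this] obtain I where I: "I \<subseteq> P" "t * s p * (\<Prod>p\<in>I. s p) \<in> \<rat>" by blast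
        moreover have "finite I" "p \<notin> I" using I P p finite_subset by auto
        ultimately show ?thesis by (intro exI[of _ "insert p I"]) (auto simp: mult.assoc)
      qed
    qed
    have "rat_vs.span S \<subseteq> F" using S(1) F.subspace by (rule rat_vs.span_minimal)
    then have sp: "s p \<notin> rat_vs.span S" using spF by blast
    then have "rat_vs.independent (insert (s p) S)" using S(3) by (rule rat_vs.independent_insertI)
    moreover have "s p \<notin> S" using S(1) spF by blast
    ultimately have S': "insert (s p) S \<subseteq> E" "finite (insert (s p) S)"
      "rat_vs.independent (insert (s p) S)" "card (insert (s p) S) = Suc m"
      using S FE spE by auto
    have P': "finite (insert p P)" "\<forall>q\<in>insert p P. prime q" using P p(1) by auto
    have tE': "\<forall>t\<in>E. t\<^sup>2 \<in> \<rat> \<longrightarrow> (\<exists>I\<subseteq>insert p P. t * (\<Prod>p\<in>I. s p) \<in> \<rat>)"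
      by (intro ballI impI tE)
    show ?case
      by (rule exI[of _ "insert p P"], rule exI[of _ E], rule exI[of _ "insert (s p) S"])
        (intro conjI P' E EL tE' S')
  qed
  from this[of "Suc (card B)"] obtain F S where "F \<subseteq> L" "S \<subseteq> F" "rat_vs.independent S" "card S = Suc (card B)"
    by (elim exE conjE)
  with rat_vs.independent_span_bound[OF B(1), of S] B(2) show False by auto
qed

section \<open>Sizes of algebraic numbers\<close>

lemma common_denominator:
  assumes "finite (Q :: rat set)"
  shows "\<exists>E::nat. E > 0 \<and> (\<forall>q\<in>Q. \<exists>z::int. of_nat E * q = of_int z)"
  using assms
proof (induction Q rule: finite_induct)
  case (insert q Q)
  then obtain E :: nat where E: "E > 0" "\<And>q. q \<in> Q \<Longrightarrow> \<exists>z::int. of_nat E * q = of_int z" by blast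
  obtain a b where ab: "quotient_of q = (a, b)" by fastforce
  then have b: "b > 0" "q = of_int a / of_int b"
    using quotient_of_denom_pos quotient_of_div by auto
  have "\<exists>z::int. of_nat (E * nat b) * r = of_int z" if "r \<in> insert q Q" for r
    using that
  proof
    assume "r = q"
    then have "of_nat (E * nat b) * r = of_int (int E * a)" using b by simp
    then show ?thesis ..
  next
    assume "r \<in> Q"
    then obtain z :: int where "of_nat E * r = of_int z" using E by blast
    then have "of_nat (E * nat b) * r = of_int (b * z)"
      using b(1) by (simp add: ac_simps)
    then show ?thesis ..
  qed
  with E b show ?case by (intro exI[of _ "E * nat b"]) auto
qed (auto intro: exI[of _ 1])

text \<open>The integer combinations of the \<beta> i form a lattice closed under multiplication. In
  the norm given by the sum of absolute values of the coordinates, a product is at most c0 times the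
  product of the norms. The lattice need not contain 1.\<close>

locale integral_family =
  fixes n :: nat and \<beta> :: "nat \<Rightarrow> complex" and \<gamma> :: "nat \<Rightarrow> nat \<Rightarrow> nat \<Rightarrow> int" and c0 :: nat
  assumes mult_table: "\<And>i j. i < n \<Longrightarrow> j < n \<Longrightarrow> \<beta> i * \<beta> j = (\<Sum>l<n. of_int (\<gamma> i j l) * \<beta> l)"
    and c0_ge: "\<And>i j. i < n \<Longrightarrow> j < n \<Longrightarrow> (\<Sum>l<n. \<bar>\<gamma> i j l\<bar>) \<le> int c0"

text \<open>Without independence the same family serves every subfield, which makes n a uniform
  bound for the degrees of the fields of definition of all points of an orbit.\<close>

definition spans :: "nat \<Rightarrow> (nat \<Rightarrow> complex) \<Rightarrow> complex set \<Rightarrow> bool" where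
  "spans n \<beta> L \<longleftrightarrow> (\<forall>x\<in>L. \<exists>u::nat \<Rightarrow> rat. x = (\<Sum>i<n. of_rat (u i) * \<beta> i))"

lemma spans_subset: "spans n \<beta> L \<Longrightarrow> L' \<subseteq> L \<Longrightarrow> spans n \<beta> L'"
  by (auto simp: spans_def)

text \<open>If E clears the denominators of the structure constants u of a basis b, then the family
  E b has integral ones, as (E b_i) (E b_j) is the sum of the (E u) (E b_l).\<close>

lemma number_field_integral_family:
  assumes "number_field L"
  obtains n \<beta> \<gamma> c0 where "integral_family n \<beta> \<gamma> c0" "spans n \<beta> L"
proof -
  interpret complex_subfield_loc L using assms by (rule number_field_locI)
  obtain B where B: "finite B" "B \<subseteq> L" "L = rat_vs.span B" "card B = rat_vs.dim L"
    using number_field_basis[OF assms] .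
  define n where "n = card B"
  obtain b where b: "bij_betw b {..<n} B"
    using ex_bij_betw_nat_finite[OF B(1)] by (auto simp: n_def atLeast0LessThan)
  have sp: "\<exists>u::nat \<Rightarrow> rat. x = (\<Sum>i<n. of_rat (u i) * b i)" if "x \<in> L" for x
  proof -
    have "x \<in> rat_vs.span B" using that B(3) by simp
    then obtain u where "x = (\<Sum>y\<in>B. of_rat (u y) * y)"
      unfolding rat_span_finite[OF B(1)] by (elim exE)
    also have "\<dots> = (\<Sum>i<n. of_rat (u (b i)) * b i)"
      by (rule sum.reindex_bij_betw[OF b, symmetric])
    finally show ?thesis by (intro exI[of _ "\<lambda>i. u (b i)"])
  qed
  have "b i * b j \<in> L" if "i < n" "j < n" for i j
    using that b B(2) by (intro mult_mem) (auto simp: bij_betw_def)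
  then have "\<forall>i j. \<exists>u::nat \<Rightarrow> rat. i < n \<longrightarrow> j < n \<longrightarrow> b i * b j = (\<Sum>l<n. of_rat (u l) * b l)"
    using sp by presburger
  then obtain u :: "nat \<Rightarrow> nat \<Rightarrow> nat \<Rightarrow> rat" where
    u: "\<And>i j. i < n \<Longrightarrow> j < n \<Longrightarrow> b i * b j = (\<Sum>l<n. of_rat (u i j l) * b l)" by metis
  obtain E :: nat where E: "E > 0"
    "\<forall>q\<in>(\<lambda>(i, j, l). u i j l) ` ({..<n} \<times> {..<n} \<times> {..<n}). \<exists>z::int. of_nat E * q = of_int z"
    using common_denominator[of "(\<lambda>(i, j, l). u i j l) ` ({..<n} \<times> {..<n} \<times> {..<n})"] by blast
  have "\<forall>i j l. \<exists>z::int. i < n \<longrightarrow> j < n \<longrightarrow> l < n \<longrightarrow> of_nat E * u i j l = of_int z"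
    using E(2) by auto
  then obtain \<gamma> :: "nat \<Rightarrow> nat \<Rightarrow> nat \<Rightarrow> int"
    where \<gamma>: "\<And>i j l. i < n \<Longrightarrow> j < n \<Longrightarrow> l < n \<Longrightarrow> of_nat E * u i j l = of_int (\<gamma> i j l)" by metis
  define \<beta> where "\<beta> i = of_nat E * b i" for i
  define c0 where "c0 = nat (\<Sum>i<n. \<Sum>j<n. \<Sum>l<n. \<bar>\<gamma> i j l\<bar>)"
  have "integral_family n \<beta> \<gamma> c0"
  proof
    fix i j assume ij: "i < n" "j < n"
    have "of_int (\<gamma> i j l) = of_nat E * (of_rat (u i j l) :: complex)" if "l < n" for l
      using arg_cong[OF \<gamma>[OF ij that], of "of_rat :: rat \<Rightarrow> complex"] by (simp add: of_rat_mult)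
    then have "(\<Sum>l<n. of_int (\<gamma> i j l) * \<beta> l) = (\<Sum>l<n. of_nat E * of_nat E * (of_rat (u i j l) * b l))"
      by (intro sum.cong) (auto simp: \<beta>_def)
    also have "\<dots> = \<beta> i * \<beta> j"
      using u[OF ij] by (simp add: \<beta>_def flip: sum_distrib_left)
    finally show "\<beta> i * \<beta> j = (\<Sum>l<n. of_int (\<gamma> i j l) * \<beta> l)" by simp
    have "(\<Sum>l<n. \<bar>\<gamma> i j l\<bar>) \<le> (\<Sum>j<n. \<Sum>l<n. \<bar>\<gamma> i j l\<bar>)"
      by (rule member_le_sum[of j "{..<n}" "\<lambda>j. \<Sum>l<n. \<bar>\<gamma> i j l\<bar>"]) (use ij in \<open>auto intro: sum_nonneg\<close>)
    also have "\<dots> \<le> (\<Sum>i<n. \<Sum>j<n. \<Sum>l<n. \<bar>\<gamma> i j l\<bar>)"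
      by (rule member_le_sum[of i "{..<n}" "\<lambda>i. \<Sum>j<n. \<Sum>l<n. \<bar>\<gamma> i j l\<bar>"])
        (use ij in \<open>auto intro: sum_nonneg\<close>)
    finally show "(\<Sum>l<n. \<bar>\<gamma> i j l\<bar>) \<le> int c0" by (simp add: c0_def)
  qed
  moreover have "spans n \<beta> L"
    unfolding spans_def
  proof
    fix x assume "x \<in> L"
    then obtain w :: "nat \<Rightarrow> rat" where "x = (\<Sum>i<n. of_rat (w i) * b i)" using sp by blast
    also have "\<dots> = (\<Sum>i<n. of_rat (w i / of_nat E) * \<beta> i)"
      using E(1) by (simp add: \<beta>_def of_rat_divide)
    finally show "\<exists>u::nat \<Rightarrow> rat. x = (\<Sum>i<n. of_rat (u i) * \<beta> i)"
      by (intro exI[of _ "\<lambda>i. w i / of_nat E"])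
  qed
  ultimately show thesis by (rule that)
qed

lemma spans_common_denominator:
  assumes "spans n \<beta> L" "finite X" "X \<subseteq> L"
  shows "\<exists>(E::nat) (a :: complex \<Rightarrow> nat \<Rightarrow> int) (W::nat). E > 0 \<and> W > 0 \<and> (\<forall>x\<in>X. of_nat E * x = (\<Sum>i<n. of_int (a x i) * \<beta> i)) \<and>
    (\<forall>x\<in>X. (\<Sum>i<n. \<bar>a x i\<bar>) \<le> int W)"
proof -
  have "\<forall>x. \<exists>u::nat \<Rightarrow> rat. x \<in> X \<longrightarrow> x = (\<Sum>i<n. of_rat (u i) * \<beta> i)"
    using assms unfolding spans_def by blast
  then obtain u :: "complex \<Rightarrow> nat \<Rightarrow> rat"
    where u: "\<And>x. x \<in> X \<Longrightarrow> x = (\<Sum>i<n. of_rat (u x i) * \<beta> i)" by metis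
  obtain E :: nat where E: "E > 0"
    "\<forall>q\<in>(\<lambda>(x, i). u x i) ` (X \<times> {..<n}). \<exists>z::int. of_nat E * q = of_int z"
    using common_denominator[of "(\<lambda>(x, i). u x i) ` (X \<times> {..<n})"] assms(2) by blast
  have "\<forall>x i. \<exists>z::int. x \<in> X \<longrightarrow> i < n \<longrightarrow> of_nat E * u x i = of_int z"
    using E(2) by auto
  then obtain a :: "complex \<Rightarrow> nat \<Rightarrow> int"
    where a: "\<And>x i. x \<in> X \<Longrightarrow> i < n \<Longrightarrow> of_nat E * u x i = of_int (a x i)" by metis
  define W where "W = Suc (nat (\<Sum>x\<in>X. \<Sum>i<n. \<bar>a x i\<bar>))"
  have 1: "of_nat E * x = (\<Sum>i<n. of_int (a x i) * \<beta> i)" if x: "x \<in> X" for x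
  proof -
    have *: "of_int (a x i) = of_nat E * (of_rat (u x i) :: complex)" if "i < n" for i
      using arg_cong[OF a[OF x that], of "of_rat :: rat \<Rightarrow> complex"] by (simp add: of_rat_mult)
    have "of_nat E * x = (\<Sum>i<n. of_nat E * (of_rat (u x i) * \<beta> i))"
      by (subst u[OF x]) (simp only: sum_distrib_left)
    also have "\<dots> = (\<Sum>i<n. of_int (a x i) * \<beta> i)" by (rule sum.cong) (simp_all add: *)
    finally show ?thesis .
  qed
  have 2: "(\<Sum>i<n. \<bar>a x i\<bar>) \<le> int W" if "x \<in> X" for x
  proof -
    have "(\<Sum>i<n. \<bar>a x i\<bar>) \<le> (\<Sum>x\<in>X. \<Sum>i<n. \<bar>a x i\<bar>)"
      by (rule member_le_sum[of x X "\<lambda>x. \<Sum>i<n. \<bar>a x i\<bar>"]) (use that assms in \<open>auto intro: sum_nonneg\<close>)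
    then show ?thesis by (simp add: W_def)
  qed
  have "W > 0" by (simp add: W_def)
  with E(1) 1 2 show ?thesis by (intro exI[of _ E] exI[of _ a] exI[of _ W]) simp
qed

lemma pigeonhole_int_vectors:
  fixes v :: "'a \<Rightarrow> nat \<Rightarrow> int"
  assumes "finite C" "\<And>c i. c \<in> C \<Longrightarrow> i < n \<Longrightarrow> \<bar>v c i\<bar> \<le> int W" "card C > (2 * W + 1) ^ n"
  shows "\<exists>c\<in>C. \<exists>c'\<in>C. c \<noteq> c' \<and> (\<forall>i<n. v c i = v c' i)"
proof -
  let ?r = "\<lambda>c. restrict (v c) {..<n}"
  have "?r ` C \<subseteq> PiE {..<n} (\<lambda>_. {- int W..int W})"
    using assms(2) by (force simp: abs_le_iff)
  then have "card (?r ` C) \<le> card (PiE {..<n} (\<lambda>_. {- int W..int W}))"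
    by (intro card_mono finite_PiE) auto
  also have "\<dots> = (2 * W + 1) ^ n" by (simp add: card_PiE nat_add_distrib nat_mult_distrib)
  finally have "\<not> inj_on ?r C" using assms(3) card_image by fastforce
  then obtain c c' where cc: "c \<in> C" "c' \<in> C" "c \<noteq> c'" "?r c = ?r c'" unfolding inj_on_def by blast
  have "v c i = v c' i" if "i < n" for i
    using fun_cong[OF cc(4), of i] that by simp
  with cc show ?thesis by blast
qed

text \<open>A stand-in for a height bound: with m fixed, ln Q measures the height. Unlike the
  minimal polynomial, such a relation involves neither irreducibility nor the exact degree, and it
  passes to inverses and to conjugates.\<close>

definition int_rel :: "nat \<Rightarrow> nat \<Rightarrow> complex \<Rightarrow> bool" where
  "int_rel m Q x \<longleftrightarrow> (\<exists>c::nat \<Rightarrow> int. (\<exists>i\<le>m. c i \<noteq> 0) \<and> (\<forall>i\<le>m. \<bar>c i\<bar> \<le> int Q) \<and>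
     (\<Sum>i\<le>m. of_int (c i) * x ^ i) = 0)"

text \<open>M is a logarithmic size: denominator D^M and numerator of norm at most A^M. The factor
  c0 in the second bound absorbs the loss in products, so that sizes simply add; the third bound
  stands separately because the second says nothing when c0 = 0.\<close>

definition size_le :: "nat \<Rightarrow> (nat \<Rightarrow> complex) \<Rightarrow> nat \<Rightarrow> nat \<Rightarrow> nat \<Rightarrow> nat \<Rightarrow> complex \<Rightarrow> bool" where
  "size_le n \<beta> c0 D A M x \<longleftrightarrow> (\<exists>a::nat \<Rightarrow> int. of_nat (D ^ M) * x = (\<Sum>i<n. of_int (a i) * \<beta> i) \<and>
     int c0 * (\<Sum>i<n. \<bar>a i\<bar>) \<le> int (A ^ M) \<and> (\<Sum>i<n. \<bar>a i\<bar>) \<le> int (A ^ M))"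

lemma size_le_zero: "size_le n \<beta> c0 D A 0 0"
  unfolding size_le_def by (rule exI[of _ "\<lambda>_. 0"]) simp

lemma size_le_mono:
  assumes "size_le n \<beta> c0 D A M x" "M \<le> M'" "D \<le> A"
  shows "size_le n \<beta> c0 D A M' x"
proof -
  from assms(1) obtain a :: "nat \<Rightarrow> int" where a: "of_nat (D ^ M) * x = (\<Sum>i<n. of_int (a i) * \<beta> i)"
    "int c0 * (\<Sum>i<n. \<bar>a i\<bar>) \<le> int (A ^ M)" "(\<Sum>i<n. \<bar>a i\<bar>) \<le> int (A ^ M)"
    unfolding size_le_def by blast
  define e where "e = M' - M"
  have M': "M' = e + M" using assms(2) by (simp add: e_def)
  have De: "int (D ^ e) \<le> int (A ^ e)" using assms(3) by (simp add: power_mono)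
  show ?thesis
    unfolding size_le_def
  proof (rule exI[of _ "\<lambda>i. int (D ^ e) * a i"], intro conjI)
    have "of_nat (D ^ M') * x = of_nat (D ^ e) * (of_nat (D ^ M) * x)"
      by (simp add: M' power_add)
    then show "of_nat (D ^ M') * x = (\<Sum>i<n. of_int (int (D ^ e) * a i) * \<beta> i)"
      unfolding a(1) by (simp add: sum_distrib_left mult.assoc)
    have s: "(\<Sum>i<n. \<bar>int (D ^ e) * a i\<bar>) = int (D ^ e) * (\<Sum>i<n. \<bar>a i\<bar>)"
      by (simp add: sum_distrib_left abs_mult)
    have "int (D ^ e) * (\<Sum>i<n. \<bar>a i\<bar>) \<le> int (A ^ e) * int (A ^ M)"
      using De a(3) by (intro mult_mono) (auto intro: sum_nonneg)
    then show "(\<Sum>i<n. \<bar>int (D ^ e) * a i\<bar>) \<le> int (A ^ M')"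
      unfolding s by (simp add: M' power_add)
    have "int (D ^ e) * (int c0 * (\<Sum>i<n. \<bar>a i\<bar>)) \<le> int (A ^ e) * int (A ^ M)"
      using De a(2) by (intro mult_mono) (auto intro: sum_nonneg)
    then show "int c0 * (\<Sum>i<n. \<bar>int (D ^ e) * a i\<bar>) \<le> int (A ^ M')"
      unfolding s by (simp add: M' power_add mult.left_commute)
  qed
qed

text \<open>Passing to the denominator D^(M + 1) multiplies both numerators by D before they are
  added, hence the condition \<open>2 * D \<le> A\<close>.\<close>

lemma size_le_add:
  assumes "size_le n \<beta> c0 D A M x" "size_le n \<beta> c0 D A M y" "2 * D \<le> A"
  shows "size_le n \<beta> c0 D A (M + 1) (x + y)"
proof -
  from assms(1) obtain a :: "nat \<Rightarrow> int" where a: "of_nat (D ^ M) * x = (\<Sum>i<n. of_int (a i) * \<beta> i)"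
    "int c0 * (\<Sum>i<n. \<bar>a i\<bar>) \<le> int (A ^ M)" "(\<Sum>i<n. \<bar>a i\<bar>) \<le> int (A ^ M)"
    unfolding size_le_def by blast
  from assms(2) obtain b :: "nat \<Rightarrow> int" where b: "of_nat (D ^ M) * y = (\<Sum>i<n. of_int (b i) * \<beta> i)"
    "int c0 * (\<Sum>i<n. \<bar>b i\<bar>) \<le> int (A ^ M)" "(\<Sum>i<n. \<bar>b i\<bar>) \<le> int (A ^ M)"
    unfolding size_le_def by blast
  let ?s = "\<Sum>i<n. \<bar>int D * (a i + b i)\<bar>"
  have s: "?s \<le> int D * ((\<Sum>i<n. \<bar>a i\<bar>) + (\<Sum>i<n. \<bar>b i\<bar>))"
    unfolding sum.distrib[symmetric] sum_distrib_left
    by (intro sum_mono) (simp add: abs_mult mult_left_mono)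
  show ?thesis
    unfolding size_le_def
  proof (rule exI[of _ "\<lambda>i. int D * (a i + b i)"], intro conjI)
    have "of_nat (D ^ (M + 1)) * (x + y) = of_nat D * (of_nat (D ^ M) * x + of_nat (D ^ M) * y)"
      by (simp add: algebra_simps)
    then show "of_nat (D ^ (M + 1)) * (x + y) = (\<Sum>i<n. of_int (int D * (a i + b i)) * \<beta> i)"
      unfolding a(1) b(1) by (simp add: sum_distrib_left algebra_simps sum.distrib)
    have A2: "int D * (int (A ^ M) + int (A ^ M)) \<le> int (A ^ (M + 1))"
    proof -
      have "int D * (int (A ^ M) + int (A ^ M)) = int (2 * D) * int (A ^ M)" by simp
      also have "\<dots> \<le> int A * int (A ^ M)" using assms(3) by (intro mult_right_mono) auto
      finally show ?thesis by simp
    qed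
    have "?s \<le> int D * (int (A ^ M) + int (A ^ M))"
      by (rule order_trans[OF s]) (intro mult_left_mono add_mono a(3) b(3), simp)
    with A2 show "?s \<le> int (A ^ (M + 1))" by linarith
    have "int c0 * ?s \<le> int c0 * (int D * ((\<Sum>i<n. \<bar>a i\<bar>) + (\<Sum>i<n. \<bar>b i\<bar>)))"
      using s by (intro mult_left_mono) auto
    also have "\<dots> = int D * (int c0 * (\<Sum>i<n. \<bar>a i\<bar>) + int c0 * (\<Sum>i<n. \<bar>b i\<bar>))"
      by (simp add: algebra_simps)
    also have "\<dots> \<le> int D * (int (A ^ M) + int (A ^ M))"
      by (intro mult_left_mono add_mono a(2) b(2)) simp
    finally show "int c0 * ?s \<le> int (A ^ (M + 1))" using A2 by linarith
  qed
qed

context integral_family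
begin

text \<open>With a and b the norms of the factors, the product has norm at most c0 a b, and c0 times
  this is (c0 a) (c0 b): each factor contributes its own c0.\<close>

lemma size_le_mult:
  assumes "size_le n \<beta> c0 D A M x" "size_le n \<beta> c0 D A M' y"
  shows "size_le n \<beta> c0 D A (M + M') (x * y)"
proof -
  from assms(1) obtain a :: "nat \<Rightarrow> int" where a: "of_nat (D ^ M) * x = (\<Sum>i<n. of_int (a i) * \<beta> i)"
    "int c0 * (\<Sum>i<n. \<bar>a i\<bar>) \<le> int (A ^ M)" "(\<Sum>i<n. \<bar>a i\<bar>) \<le> int (A ^ M)"
    unfolding size_le_def by blast
  from assms(2) obtain b :: "nat \<Rightarrow> int" where b: "of_nat (D ^ M') * y = (\<Sum>i<n. of_int (b i) * \<beta> i)"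
    "int c0 * (\<Sum>i<n. \<bar>b i\<bar>) \<le> int (A ^ M')" "(\<Sum>i<n. \<bar>b i\<bar>) \<le> int (A ^ M')"
    unfolding size_le_def by blast
  define d where "d l = (\<Sum>i<n. \<Sum>j<n. a i * b j * \<gamma> i j l)" for l
  let ?s = "\<Sum>l<n. \<bar>d l\<bar>" and ?a = "\<Sum>i<n. \<bar>a i\<bar>" and ?b = "\<Sum>i<n. \<bar>b i\<bar>"
  have "?s \<le> (\<Sum>l<n. \<Sum>i<n. \<Sum>j<n. \<bar>a i\<bar> * \<bar>b j\<bar> * \<bar>\<gamma> i j l\<bar>)"
  proof (rule sum_mono)
    fix l
    have "\<bar>d l\<bar> \<le> (\<Sum>i<n. \<bar>\<Sum>j<n. a i * b j * \<gamma> i j l\<bar>)" unfolding d_def by (rule sum_abs)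
    also have "\<dots> \<le> (\<Sum>i<n. \<Sum>j<n. \<bar>a i\<bar> * \<bar>b j\<bar> * \<bar>\<gamma> i j l\<bar>)"
      by (intro sum_mono order_trans[OF sum_abs]) (simp add: abs_mult)
    finally show "\<bar>d l\<bar> \<le> (\<Sum>i<n. \<Sum>j<n. \<bar>a i\<bar> * \<bar>b j\<bar> * \<bar>\<gamma> i j l\<bar>)" .
  qed
  also have "\<dots> = (\<Sum>i<n. \<Sum>l<n. \<Sum>j<n. \<bar>a i\<bar> * \<bar>b j\<bar> * \<bar>\<gamma> i j l\<bar>)" by (rule sum.swap)
  also have "\<dots> = (\<Sum>i<n. \<Sum>j<n. \<Sum>l<n. \<bar>a i\<bar> * \<bar>b j\<bar> * \<bar>\<gamma> i j l\<bar>)"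
    by (intro sum.cong refl sum.swap)
  also have "\<dots> = (\<Sum>i<n. \<Sum>j<n. \<bar>a i\<bar> * \<bar>b j\<bar> * (\<Sum>l<n. \<bar>\<gamma> i j l\<bar>))"
    by (simp add: sum_distrib_left)
  also have "\<dots> \<le> (\<Sum>i<n. \<Sum>j<n. \<bar>a i\<bar> * \<bar>b j\<bar> * int c0)"
    by (intro sum_mono mult_left_mono c0_ge) auto
  also have "\<dots> = (int c0 * ?a) * ?b" by (simp add: sum_product sum_distrib_left sum_distrib_right ac_simps)
  finally have s: "?s \<le> (int c0 * ?a) * ?b" .
  show ?thesis
    unfolding size_le_def
  proof (rule exI[of _ d], intro conjI)
    have "of_nat (D ^ (M + M')) * (x * y) = (of_nat (D ^ M) * x) * (of_nat (D ^ M') * y)"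
      by (simp add: power_add)
    also have "\<dots> = (\<Sum>i<n. \<Sum>j<n. of_int (a i) * of_int (b j) * (\<beta> i * \<beta> j))"
      unfolding a(1) b(1) by (simp add: sum_product ac_simps)
    also have "\<dots> = (\<Sum>i<n. \<Sum>j<n. \<Sum>l<n. of_int (a i) * of_int (b j) * (of_int (\<gamma> i j l) * \<beta> l))"
      by (intro sum.cong refl) (simp add: mult_table sum_distrib_left)
    also have "\<dots> = (\<Sum>i<n. \<Sum>l<n. \<Sum>j<n. of_int (a i) * of_int (b j) * (of_int (\<gamma> i j l) * \<beta> l))"
      by (intro sum.cong refl sum.swap)
    also have "\<dots> = (\<Sum>l<n. \<Sum>i<n. \<Sum>j<n. of_int (a i) * of_int (b j) * (of_int (\<gamma> i j l) * \<beta> l))"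
      by (rule sum.swap)
    also have "\<dots> = (\<Sum>l<n. of_int (d l) * \<beta> l)"
      by (simp add: d_def sum_distrib_right mult.assoc)
    finally show "of_nat (D ^ (M + M')) * (x * y) = (\<Sum>l<n. of_int (d l) * \<beta> l)" .
    have "(int c0 * ?a) * ?b \<le> int (A ^ M) * int (A ^ M')"
      by (intro mult_mono a(2) b(3)) (auto intro: sum_nonneg)
    with s show "?s \<le> int (A ^ (M + M'))" by (simp add: power_add)
    have "int c0 * ?s \<le> int c0 * ((int c0 * ?a) * ?b)" using s by (intro mult_left_mono) auto
    also have "\<dots> = (int c0 * ?a) * (int c0 * ?b)" by (simp add: ac_simps)
    also have "\<dots> \<le> int (A ^ M) * int (A ^ M')"
      by (intro mult_mono a(2) b(2)) (auto intro!: mult_nonneg_nonneg sum_nonneg)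
    finally show "int c0 * ?s \<le> int (A ^ (M + M'))" by (simp add: power_add)
  qed
qed

text \<open>The exponent 0 is left out because 1 would have to be of size 0, while the lattice need
  not even contain it.\<close>

lemma size_le_power: "size_le n \<beta> c0 D A M x \<Longrightarrow> i > 0 \<Longrightarrow> size_le n \<beta> c0 D A (i * M) (x ^ i)"
proof (induction i)
  case (Suc i)
  show ?case
  proof (cases "i = 0")
    case False
    with Suc size_le_mult[OF Suc.prems(1) Suc.IH] show ?thesis by simp
  qed (use Suc in simp)
qed simp

text \<open>Dirichlet's box principle among the integer combinations of \<open>y, \<dots>, y\<^bsup>n+1\<^esup>\<close>, \<open>y = D\<^sup>M x\<close>.\<close>

lemma size_le_int_rel:
  assumes "size_le n \<beta> c0 D A M x" "D > 0" "A > 0"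
  shows "int_rel (n + 1) (((2 * (n + 1)) ^ n * A ^ ((n + 1) * n) * D ^ (n + 1)) ^ (M + 1)) x"
proof -
  define T where "T = A ^ (M * (n + 1))"
  \<comment> \<open>With this H there are at most H (H + 1)^n possible coordinate vectors, fewer
    than the (H + 1)^(n + 1) choices of coefficients.\<close>
  define H where "H = (2 * (n + 1) * T) ^ n"
  have T1: "T \<ge> 1" using assms(3) by (simp add: T_def)
  have "\<exists>r::nat \<Rightarrow> int. of_nat (D ^ (M * i)) * x ^ i = (\<Sum>j<n. of_int (r j) * \<beta> j) \<and> (\<Sum>j<n. \<bar>r j\<bar>) \<le> int T"
    if i: "i \<in> {1..n + 1}" for i
  proof -
    from size_le_power[OF assms(1), of i] i obtain r :: "nat \<Rightarrow> int"
      where r: "of_nat (D ^ (i * M)) * x ^ i = (\<Sum>j<n. of_int (r j) * \<beta> j)" "(\<Sum>j<n. \<bar>r j\<bar>) \<le> int (A ^ (i * M))"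
      unfolding size_le_def by auto
    moreover have "A ^ (i * M) \<le> T" unfolding T_def
    proof (rule power_increasing)
      show "i * M \<le> M * (n + 1)" using i mult_le_mono2[of i "n + 1" M] by (simp add: mult.commute)
    qed (use assms(3) in simp)
    moreover from this have "int (A ^ (i * M)) \<le> int T" by (simp only: of_nat_le_iff)
    ultimately have "(\<Sum>j<n. \<bar>r j\<bar>) \<le> int T" by linarith
    with r(1) show ?thesis by (intro exI[of _ r]) (simp add: mult.commute)
  qed
  then obtain r :: "nat \<Rightarrow> nat \<Rightarrow> int" where
    r: "\<And>i. i \<in> {1..n + 1} \<Longrightarrow> of_nat (D ^ (M * i)) * x ^ i = (\<Sum>j<n. of_int (r i j) * \<beta> j)"
    and rT: "\<And>i. i \<in> {1..n + 1} \<Longrightarrow> (\<Sum>j<n. \<bar>r i j\<bar>) \<le> int T" by metis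
  define C where "C = PiE {1..n + 1} (\<lambda>_. {0..int H})"
  define v where "v c j = (\<Sum>i\<in>{1..n + 1}. c i * r i j)" for c :: "nat \<Rightarrow> int" and j
  have "\<exists>c\<in>C. \<exists>c'\<in>C. c \<noteq> c' \<and> (\<forall>i<n. v c i = v c' i)"
  proof (rule pigeonhole_int_vectors)
    show "finite C" unfolding C_def by (intro finite_PiE) auto
    fix c j assume c: "c \<in> C" and j: "j < n"
    have "\<bar>v c j\<bar> \<le> (\<Sum>i\<in>{1..n + 1}. \<bar>c i * r i j\<bar>)" unfolding v_def by (rule sum_abs)
    also have "\<dots> \<le> (\<Sum>i\<in>{1..n + 1}. int H * int T)"
    proof (rule sum_mono)
      fix i assume i: "i \<in> {1..n + 1}"
      have "\<bar>c i\<bar> \<le> int H" using c i by (auto simp: C_def dest!: PiE_mem)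
      moreover have "\<bar>r i j\<bar> \<le> (\<Sum>j<n. \<bar>r i j\<bar>)"
        by (rule member_le_sum[of j "{..<n}" "\<lambda>j. \<bar>r i j\<bar>"]) (use j in auto)
      then have "\<bar>r i j\<bar> \<le> int T" using rT[OF i] by linarith
      ultimately show "\<bar>c i * r i j\<bar> \<le> int H * int T" unfolding abs_mult by (intro mult_mono) auto
    qed
    also have "\<dots> = int ((n + 1) * H * T)" by (simp add: algebra_simps)
    finally show "\<bar>v c j\<bar> \<le> int ((n + 1) * H * T)" .
  next
    have "2 * ((n + 1) * H * T) + 1 \<le> (2 * (n + 1) * T) * (H + 1)"
      using T1 by (simp add: algebra_simps)
    then have "(2 * ((n + 1) * H * T) + 1) ^ n \<le> ((2 * (n + 1) * T) * (H + 1)) ^ n"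
      by (intro power_mono) auto
    also have "\<dots> = H * (H + 1) ^ n" 
      by (simp only: power_mult_distrib[of "2 * (n + 1) * T" "H + 1"] H_def[symmetric])
    also have "\<dots> < (H + 1) * (H + 1) ^ n" by (intro mult_strict_right_mono) auto
    also have "\<dots> = card C" by (simp add: C_def card_PiE nat_add_distrib)
    finally show "(2 * ((n + 1) * H * T) + 1) ^ n < card C" .
  qed
  then obtain c c' where cc: "c \<in> C" "c' \<in> C" "c \<noteq> c'" "\<And>i. i < n \<Longrightarrow> v c i = v c' i" by blast
  \<comment> \<open>There is no constant term, since only positive powers are known to lie in the
    lattice; the factor D^(M i) turns a relation among the powers of D^M x into one among the powers
    of x.\<close>
  define e where "e i = (if i = 0 then 0 else (c i - c' i) * int (D ^ (M * i)))" for i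
  have ex: "\<exists>i\<in>{1..n + 1}. c i \<noteq> c' i"
    using cc(1,2,3) unfolding C_def by (metis PiE_ext)
  \<comment> \<open>The exponent M + 1 instead of M absorbs the constant factor (2 (n +
    1))^n.\<close>
  define Q where "Q = ((2 * (n + 1)) ^ n * A ^ ((n + 1) * n) * D ^ (n + 1)) ^ (M + 1)"
  have "\<bar>e i\<bar> \<le> int Q" if i: "i \<le> n + 1" for i
  proof (cases "i = 0")
    case False
    have bnds: "0 \<le> c i" "c i \<le> int H" "0 \<le> c' i" "c' i \<le> int H"
      using cc(1,2) i False by (auto simp: C_def dest!: PiE_mem[of _ _ _ i])
    then have "\<bar>c i - c' i\<bar> \<le> int H" by linarith
    moreover have "D ^ (M * i) \<le> D ^ (M * (n + 1))"
      by (intro power_increasing mult_le_mono2 i) (use assms(2) in simp)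
    then have "int (D ^ (M * i)) \<le> int (D ^ (M * (n + 1)))" by (simp only: of_nat_le_iff)
    moreover have "e i = (c i - c' i) * int (D ^ (M * i))" using False by (simp add: e_def)
    then have "\<bar>e i\<bar> = \<bar>c i - c' i\<bar> * int (D ^ (M * i))" by (simp only: abs_mult abs_of_nat)
    ultimately have "\<bar>e i\<bar> \<le> int H * int (D ^ (M * (n + 1)))"
      using mult_mono[of "\<bar>c i - c' i\<bar>" "int H" "int (D ^ (M * i))" "int (D ^ (M * (n + 1)))"] by linarith
    also have "\<dots> = int ((2 * (n + 1)) ^ n * (A ^ ((n + 1) * n) * D ^ (n + 1)) ^ M)"
    proof -
      have "H * D ^ (M * (n + 1)) = (2 * (n + 1)) ^ n * (A ^ ((n + 1) * n) * D ^ (n + 1)) ^ M"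
        unfolding H_def T_def power_mult_distrib power_mult[symmetric] by (simp only: ac_simps)
      then show ?thesis by (metis of_nat_mult)
    qed
    also have "\<dots> \<le> int Q"
    proof -
      let ?u = "(2 * (n + 1)) ^ n" and ?w = "A ^ ((n + 1) * n) * D ^ (n + 1)"
      have "?u \<ge> 1" "?w \<ge> 1" using assms(2,3) by (simp_all add: Suc_le_eq)
      then have "?u * ?w ^ M \<le> ?u ^ (M + 1) * ?w ^ (M + 1)"
        by (intro mult_mono power_increasing self_le_power) auto
      moreover have "Q = ?u ^ (M + 1) * ?w ^ (M + 1)"
        unfolding Q_def by (simp only: mult.assoc power_mult_distrib[symmetric])
      ultimately show ?thesis by (simp only: of_nat_le_iff)
    qed
    finally show ?thesis .
  qed (simp add: e_def)
  moreover have "\<exists>i\<le>n + 1. e i \<noteq> 0"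
  proof -
    from ex obtain i where "i \<in> {1..n + 1}" "c i \<noteq> c' i" by blast
    then have "i \<le> n + 1" "e i \<noteq> 0" using assms(2) by (simp_all add: e_def)
    then show ?thesis by blast
  qed
  moreover have "(\<Sum>i\<le>n + 1. of_int (e i) * x ^ i) = 0"
  proof -
    have "(\<Sum>i\<le>n + 1. of_int (e i) * x ^ i) = (\<Sum>i\<in>{1..n + 1}. of_int (e i) * x ^ i)"
      by (rule sum.mono_neutral_right) (auto simp: e_def)
    also have "\<dots> = (\<Sum>i\<in>{1..n + 1}. of_int (c i - c' i) * (of_nat (D ^ (M * i)) * x ^ i))"
      by (rule sum.cong) (auto simp: e_def)
    also have "\<dots> = (\<Sum>i\<in>{1..n + 1}. \<Sum>j<n. of_int ((c i - c' i) * r i j) * \<beta> j)"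
      by (rule sum.cong) (simp_all only: r sum_distrib_left, simp add: mult.assoc)
    also have "\<dots> = (\<Sum>j<n. \<Sum>i\<in>{1..n + 1}. of_int ((c i - c' i) * r i j) * \<beta> j)" by (rule sum.swap)
    also have "\<dots> = (\<Sum>j<n. of_int (v c j - v c' j) * \<beta> j)"
    proof (rule sum.cong)
      fix j
      have "v c j - v c' j = (\<Sum>i\<in>{1..n + 1}. (c i - c' i) * r i j)"
        by (simp add: v_def left_diff_distrib sum_subtractf)
      then show "(\<Sum>i\<in>{1..n + 1}. of_int ((c i - c' i) * r i j) * \<beta> j) = of_int (v c j - v c' j) * \<beta> j"
        by (simp only: of_int_sum sum_distrib_right)
    qed simp
    also have "\<dots> = 0" using cc(4) by simp
    finally show ?thesis .
  qed
  ultimately show ?thesis unfolding int_rel_def Q_def[symmetric] by blast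
qed

end

text \<open>Cauchy's root bound: the leading coefficient is a nonzero integer, hence of absolute
  value at least 1, and for large z it outweighs the at most m lower terms.\<close>

lemma int_rel_bound:
  assumes "int_rel m Q z"
  shows "cmod z \<le> max 1 (real (m * Q))"
proof (rule ccontr)
  assume "\<not> ?thesis"
  then have z: "cmod z > 1" "cmod z > real (m * Q)" by auto
  from assms obtain c :: "nat \<Rightarrow> int" where c: "\<exists>i\<le>m. c i \<noteq> 0" "\<And>i. i \<le> m \<Longrightarrow> \<bar>c i\<bar> \<le> int Q"
    "(\<Sum>i\<le>m. of_int (c i) * z ^ i) = 0" unfolding int_rel_def by blast
  define t where "t = Max {i. i \<le> m \<and> c i \<noteq> 0}"
  have tin: "t \<in> {i. i \<le> m \<and> c i \<noteq> 0}" unfolding t_def by (rule Max_in) (use c(1) in auto)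
  have tmax: "c i = 0" if "i > t" "i \<le> m" for i
    using that Max_ge[of "{i. i \<le> m \<and> c i \<noteq> 0}" i] unfolding t_def by fastforce
  have "(\<Sum>i\<le>m. of_int (c i) * z ^ i) = (\<Sum>i\<le>t. of_int (c i) * z ^ i)"
    by (rule sum.mono_neutral_right) (use tin tmax in auto)
  also have "\<dots> = (\<Sum>i<t. of_int (c i) * z ^ i) + of_int (c t) * z ^ t"
    by (simp flip: lessThan_Suc_atMost)
  finally have eq: "of_int (c t) * z ^ t = - (\<Sum>i<t. of_int (c i) * z ^ i)"
    using c(3) by (simp add: eq_neg_iff_add_eq_0 add.commute)
  have t0: "t > 0" using eq tin by (cases t) auto
  have "cmod z ^ t \<le> cmod (of_int (c t) * z ^ t)"
  proof -
    have "1 \<le> \<bar>c t\<bar>" using tin by auto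
    then have "1 \<le> real_of_int \<bar>c t\<bar>" by linarith
    then show ?thesis using z by (simp add: norm_mult norm_power mult_le_cancel_right1)
  qed
  also have "\<dots> \<le> (\<Sum>i<t. cmod (of_int (c i) * z ^ i))" unfolding eq norm_minus_cancel by (rule norm_sum)
  also have "\<dots> \<le> (\<Sum>i<t. real Q * cmod z ^ (t - 1))"
  proof (rule sum_mono)
    fix i assume i: "i \<in> {..<t}"
    then have "\<bar>c i\<bar> \<le> int Q" using c(2)[of i] tin by auto
    then have "real_of_int \<bar>c i\<bar> \<le> real Q" by linarith
    then show "cmod (of_int (c i) * z ^ i) \<le> real Q * cmod z ^ (t - 1)"
      unfolding norm_mult norm_power norm_of_int using i z
      by (intro mult_mono power_increasing) auto
  qed
  also have "\<dots> = real (t * Q) * cmod z ^ (t - 1)" by simp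
  also have "\<dots> \<le> real (m * Q) * cmod z ^ (t - 1)" using tin by (intro mult_right_mono) (auto intro: mult_right_mono)
  also have "\<dots> < cmod z * cmod z ^ (t - 1)"
    using z by (intro mult_strict_right_mono zero_less_power) linarith+
  also have "\<dots> = cmod z ^ t" using t0 by (simp flip: power_Suc)
  finally show False by simp
qed

text \<open>Reversing the coefficients turns upper bounds for z into upper bounds for its inverse;
  this is the source of Liouville's inequality below.\<close>

lemma int_rel_inverse:
  assumes "int_rel m Q z" "z \<noteq> 0"
  shows "int_rel m Q (inverse z)"
proof -
  from assms obtain c :: "nat \<Rightarrow> int" where c: "\<exists>i\<le>m. c i \<noteq> 0" "\<And>i. i \<le> m \<Longrightarrow> \<bar>c i\<bar> \<le> int Q"
    "(\<Sum>i\<le>m. of_int (c i) * z ^ i) = 0" unfolding int_rel_def by blast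
  have "(\<Sum>i\<le>m. of_int (c (m - i)) * inverse z ^ i) = (\<Sum>i\<le>m. of_int (c i) * inverse z ^ (m - i))"
    by (rule sum.reindex_bij_witness[of _ "\<lambda>i. m - i" "\<lambda>i. m - i"]) auto
  also have "\<dots> = (\<Sum>i\<le>m. inverse z ^ m * (of_int (c i) * z ^ i))"
    by (rule sum.cong) (use assms(2) in \<open>auto simp: power_diff power_inverse field_simps\<close>)
  also have "\<dots> = 0" using c(3) by (simp flip: sum_distrib_left)
  finally have "(\<Sum>i\<le>m. of_int (c (m - i)) * inverse z ^ i) = 0" .
  moreover have "\<exists>i\<le>m. c (m - i) \<noteq> 0" using c(1) by (metis diff_diff_cancel diff_le_self)
  ultimately show ?thesis
    unfolding int_rel_def using c(2) by (intro exI[of _ "\<lambda>i. c (m - i)"]) auto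
qed

section \<open>Finite places\<close>

locale finite_place = complex_subfield_loc K for K :: "complex set" +
  fixes v :: "complex \<Rightarrow> real"
  assumes place: "v \<in> finite_places K"
begin

abbreviation "q \<equiv> residue_card K v"

lemma v_nonneg: "x \<in> K \<Longrightarrow> v x \<ge> 0" and v_eq_0: "x \<in> K \<Longrightarrow> v x = 0 \<longleftrightarrow> x = 0"
  and v_mult: "x \<in> K \<Longrightarrow> y \<in> K \<Longrightarrow> v (x * y) = v x * v y"
  and v_add: "x \<in> K \<Longrightarrow> y \<in> K \<Longrightarrow> v (x + y) \<le> max (v x) (v y)"
  and value_group: "v ` (K - {0}) = range (\<lambda>z::int. real q powi z)"
  and v_ext: "v \<in> extensional K"
  using place by (auto simp: finite_places_def)

lemma v_pos: "x \<in> K \<Longrightarrow> x \<noteq> 0 \<Longrightarrow> v x > 0"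
  using v_nonneg v_eq_0 by (metis less_eq_real_def)

lemma v_0 [simp]: "v 0 = 0"
  using v_eq_0[OF zero_mem] by simp

lemma v_1 [simp]: "v 1 = 1"
proof -
  have "v 1 * v 1 = v 1 * 1" using v_mult[OF one_mem one_mem] by simp
  then show ?thesis using v_pos[OF one_mem] by simp
qed

lemma v_power: "x \<in> K \<Longrightarrow> v (x ^ n) = v x ^ n"
  by (induction n) (auto simp: v_mult power_mem)

lemma v_inverse: "x \<in> K \<Longrightarrow> v (inverse x) = inverse (v x)"
proof (cases "x = 0")
  case False
  assume x: "x \<in> K"
  have "v x * v (inverse x) = 1" using v_mult[OF x inverse_mem[OF x]] False by simp
  then show ?thesis by (metis inverse_unique)
qed simp

lemma v_divide: "x \<in> K \<Longrightarrow> y \<in> K \<Longrightarrow> v (x / y) = v x / v y"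
  by (simp add: divide_inverse v_mult v_inverse inverse_mem)

lemma v_minus: "x \<in> K \<Longrightarrow> v (- x) = v x"
proof -
  assume x: "x \<in> K"
  have m1: "- 1 \<in> K" by (intro uminus_mem one_mem)
  have "(v (- 1))\<^sup>2 = 1" using v_power[OF m1, of 2] by simp
  then have "v (- 1) = 1" using v_nonneg[OF m1] by (simp add: power2_eq_1_iff)
  then show ?thesis using v_mult[OF m1 x] by simp
qed

lemma v_diff: "x \<in> K \<Longrightarrow> y \<in> K \<Longrightarrow> v (x - y) \<le> max (v x) (v y)"
  using v_add[of x "- y"] by (simp add: v_minus uminus_mem)

lemma v_add_dominant: "x \<in> K \<Longrightarrow> y \<in> K \<Longrightarrow> v y < v x \<Longrightarrow> v (x + y) = v x"
  using v_add[of x y] v_diff[of "x + y" y] add_mem[of x y] by (auto simp: max_def split: if_splits)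

lemma v_of_nat: "v (of_nat n) \<le> 1"
proof (induction n)
  case (Suc n)
  have "v (of_nat (Suc n)) \<le> max (v 1) (v (of_nat n))"
    using v_add[OF one_mem of_nat_mem, of n] by simp
  with Suc show ?case by simp
qed simp

lemma v_of_int: "v (of_int z) \<le> 1"
  by (cases z) (auto simp: v_of_nat v_minus of_nat_mem simp del: of_nat_Suc)

lemma v_sum: "(\<And>a. a \<in> A \<Longrightarrow> f a \<in> K) \<Longrightarrow> (\<And>a. a \<in> A \<Longrightarrow> v (f a) \<le> b) \<Longrightarrow> b \<ge> 0 \<Longrightarrow> v (sum f A) \<le> b"
proof (induction A rule: infinite_finite_induct)
  case (insert a A)
  then have "v (f a + sum f A) \<le> max (v (f a)) (v (sum f A))" by (intro v_add sum_mem) auto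
  also have "\<dots> \<le> b" using insert by auto
  finally show ?case using insert by simp
qed auto

section \<open>Residue classes and digits\<close>

definition R where "R = {x \<in> K. v x \<le> 1}"

definition rel where "rel = {(x, y). x \<in> R \<and> y \<in> R \<and> v (x - y) < 1}"

lemma q_altdef: "q = card (R // rel)"
  by (simp add: residue_card_def R_def rel_def Let_def)

lemma equiv_rel: "equiv R rel"
proof (rule equivI)
  show "rel \<subseteq> R \<times> R" by (auto simp: rel_def)
  show "refl_on R rel" by (auto simp: refl_on_def rel_def)
  show "sym rel"
  proof (rule symI)
    fix x y assume "(x, y) \<in> rel"
    then have *: "x \<in> R" "y \<in> R" "v (x - y) < 1" by (auto simp: rel_def)
    moreover have "v (- (x - y)) = v (x - y)" using * by (intro v_minus diff_mem) (auto simp: R_def)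
    ultimately show "(y, x) \<in> rel" by (simp add: rel_def)
  qed
  show "trans rel"
  proof (rule transI)
    fix x y z assume "(x, y) \<in> rel" "(y, z) \<in> rel"
    then have *: "x \<in> R" "y \<in> R" "z \<in> R" "v (x - y) < 1" "v (y - z) < 1" by (auto simp: rel_def)
    have "v ((x - y) + (y - z)) \<le> max (v (x - y)) (v (y - z))"
      using * by (intro v_add diff_mem) (auto simp: R_def)
    then show "(x, z) \<in> rel" using * by (simp add: rel_def)
  qed
qed

text \<open>For an infinite residue field \<open>card\<close> is 0, but then 0 would be the value of
  a nonzero element. If q = 1, the absolute value is trivial and its residue classes are the
  singletons of K, of which there are at least two.\<close>

lemma q_ge_2: "q \<ge> 2"
proof (rule ccontr)
  assume "\<not> q \<ge> 2"
  then consider "q = 0" | "q = 1" by linarith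
  then show False
  proof cases
    case 1
    have "real q powi 1 \<in> v ` (K - {0})" unfolding value_group by (rule rangeI)
    then obtain x where "real q powi 1 = v x" "x \<in> K - {0}" by (rule imageE)
    then show False using v_eq_0[of x] 1 by simp
  next
    case 2
    have v1: "v x = 1" if "x \<in> K" "x \<noteq> 0" for x
    proof -
      have "v x \<in> v ` (K - {0})" using that by auto
      then show ?thesis unfolding value_group 2 by auto
    qed
    have RK: "R = K" using v1 v_0 by (force simp: R_def)
    have rel: "rel = Id_on K"
    proof (intro equalityI subrelI)
      fix x y assume "(x, y) \<in> rel"
      then have "x \<in> K" "y \<in> K" "v (x - y) < 1" by (auto simp: rel_def RK)
      then have "x - y = 0" using v1[of "x - y"] diff_mem by force
      then show "(x, y) \<in> Id_on K" using \<open>x \<in> K\<close> by auto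
    next
      fix x y assume "(x, y) \<in> Id_on K"
      then show "(x, y) \<in> rel" by (auto simp: rel_def RK)
    qed
    have "{0} \<in> R // rel" "{1} \<in> R // rel"
      unfolding rel RK using quotientI[OF zero_mem, of "Id_on K"] quotientI[OF one_mem, of "Id_on K"]
        zero_mem one_mem by (simp_all add: Image_def Id_on_def)
    moreover have "finite (R // rel)" using 2 q_altdef by (metis card.infinite zero_neq_one)
    ultimately have "card {{0 :: complex}, {1}} \<le> card (R // rel)" by (intro card_mono) auto
    then show False using 2 q_altdef by simp
  qed
qed

lemma uniformizer: "\<exists>\<pi>\<in>K. \<pi> \<noteq> 0 \<and> v \<pi> = inverse (real q)"
proof -
  have "real q powi (- 1) \<in> v ` (K - {0})" unfolding value_group by (rule rangeI)
  then show ?thesis by (auto simp: power_int_minus)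
qed

text \<open>Differences of representatives of distinct classes have value at least 1 by the
  definition of the classes and at most 1 by the ultrametric inequality.\<close>

lemma residue_reps: "\<exists>S. S \<subseteq> R \<and> finite S \<and> card S = q \<and> (\<forall>x\<in>S. \<forall>y\<in>S. x \<noteq> y \<longrightarrow> v (x - y) = 1)"
proof -
  define r where "r X = (SOME x. x \<in> X)" for X :: "complex set"
  have r: "r X \<in> X" if X: "X \<in> R // rel" for X
  proof -
    have "X \<noteq> {}" using in_quotient_imp_non_empty[OF equiv_rel X] .
    then show ?thesis unfolding r_def by (rule some_in_eq[THEN iffD2])
  qed
  have rR: "r X \<in> R" if "X \<in> R // rel" for X
    using r[OF that] in_quotient_imp_subset[OF equiv_rel that] by auto
  have fin: "finite (R // rel)" using q_ge_2 q_altdef by (metis card.infinite not_numeral_le_zero)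
  have eqI: "X = Y" if "X \<in> R // rel" "Y \<in> R // rel" "(r X, r Y) \<in> rel" for X Y
    using quotient_eqI[OF equiv_rel that(1,2) r[OF that(1)] r[OF that(2)] that(3)] .
  have inj: "inj_on r (R // rel)"
  proof (rule inj_onI)
    fix X Y assume XY: "X \<in> R // rel" "Y \<in> R // rel" "r X = r Y"
    then have "(r X, r Y) \<in> rel" using rR[OF XY(1)] by (simp add: rel_def)
    then show "X = Y" using eqI XY by blast
  qed
  have "v (r X - r Y) = 1" if XY: "X \<in> R // rel" "Y \<in> R // rel" "r X \<noteq> r Y" for X Y
  proof -
    have "(r X, r Y) \<notin> rel" using eqI XY by blast
    then have "v (r X - r Y) \<ge> 1" using rR XY by (auto simp: rel_def)
    moreover have "v (r X - r Y) \<le> max (v (r X)) (v (r Y))"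
      using rR[OF XY(1)] rR[OF XY(2)] by (intro v_diff) (auto simp: R_def)
    ultimately show ?thesis using rR[OF XY(1)] rR[OF XY(2)] by (auto simp: R_def)
  qed
  then show ?thesis
    using rR inj fin card_image[OF inj] q_altdef by (intro exI[of _ "r ` (R // rel)"]) auto
qed

text \<open>The elements are s_0 + \<pi> s_1 + ... + \<pi>^(e-1) s_(e-1) with digits among the
  residue representatives; the first digit in which two of them differ determines the value of their
  difference.\<close>

lemma digits:
  "\<exists>T. T \<subseteq> R \<and> finite T \<and> card T = q ^ e \<and> (\<forall>x\<in>T. \<forall>y\<in>T. x \<noteq> y \<longrightarrow> v (x - y) > inverse (real q) ^ e)"
proof (induction e)
  case 0
  show ?case by (rule exI[of _ "{0}"]) (auto simp: R_def zero_mem)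
next
  case (Suc e)
  then obtain T where T: "T \<subseteq> R" "finite T" "card T = q ^ e"
    "\<And>x y. x \<in> T \<Longrightarrow> y \<in> T \<Longrightarrow> x \<noteq> y \<Longrightarrow> v (x - y) > inverse (real q) ^ e" by blast
  obtain S where S: "S \<subseteq> R" "finite S" "card S = q"
    "\<And>x y. x \<in> S \<Longrightarrow> y \<in> S \<Longrightarrow> x \<noteq> y \<Longrightarrow> v (x - y) = 1" using residue_reps by blast
  obtain \<pi> where \<pi>: "\<pi> \<in> K" "\<pi> \<noteq> 0" "v \<pi> = inverse (real q)" using uniformizer by blast
  have q1: "inverse (real q) < 1" "inverse (real q) > 0" using q_ge_2 by (auto simp: field_simps)
  define g where "g = (\<lambda>(s, t). s + \<pi> * t)"
  have key: "v (g (s, t) - g (s', t')) > inverse (real q) ^ Suc e"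
    if st: "s \<in> S" "s' \<in> S" "t \<in> T" "t' \<in> T" "(s, t) \<noteq> (s', t')" for s s' t t'
  proof -
    have mem: "s \<in> K" "s' \<in> K" "t \<in> K" "t' \<in> K" "v t \<le> 1" "v t' \<le> 1"
      using st S(1) T(1) by (auto simp: R_def)
    have eq: "g (s, t) - g (s', t') = (s - s') + \<pi> * (t - t')" by (simp add: g_def algebra_simps)
    have vp: "v (\<pi> * (t - t')) = inverse (real q) * v (t - t')"
      using mem \<pi> by (simp add: v_mult diff_mem)
    show ?thesis
    proof (cases "s = s'")
      case True
      then have "v (t - t') > inverse (real q) ^ e" using T(4) st by auto
      then have "inverse (real q) * inverse (real q) ^ e < inverse (real q) * v (t - t')"
        using q1 by (intro mult_strict_left_mono)
      then show ?thesis using True vp eq by simp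
    next
      case False
      have "v (t - t') \<le> 1" using v_diff[OF mem(3,4)] mem(5,6) by simp
      then have "inverse (real q) * v (t - t') \<le> inverse (real q) * 1" using q1 by (intro mult_left_mono) auto
      then have "v (\<pi> * (t - t')) < v (s - s')"
        unfolding vp S(4)[OF st(1,2) False] using q1(1) by linarith
      then have "v (g (s, t) - g (s', t')) = 1"
        unfolding eq using mem \<pi> S(4)[OF st(1,2) False]
        by (subst v_add_dominant) (auto intro: diff_mem mult_mem)
      moreover have "inverse (real q) ^ Suc e < 1" using q1 by (intro power_Suc_less_one) auto
      ultimately show ?thesis by simp
    qed
  qed
  have inj: "inj_on g (S \<times> T)"
  proof (rule inj_onI)
    fix a b assume ab: "a \<in> S \<times> T" "b \<in> S \<times> T" "g a = g b"
    show "a = b"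
    proof (rule ccontr)
      assume "a \<noteq> b"
      with ab key[of "fst a" "fst b" "snd a" "snd b"] have "v (g a - g b) > inverse (real q) ^ Suc e" by auto
      moreover have "0 < inverse (real q) ^ Suc e" by (rule zero_less_power[OF q1(2)])
      moreover have "v (g a - g b) = 0" using ab(3) by simp
      ultimately show False by linarith
    qed
  qed
  show ?case
  proof (rule exI[of _ "g ` (S \<times> T)"], intro conjI ballI impI)
    show "g ` (S \<times> T) \<subseteq> R"
    proof
      fix x assume "x \<in> g ` (S \<times> T)"
      then obtain s t where st: "s \<in> S" "t \<in> T" "x = s + \<pi> * t" by (auto simp: g_def)
      then have mem: "s \<in> K" "t \<in> K" "v s \<le> 1" "v t \<le> 1" using S(1) T(1) by (auto simp: R_def)
      have "v (\<pi> * t) \<le> 1 * 1" unfolding v_mult[OF \<pi>(1) mem(2)]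
        using mem \<pi>(3) q1 v_nonneg by (intro mult_mono) auto
      then show "x \<in> R" unfolding R_def st(3)
        using v_add[OF mem(1) mult_mem[OF \<pi>(1) mem(2)]] mem \<pi>(1) by (auto intro: add_mem mult_mem)
    qed
    show "finite (g ` (S \<times> T))" using S(2) T(2) by simp
    show "card (g ` (S \<times> T)) = q ^ Suc e"
      using card_image[OF inj] S(3) T(3) by (simp add: card_cartesian_product)
  next
    fix x y assume "x \<in> g ` (S \<times> T)" "y \<in> g ` (S \<times> T)" "x \<noteq> y"
    then show "v (x - y) > inverse (real q) ^ Suc e" using key by force
  qed
qed

end

section \<open>Equality of places and weak approximation\<close>

lemma power_Suc_less_one':
  fixes a :: real
  assumes "0 \<le> a" "a < 1"
  shows "a ^ Suc r < 1"
proof -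
  have "a * a ^ r \<le> a * 1" using assms by (intro mult_left_mono power_le_one) auto
  then show ?thesis using assms by simp
qed

lemma finite_placeI: "complex_subfield_loc K \<Longrightarrow> v \<in> finite_places K \<Longrightarrow> finite_place K v"
  by (simp add: finite_place_def finite_place_axioms_def)

lemma real_power_bounded_imp_le_1:
  fixes a b :: real
  assumes "\<And>m. a ^ m * b < c" "b > 0" "a \<ge> 0"
  shows "a \<le> 1"
proof (rule ccontr)
  assume "\<not> a \<le> 1"
  then obtain m where "c / b < a ^ m" using real_arch_pow[of a "c / b"] by auto
  then have "c < a ^ m * b" using assms(2) by (simp add: field_simps)
  with assms(1)[of m] show False by simp
qed

text \<open>Inclusion of the maximal ideals already forces units to be units, hence equal valuation
  rings and residue fields; the normalization of the value group then leaves no room for an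
  exponent.\<close>

lemma finite_places_eqI:
  assumes K: "complex_subfield_loc K" and v: "v \<in> finite_places K" and w: "w \<in> finite_places K"
    and le: "\<And>x. x \<in> K \<Longrightarrow> v x < 1 \<Longrightarrow> w x < 1"
  shows "v = w"
proof -
  interpret v: finite_place K v using K v by (rule finite_placeI)
  interpret w: finite_place K w using K w by (rule finite_placeI)
  obtain \<pi> where \<pi>: "\<pi> \<in> K" "\<pi> \<noteq> 0" "v \<pi> = inverse (real v.q)" using v.uniformizer by blast
  have "v \<pi> < 1" unfolding \<pi>(3) using v.q_ge_2 by (simp add: inverse_less_1_iff)
  \<comment> \<open>All x^m \<pi> lie in the maximal ideal of v, so the powers of w x stay
    bounded.\<close>
  have unit_le: "w x \<le> 1" if x: "x \<in> K" "v x = 1" for x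
  proof (rule real_power_bounded_imp_le_1[where b = "w \<pi>" and c = 1])
    fix m
    have "v (x ^ m * \<pi>) < 1" using x \<pi> \<open>v \<pi> < 1\<close> by (simp add: v.v_mult v.v_power v.power_mem)
    then have "w (x ^ m * \<pi>) < 1" using x \<pi> by (intro le v.mult_mem v.power_mem) auto
    then show "w x ^ m * w \<pi> < 1" using x \<pi> by (simp add: w.v_mult w.v_power v.power_mem)
  qed (use \<pi> x w.v_pos w.v_nonneg in auto)
  have unit: "w x = 1" if x: "x \<in> K" "v x = 1" for x
  proof -
    have "w (inverse x) \<le> 1" using x by (intro unit_le v.inverse_mem) (auto simp: v.v_inverse)
    moreover have "x \<noteq> 0" using x by auto
    ultimately have "1 \<le> w x"
      using w.v_pos[of x] x by (simp add: w.v_inverse inverse_le_1_iff)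
    with unit_le[OF x] show ?thesis by simp
  qed
  have gt: "w x > 1" if x: "x \<in> K" "v x > 1" for x
  proof -
    have "x \<noteq> 0" using x by auto
    have "v (inverse x) < 1" using x by (simp add: v.v_inverse inverse_less_1_iff)
    then have "w (inverse x) < 1" using x v.inverse_mem le by blast
    then show ?thesis using w.v_pos[OF x(1) \<open>x \<noteq> 0\<close>] x by (simp add: w.v_inverse inverse_less_1_iff)
  qed
  have le_iff: "w x \<le> 1 \<longleftrightarrow> v x \<le> 1" and less_iff: "w x < 1 \<longleftrightarrow> v x < 1" if "x \<in> K" for x
    using unit[OF that] gt[OF that] le[OF that] by (cases "v x" "1 :: real" rule: linorder_cases; auto)+
  have RR: "v.R = w.R" using le_iff by (auto simp: v.R_def w.R_def)
  have "v.rel = w.rel"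
    unfolding v.rel_def w.rel_def RR using less_iff v.diff_mem by (auto simp: w.R_def)
  then have q: "v.q = w.q" unfolding v.q_altdef w.q_altdef RR by simp
  have q1: "real w.q > 1" using w.q_ge_2 by simp
  have ord: "\<exists>z::int. v x = real w.q powi z" "\<exists>z::int. w x = real w.q powi z" if "x \<in> K" "x \<noteq> 0" for x
    using that v.value_group w.value_group unfolding q by auto
  have w_eq: "w x = inverse (w \<pi>) powi z" if x: "x \<in> K" "x \<noteq> 0" "v x = real w.q powi z" for x z
  proof -
    have mem: "\<pi> powi z \<in> K"
      using \<pi>(1) by (cases z) (auto simp: power_int_def v.power_mem v.inverse_mem)
    have powi: "u (\<pi> powi z) = u \<pi> powi z" if "finite_place K u" for u
    proof -
      interpret u: finite_place K u by (rule that)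
      show ?thesis using \<pi>(1) by (auto simp: power_int_def u.v_power u.v_inverse v.inverse_mem)
    qed
    have "v (x * \<pi> powi z) = 1"
      using v.v_mult[OF x(1) mem] powi[OF v.finite_place_axioms] x(3) \<pi>(3) q q1
      by (simp add: power_int_inverse)
    then have "w (x * \<pi> powi z) = 1" using x(1) mem by (intro unit v.mult_mem)
    then have "w x * w \<pi> powi z = 1" using w.v_mult[OF x(1) mem] powi[OF w.finite_place_axioms] by simp
    moreover have "w \<pi> > 0" using \<pi> w.v_pos by blast
    ultimately show ?thesis by (simp add: power_int_inverse field_simps)
  qed
  \<comment> \<open>Write w \<pi> = q^j, and v \<rho> = q^i for a uniformizer \<rho> of w.
    Comparison gives j i = 1, and j < 0 leaves j = - 1.\<close>
  have wpi: "inverse (w \<pi>) = real w.q"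
  proof -
    obtain j where j: "w \<pi> = real w.q powi j" using ord[OF \<pi>(1,2)] by blast
    have "w \<pi> < 1" using le \<pi> \<open>v \<pi> < 1\<close> by blast
    then have j0: "j < 0" using j q1 by (metis not_le one_le_power_int order_less_imp_le)
    obtain \<rho> where \<rho>: "\<rho> \<in> K" "\<rho> \<noteq> 0" "w \<rho> = inverse (real w.q)" using w.uniformizer by blast
    obtain i where i: "v \<rho> = real w.q powi i" using ord[OF \<rho>(1,2)] by blast
    have "inverse (real w.q) = inverse (w \<pi>) powi i" using w_eq[OF \<rho>(1,2) i] \<rho>(3) by simp
    also have "\<dots> = real w.q powi (- (j * i))"
      using q1 by (simp add: j power_int_minus power_int_inverse power_int_mult)
    finally have "real w.q powi (- 1) = real w.q powi (- (j * i))" by (simp add: power_int_minus)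
    moreover have "real w.q powi a < real w.q powi b" if "a < b" for a b :: int
      using that q1 by (intro power_int_strict_increasing) auto
    ultimately have "- 1 = - (j * i)" by (metis less_irrefl linorder_less_linear)
    then have "j * i = 1" by simp
    then have "j = - 1" using j0 by (auto simp: zmult_eq_1_iff)
    then show ?thesis using j by (simp add: power_int_minus)
  qed
  show "v = w"
  proof (rule extensionalityI[OF v.v_ext w.v_ext])
    fix x assume x: "x \<in> K"
    show "v x = w x"
    proof (cases "x = 0")
      case False
      obtain z where z: "v x = real w.q powi z" using ord(1)[OF x False] by blast
      show ?thesis using w_eq[OF x False z] wpi z by simp
    qed simp
  qed
qed

text \<open>Each of the two places has an element that is small there and not small at the other;
  their quotient separates the places strictly.\<close>

lemma place_pair:
  assumes K: "complex_subfield_loc K" and v: "v \<in> finite_places K" and w: "w \<in> finite_places K" and "v \<noteq> w"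
  shows "\<exists>z\<in>K. v z > 1 \<and> w z < 1"
proof -
  interpret v: finite_place K v using K v by (rule finite_placeI)
  interpret w: finite_place K w using K w by (rule finite_placeI)
  obtain x where x: "x \<in> K" "v x < 1" "w x \<ge> 1" using finite_places_eqI[OF K v w] assms(4) by force
  obtain y where y: "y \<in> K" "w y < 1" "v y \<ge> 1" using finite_places_eqI[OF K w v] assms(4) by force
  have "x \<noteq> 0" "y \<noteq> 0" using x y by auto
  then have "v x > 0" "w x > 0" using x v.v_pos w.v_pos by auto
  then have "v (y / x) > 1" "w (y / x) < 1"
    using x y by (auto simp: v.v_divide w.v_divide)
  then show ?thesis using x y v.divide_mem by blast
qed

lemma eventually_all_powers_small:
  assumes "finite W" "\<And>w. w \<in> W \<Longrightarrow> 0 \<le> a w \<and> a w < (1::real)" "\<And>w. w \<in> W \<Longrightarrow> 0 < e w"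
  shows "\<forall>\<^sub>F r in sequentially. \<forall>w\<in>W. a w ^ r < e w"
proof -
  have "\<forall>\<^sub>F r in sequentially. a w ^ r < e w" if "w \<in> W" for w
    using LIMSEQ_realpow_zero[of "a w"] assms(2,3)[OF that] by (auto simp: order_tendsto_iff)
  then show ?thesis using assms(1) by (simp add: eventually_ball_finite)
qed

text \<open>A high power z^s is small at the old places, and z1 takes care of the new place w. If z
  is large at w, the power is replaced by z^s / (1 + z^s), which is a unit at v and at w and still
  small on W.\<close>

lemma place_separate:
  assumes K: "complex_subfield_loc K" and v: "v \<in> finite_places K"
    and W: "finite W" "W \<subseteq> finite_places K" "v \<notin> W"
  shows "\<exists>z\<in>K. v z > 1 \<and> (\<forall>w\<in>W. w z < 1)"
  using W
proof (induction W rule: finite_induct)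
  case empty
  interpret v: finite_place K v using K v by (rule finite_placeI)
  obtain \<pi> where \<pi>: "\<pi> \<in> K" "\<pi> \<noteq> 0" "v \<pi> = inverse (real v.q)" using v.uniformizer by blast
  then have "v (inverse \<pi>) > 1" using v.q_ge_2 by (simp add: v.v_inverse)
  then show ?case using v.inverse_mem[OF \<pi>(1)] by blast
next
  case (insert w W)
  interpret v: finite_place K v using K v by (rule finite_placeI)
  have wp: "w \<in> finite_places K" using insert.prems by simp
  interpret w: finite_place K w using K wp by (rule finite_placeI)
  have loc: "finite_place K u" if "u \<in> W" for u using that insert.prems by (intro finite_placeI[OF K]) auto
  obtain z where z: "z \<in> K" "v z > 1" "\<And>u. u \<in> W \<Longrightarrow> u z < 1" using insert by auto
  obtain z1 where z1: "z1 \<in> K" "v z1 > 1" "w z1 < 1" using place_pair[OF K v wp] insert.prems by auto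
  have "z1 \<noteq> 0" using z1(2) by auto
  have "\<forall>\<^sub>F r in sequentially. \<forall>u\<in>W. u z ^ r < inverse (u z1)"
  proof (rule eventually_all_powers_small[OF insert.hyps(1)])
    fix u assume u: "u \<in> W"
    interpret u: finite_place K u by (rule loc[OF u])
    show "0 \<le> u z \<and> u z < 1" using u.v_nonneg z(1) z(3)[OF u] by simp
    show "0 < inverse (u z1)" using u.v_pos z1(1) \<open>z1 \<noteq> 0\<close> by simp
  qed
  then obtain r where r0: "\<And>u. u \<in> W \<Longrightarrow> u z ^ Suc r < inverse (u z1)"
    unfolding eventually_sequentially by (meson le_SucI order_refl)
  define s where "s = Suc r"
  have r: "u z ^ s * u z1 < 1" if u: "u \<in> W" for u
  proof -
    interpret u: finite_place K u by (rule loc[OF u])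
    have "u z1 > 0" using u.v_pos z1(1) \<open>z1 \<noteq> 0\<close> by simp
    then show ?thesis using r0[OF u] by (simp add: s_def field_simps)
  qed
  show ?case
  proof (cases "w z \<le> 1")
    case True
    have "1 < v z ^ s * v z1" using z(2) z1(2) by (intro less_1_mult one_less_power) (auto simp: s_def)
    then have "v (z ^ s * z1) > 1" using z z1 by (simp add: v.v_mult v.v_power v.power_mem)
    moreover have "u (z ^ s * z1) < 1" if "u \<in> insert w W" for u
      using that
    proof
      assume "u = w"
      have "w z ^ s \<le> 1" using True w.v_nonneg[OF z(1)] by (intro power_le_one) auto
      then have "w z ^ s * w z1 \<le> 1 * w z1" using w.v_nonneg[OF z1(1)] by (intro mult_right_mono) auto
      then show ?thesis using z z1 \<open>u = w\<close> by (simp add: w.v_mult w.v_power v.power_mem)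
    next
      assume u: "u \<in> W"
      interpret u: finite_place K u by (rule loc[OF u])
      show ?thesis using r[OF u] z z1 by (simp add: u.v_mult u.v_power v.power_mem)
    qed
    ultimately show ?thesis using v.mult_mem[OF v.power_mem[OF z(1)] z1(1)] by blast
  next
    case False
    define t where "t = z ^ s / (1 + z ^ s)"
    have zs: "z ^ s \<in> K" "1 + z ^ s \<in> K" using z(1) by (auto intro: v.add_mem v.power_mem v.one_mem)
    then have tK: "t \<in> K" unfolding t_def by (rule v.divide_mem)
    have big: "u t = 1" if u: "finite_place K u" "u z > 1" for u
    proof -
      interpret u: finite_place K u by (rule u)
      have "u (z ^ s) > 1" using u(2) z(1) by (simp add: u.v_power s_def del: power_Suc)
      then have "u (1 + z ^ s) = u (z ^ s)" "u (z ^ s) \<noteq> 0"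
        using u.v_add_dominant[OF zs(1) v.one_mem] by (auto simp: add.commute)
      then show ?thesis using zs by (simp add: t_def u.v_divide)
    qed
    have "v (t * z1) > 1" using big[OF v.finite_place_axioms z(2)] tK z1 by (simp add: v.v_mult)
    moreover have "u (t * z1) < 1" if "u \<in> insert w W" for u
      using that
    proof
      assume "u = w"
      then show ?thesis using big[OF w.finite_place_axioms] False tK z1 by (simp add: w.v_mult)
    next
      assume u: "u \<in> W"
      interpret u: finite_place K u by (rule loc[OF u])
      have "u (z ^ s) < 1"
        unfolding u.v_power[OF z(1)] s_def by (intro power_Suc_less_one' u.v_nonneg z(1) z(3)[OF u])
      then have "u (1 + z ^ s) = 1" using u.v_add_dominant[OF v.one_mem zs(1)] by simp
      then have "u t = u z ^ s" using zs z(1) by (simp add: t_def u.v_divide u.v_power)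
      then show ?thesis using r[OF u] tK z1 by (simp add: u.v_mult)
    qed
    ultimately show ?thesis using v.mult_mem[OF tK z1(1)] by blast
  qed
qed

text \<open>By the ultrametric inequality z^s / (1 + z^s) has value exactly 1 where z is large, and
  its value tends to 0 with growing s where z is small.\<close>

lemma place_approx:
  assumes K: "complex_subfield_loc K" and v: "v \<in> finite_places K"
    and W: "finite W" "W \<subseteq> finite_places K" "v \<notin> W" and e: "\<And>w. w \<in> W \<Longrightarrow> 0 < (e w :: real)"
  shows "\<exists>t\<in>K. v t = 1 \<and> (\<forall>w\<in>W. w t < e w)"
proof -
  interpret v: finite_place K v using K v by (rule finite_placeI)
  have loc: "finite_place K u" if "u \<in> W" for u using that W by (intro finite_placeI[OF K]) auto
  obtain z where z: "z \<in> K" "v z > 1" "\<And>u. u \<in> W \<Longrightarrow> u z < 1" using place_separate[OF K v W] by blast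
  have "\<forall>\<^sub>F r in sequentially. \<forall>u\<in>W. u z ^ r < e u"
  proof (rule eventually_all_powers_small[OF W(1)])
    fix u assume u: "u \<in> W"
    interpret u: finite_place K u by (rule loc[OF u])
    show "0 \<le> u z \<and> u z < 1" using u.v_nonneg z(1) z(3)[OF u] by simp
  qed (use e in auto)
  then obtain r where r: "\<And>u. u \<in> W \<Longrightarrow> u z ^ Suc r < e u"
    unfolding eventually_sequentially by (meson le_SucI order_refl)
  define s where "s = Suc r"
  define t where "t = z ^ s / (1 + z ^ s)"
  have zs: "z ^ s \<in> K" "1 + z ^ s \<in> K" using z(1) by (auto intro: v.add_mem v.power_mem v.one_mem)
  then have tK: "t \<in> K" unfolding t_def by (rule v.divide_mem)
  have "v (z ^ s) > 1" using z by (simp add: v.v_power s_def del: power_Suc)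
  then have "v (1 + z ^ s) = v (z ^ s)" "v (z ^ s) \<noteq> 0"
    using v.v_add_dominant[OF zs(1) v.one_mem] by (auto simp: add.commute)
  then have "v t = 1" using zs by (simp add: t_def v.v_divide)
  moreover have "u t < e u" if u: "u \<in> W" for u
  proof -
    interpret u: finite_place K u by (rule loc[OF u])
    have "u (z ^ s) < 1"
      unfolding u.v_power[OF z(1)] s_def by (intro power_Suc_less_one' u.v_nonneg z(1) z(3)[OF u])
    then have "u (1 + z ^ s) = 1" using u.v_add_dominant[OF v.one_mem zs(1)] by simp
    then have "u t = u z ^ s" using zs z(1) by (simp add: t_def u.v_divide u.v_power)
    then show ?thesis using r[OF u] by (simp add: s_def)
  qed
  ultimately show ?thesis using tK by blast
qed

section \<open>Half of the product formula\<close>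

lemma (in finite_place) v_le_1_power:
  assumes "x \<in> K" "x \<noteq> 0" "v x \<le> 1"
  shows "\<exists>e. v x = inverse (real q) ^ e"
proof -
  have "v x \<in> range (\<lambda>z::int. real q powi z)" using assms value_group by blast
  then obtain z :: int where z: "v x = real q powi z" by (rule rangeE)
  have "z \<le> 0"
  proof (rule ccontr)
    assume "\<not> z \<le> 0"
    then have "1 < real q powi z" using q_ge_2 by (intro one_less_power_int) auto
    with z assms(3) show False by simp
  qed
  then have "real q powi z = inverse (real q) ^ nat (- z)" by (simp add: power_int_def)
  with z show ?thesis by auto
qed

lemma sum_powers_le:
  fixes c :: nat
  assumes "c \<ge> 2"
  shows "(\<Sum>j<k. c ^ j) \<le> c ^ k"
proof (induction k)
  case (Suc k)
  have "(\<Sum>j<Suc k. c ^ j) \<le> c ^ k + c ^ k" using Suc by simp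
  also have "\<dots> = 2 * c ^ k" by simp
  also have "\<dots> \<le> c * c ^ k" using assms by (rule mult_le_mono1)
  finally show ?case by simp
qed simp

text \<open>
  The inequality half of the product formula. Weak approximation turns \<open>\<pi>\<close>-adic digits at the
  places in \<open>V\<close> into \<open>\<Prod>\<^sub>v \<parallel>c\<parallel>\<^sub>v\<inverse>\<close> elements that are pairwise incongruent modulo \<open>c\<close> and
  integral at \<open>V\<close>; \<open>c\<close>-adic expansions of length \<open>k\<close> in these digits are pairwise distinct, but
  they lie in a fixed lattice and have coordinates \<open>O(c\<^sup>k)\<close>.
\<close>

lemma places_product_bound:
  assumes K: "complex_subfield_loc K" and sp: "spans n \<beta> K"
    and V: "finite V" "V \<subseteq> finite_places K" and c: "c \<ge> (2::nat)"
  shows "(\<Prod>v\<in>V. inverse (v (of_nat c))) \<le> real c ^ n"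
proof -
  interpret complex_subfield_loc K by (rule K)
  have loc: "finite_place K v" if "v \<in> V" for v using that V by (intro finite_placeI[OF K]) auto
  define C where "C = complex_of_nat c"
  have CK: "C \<in> K" and C0: "C \<noteq> 0" using c by (auto simp: C_def of_nat_mem)
  have vC: "0 < v C" "v C \<le> 1" if "v \<in> V" for v
  proof -
    interpret v: finite_place K v by (rule loc[OF that])
    show "0 < v C" "v C \<le> 1" using v.v_pos[OF CK C0] v.v_of_nat[of c] by (auto simp: C_def)
  qed
  have "\<exists>e. v C = inverse (real (residue_card K v)) ^ e" if "v \<in> V" for v
    using finite_place.v_le_1_power[OF loc[OF that] CK C0 vC(2)[OF that]] .
  then obtain e where e: "\<And>v. v \<in> V \<Longrightarrow> v C = inverse (real (residue_card K v)) ^ e v" by metis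
  \<comment> \<open>The elements of T are pairwise incongruent modulo c at v, and their number is
    the inverse of the value of c.\<close>
  have "\<exists>T. T \<subseteq> {x \<in> K. v x \<le> 1} \<and> finite T \<and> card T = residue_card K v ^ e v \<and>
      (\<forall>x\<in>T. \<forall>y\<in>T. x \<noteq> y \<longrightarrow> v (x - y) > v C)" if "v \<in> V" for v
    using finite_place.digits[OF loc[OF that], of "e v"] e[OF that]
    unfolding finite_place.R_def[OF loc[OF that]] by simp
  then have "\<forall>v. \<exists>T. v \<in> V \<longrightarrow> T \<subseteq> {x \<in> K. v x \<le> 1} \<and> finite T \<and> card T = residue_card K v ^ e v \<and>
      (\<forall>x\<in>T. \<forall>y\<in>T. x \<noteq> y \<longrightarrow> v (x - y) > v C)" by simp
  from choice[OF this] obtain T where T0: "\<forall>v. v \<in> V \<longrightarrow> T v \<subseteq> {x \<in> K. v x \<le> 1} \<and> finite (T v) \<and>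
      card (T v) = residue_card K v ^ e v \<and> (\<forall>x\<in>T v. \<forall>y\<in>T v. x \<noteq> y \<longrightarrow> v (x - y) > v C)"
    by (elim exE)
  have T: "T v \<subseteq> {x \<in> K. v x \<le> 1}" "finite (T v)" "card (T v) = residue_card K v ^ e v"
    "\<And>x y. x \<in> T v \<Longrightarrow> y \<in> T v \<Longrightarrow> x \<noteq> y \<Longrightarrow> v (x - y) > v C" if "v \<in> V" for v
    using T0[rule_format, OF that] by simp_all
  \<comment> \<open>The multiplier u acts like an idempotent of the Chinese remainder theorem: a
    unit at v, it makes all digits of v divisible by c at the other places.\<close>
  have "\<exists>u\<in>K. v u = 1 \<and> (\<forall>w\<in>V - {v}. \<forall>t\<in>T v. w (u * t) \<le> w C)" if v: "v \<in> V" for v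
  proof -
    have nn: "(\<Sum>t\<in>T v. w t) \<ge> 0" if w: "w \<in> V" for w
    proof (rule sum_nonneg)
      fix t assume "t \<in> T v"
      then have "t \<in> K" using T(1)[OF v] by auto
      then show "0 \<le> w t" by (rule finite_place.v_nonneg[OF loc[OF w]])
    qed
    \<comment> \<open>The denominator exceeds every value w t with t in T v, and it is positive even
      if all of these vanish.\<close>
    have "\<exists>u\<in>K. v u = 1 \<and> (\<forall>w\<in>V - {v}. w u < w C / (1 + (\<Sum>t\<in>T v. w t)))"
    proof (rule place_approx[OF K])
      fix w assume "w \<in> V - {v}"
      then show "0 < w C / (1 + (\<Sum>t\<in>T v. w t))" using vC(1)[of w] nn[of w] by (auto intro!: divide_pos_pos)
    qed (use V v in auto)
    then obtain u where u: "u \<in> K" "v u = 1" "\<And>w. w \<in> V - {v} \<Longrightarrow> w u < w C / (1 + (\<Sum>t\<in>T v. w t))"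
      by blast
    have "w (u * t) \<le> w C" if w: "w \<in> V - {v}" and t: "t \<in> T v" for w t
    proof -
      interpret w: finite_place K w using w by (intro loc) auto
      have tK: "t \<in> K" using T(1)[OF v] t by auto
      have pos: "0 < 1 + (\<Sum>t\<in>T v. w t)" using nn[of w] w by auto
      have "w t \<le> (\<Sum>t\<in>T v. w t)"
        by (rule member_le_sum[OF t _ T(2)[OF v]]) (use T(1)[OF v] w.v_nonneg in auto)
      then have "w u * w t \<le> w u * (1 + (\<Sum>t\<in>T v. w t))"
        using w.v_nonneg[OF u(1)] by (intro mult_left_mono) auto
      also have "\<dots> \<le> w C" using u(3)[OF w] pos by (simp add: pos_less_divide_eq)
      finally show ?thesis using w.v_mult[OF u(1) tK] by simp
    qed
    with u show ?thesis by blast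
  qed
  then have "\<forall>v. \<exists>u. v \<in> V \<longrightarrow> u \<in> K \<and> v u = 1 \<and> (\<forall>w\<in>V - {v}. \<forall>t\<in>T v. w (u * t) \<le> w C)" by blast
  from choice[OF this] obtain u where u0: "\<forall>v. v \<in> V \<longrightarrow> u v \<in> K \<and> v (u v) = 1 \<and>
      (\<forall>w\<in>V - {v}. \<forall>t\<in>T v. w (u v * t) \<le> w C)" by (elim exE)
  have u: "u v \<in> K" "v (u v) = 1"
    "\<And>w t. w \<in> V \<Longrightarrow> w \<noteq> v \<Longrightarrow> t \<in> T v \<Longrightarrow> w (u v * t) \<le> w C" if "v \<in> V" for v
    using u0[rule_format, OF that] by simp_all
  define I where "I = PiE V T"
  define g where "g \<tau> = (\<Sum>v\<in>V. u v * \<tau> v)" for \<tau>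
  have finI: "finite I" unfolding I_def using V(1) T(2) by (intro finite_PiE) auto
  have term_K: "u v * \<tau> v \<in> K" if "\<tau> \<in> I" "v \<in> V" for \<tau> v
    using u(1)[OF that(2)] T(1)[OF that(2)] PiE_mem[of \<tau> V T v] that by (auto simp: I_def intro: mult_mem)
  have term_le: "w (u v * \<tau> v) \<le> (if v = w then 1 else w C)" if "\<tau> \<in> I" "v \<in> V" "w \<in> V" for \<tau> v w
  proof -
    have t: "\<tau> v \<in> T v" using that PiE_mem by (auto simp: I_def)
    interpret w: finite_place K w using that by (intro loc)
    have tK: "\<tau> v \<in> K" "v (\<tau> v) \<le> 1" using T(1)[OF that(2)] t by auto
    show ?thesis
      using u(3)[OF that(2,3) _ t] u(2)[OF that(2)] tK w.v_mult[OF u(1)[OF that(2)] tK(1)] by auto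
  qed
  have gK: "g \<tau> \<in> K" if "\<tau> \<in> I" for \<tau>
    unfolding g_def using term_K[OF that] by (rule sum_mem)
  have g_le: "w (g \<tau>) \<le> 1" if "\<tau> \<in> I" "w \<in> V" for \<tau> w
  proof -
    interpret w: finite_place K w using that by (intro loc)
    show ?thesis unfolding g_def
    proof (rule w.v_sum)
      fix v assume v: "v \<in> V"
      show "u v * \<tau> v \<in> K" by (rule term_K[OF that(1) v])
      show "w (u v * \<tau> v) \<le> 1" using term_le[OF that(1) v that(2)] vC(2)[OF that(2)] by (auto split: if_splits)
    qed simp
  qed
  \<comment> \<open>At a place where \<tau> and \<tau>' differ, the difference of their digits
    survives modulo c, while the contributions of the other places are divisible by c.\<close>
  have sep: "\<exists>v\<in>V. v (g \<tau> - g \<tau>') > v C" if tt: "\<tau> \<in> I" "\<tau>' \<in> I" "\<tau> \<noteq> \<tau>'" for \<tau> \<tau>'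
  proof -
    obtain v where v: "v \<in> V" "\<tau> v \<noteq> \<tau>' v" using tt unfolding I_def by (metis PiE_ext)
    interpret v: finite_place K v using v by (intro loc)
    have t: "\<tau> v \<in> T v" "\<tau>' v \<in> T v" using tt v PiE_mem by (auto simp: I_def)
    have tK: "\<tau> v \<in> K" "\<tau>' v \<in> K" using t T(1)[OF v(1)] by auto
    define a where "a = u v * \<tau> v - u v * \<tau>' v"
    define b where "b = (\<Sum>w\<in>V - {v}. u w * \<tau> w - u w * \<tau>' w)"
    have "v (u v * (\<tau> v - \<tau>' v)) = v (\<tau> v - \<tau>' v)"
      using v.v_mult[OF u(1)[OF v(1)] diff_mem[OF tK]] u(2)[OF v(1)] by simp
    then have a: "v a > v C" using T(4)[OF v(1) t v(2)] by (simp add: a_def right_diff_distrib)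
    have aK: "a \<in> K" unfolding a_def using term_K tt v by (intro diff_mem) auto
    have bK: "b \<in> K" unfolding b_def using term_K tt by (intro sum_mem diff_mem) auto
    have "v b \<le> v C" unfolding b_def
    proof (rule v.v_sum)
      fix w assume w: "w \<in> V - {v}"
      have wK: "u w * \<tau> w \<in> K" "u w * \<tau>' w \<in> K" using w term_K tt by auto
      show "u w * \<tau> w - u w * \<tau>' w \<in> K" using wK by (rule diff_mem)
      show "v (u w * \<tau> w - u w * \<tau>' w) \<le> v C"
        using v.v_diff[OF wK] term_le[OF tt(1) _ v(1), of w] term_le[OF tt(2) _ v(1), of w] w by auto
    qed (use vC(1)[OF v(1)] in simp)
    then have "v (a + b) = v a" using a aK bK by (intro v.v_add_dominant) auto
    moreover have "g \<tau> - g \<tau>' = a + b"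
      unfolding g_def a_def b_def sum_subtractf[symmetric] by (rule sum.remove[OF V(1) v(1)])
    ultimately show ?thesis using a v(1) by (intro bexI[of _ v]) auto
  qed
  define N where "N = card I"
  have N: "real N = (\<Prod>v\<in>V. inverse (v (of_nat c)))"
  proof -
    have "real N = (\<Prod>v\<in>V. real (card (T v)))" by (simp add: N_def I_def card_PiE V(1))
    also have "\<dots> = (\<Prod>v\<in>V. inverse (v C))"
      by (rule prod.cong) (simp_all add: T(3) e power_inverse)
    finally show ?thesis by (simp add: C_def)
  qed
  define G where "G k \<omega> = (\<Sum>j<k. C ^ j * g (\<omega> j))" for k :: nat and \<omega>
  \<comment> \<open>The first position in which the expansions differ dominates at a place where the
    two digits are incongruent modulo c, because all later terms carry a further factor c.\<close>
  have G_inj: "G k \<omega> \<noteq> G k \<omega>'"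
    if w: "\<omega> \<in> PiE {..<k} (\<lambda>_. I)" "\<omega>' \<in> PiE {..<k} (\<lambda>_. I)" "\<omega> \<noteq> \<omega>'" for k \<omega> \<omega>'
  proof -
    have "\<exists>j. j < k \<and> \<omega> j \<noteq> \<omega>' j" using w by (metis PiE_ext lessThan_iff)
    then obtain j where j: "j < k" "\<omega> j \<noteq> \<omega>' j" "\<And>i. i < j \<Longrightarrow> \<not> (i < k \<and> \<omega> i \<noteq> \<omega>' i)"
      using exists_least_iff[of "\<lambda>j. j < k \<and> \<omega> j \<noteq> \<omega>' j"] by blast
    have wI: "\<omega> i \<in> I" "\<omega>' i \<in> I" if "i < k" for i using w that by (auto dest: PiE_mem)
    define h where "h i = g (\<omega> i) - g (\<omega>' i)" for i
    have hK: "h i \<in> K" if "i < k" for i unfolding h_def using wI[OF that] gK by (intro diff_mem) auto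
    obtain v where v: "v \<in> V" "v (h j) > v C" using sep[OF wI[OF j(1)] j(2)] by (auto simp: h_def)
    interpret v: finite_place K v using v by (intro loc)
    have h1: "v (h i) \<le> 1" if "i < k" for i
      unfolding h_def using v.v_diff[OF gK[OF wI(1)[OF that]] gK[OF wI(2)[OF that]]]
        g_le[OF wI(1)[OF that] v(1)] g_le[OF wI(2)[OF that] v(1)] by simp
    have split: "G k \<omega> - G k \<omega>' = C ^ j * h j + (\<Sum>i\<in>{Suc j..<k}. C ^ i * h i)"
    proof -
      have "G k \<omega> - G k \<omega>' = (\<Sum>i<k. C ^ i * h i)"
        by (simp add: G_def h_def right_diff_distrib sum_subtractf)
      also have "\<dots> = (\<Sum>i\<in>{j..<k}. C ^ i * h i)"
        by (rule sum.mono_neutral_right) (use j(3) in \<open>auto simp: h_def not_le\<close>)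
      also have "\<dots> = C ^ j * h j + (\<Sum>i\<in>{Suc j..<k}. C ^ i * h i)"
        by (rule sum.atLeast_Suc_lessThan[OF j(1)])
      finally show ?thesis .
    qed
    have first: "v (C ^ j * h j) > v C ^ Suc j"
      using v vC(1)[OF v(1)] hK[OF j(1)] CK by (simp add: v.v_mult v.v_power power_mem mult.commute)
    have "v (\<Sum>i\<in>{Suc j..<k}. C ^ i * h i) \<le> v C ^ Suc j"
    proof (rule v.v_sum)
      fix i assume i: "i \<in> {Suc j..<k}"
      show "C ^ i * h i \<in> K" using i CK hK by (intro mult_mem power_mem) auto
      have "v C ^ i * v (h i) \<le> v C ^ Suc j * 1"
        using i h1[of i] vC[OF v(1)] v.v_nonneg hK by (intro mult_mono power_decreasing) auto
      then show "v (C ^ i * h i) \<le> v C ^ Suc j" using i hK CK by (simp add: v.v_mult v.v_power power_mem)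
    qed (use vC(1)[OF v(1)] in simp)
    then have "v (G k \<omega> - G k \<omega>') = v (C ^ j * h j)"
      unfolding split using first hK CK j(1)
      by (intro v.v_add_dominant mult_mem power_mem sum_mem) auto
    moreover have "0 < v C ^ Suc j" using vC(1)[OF v(1)] by (rule zero_less_power)
    ultimately have "v (G k \<omega> - G k \<omega>') \<noteq> 0" using first by linarith
    then show ?thesis by auto
  qed
  obtain E :: nat and a :: "complex \<Rightarrow> nat \<Rightarrow> int" and W :: nat where E: "E > 0" "W > 0"
    and a: "\<And>x. x \<in> g ` I \<Longrightarrow> of_nat E * x = (\<Sum>i<n. of_int (a x i) * \<beta> i)"
    and aW: "\<And>x. x \<in> g ` I \<Longrightarrow> (\<Sum>i<n. \<bar>a x i\<bar>) \<le> int W"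
  proof -
    have "finite (g ` I)" "g ` I \<subseteq> K" using finI gK by auto
    from spans_common_denominator[OF sp this] obtain E :: nat and a :: "complex \<Rightarrow> nat \<Rightarrow> int" and W :: nat
      where *: "E > 0" "W > 0" "\<forall>x\<in>g ` I. of_nat E * x = (\<Sum>i<n. of_int (a x i) * \<beta> i)"
        "\<forall>x\<in>g ` I. (\<Sum>i<n. \<bar>a x i\<bar>) \<le> int W" by (elim exE conjE)
    show thesis by (rule that[OF *(1,2) *(3)[rule_format] *(4)[rule_format]])
  qed
  have bound: "N ^ k \<le> (2 * (W * c ^ k) + 1) ^ n" for k
  proof (rule ccontr)
    define P where "P = PiE {..<k} (\<lambda>_. I)"
    define x where "x \<omega> i = (\<Sum>j<k. int (c ^ j) * a (g (\<omega> j)) i)" for \<omega> i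
    assume "\<not> ?thesis"
    moreover have "card P = N ^ k" by (simp add: P_def card_PiE N_def)
    ultimately have big: "card P > (2 * (W * c ^ k) + 1) ^ n" by simp
    have "\<exists>\<omega>\<in>P. \<exists>\<omega>'\<in>P. \<omega> \<noteq> \<omega>' \<and> (\<forall>i<n. x \<omega> i = x \<omega>' i)"
    proof (rule pigeonhole_int_vectors[OF _ _ big])
      show "finite P" unfolding P_def using finI by (intro finite_PiE) auto
      fix \<omega> i assume w: "\<omega> \<in> P" and i: "i < n"
      have "\<bar>x \<omega> i\<bar> \<le> (\<Sum>j<k. \<bar>int (c ^ j) * a (g (\<omega> j)) i\<bar>)" unfolding x_def by (rule sum_abs)
      also have "\<dots> \<le> (\<Sum>j<k. int (c ^ j) * int W)"
      proof (rule sum_mono)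
        fix j assume "j \<in> {..<k}"
        then have "\<omega> j \<in> I" using w by (auto simp: P_def dest: PiE_mem)
        then have "(\<Sum>i<n. \<bar>a (g (\<omega> j)) i\<bar>) \<le> int W" by (intro aW) auto
        moreover have "\<bar>a (g (\<omega> j)) i\<bar> \<le> (\<Sum>i<n. \<bar>a (g (\<omega> j)) i\<bar>)"
          by (rule member_le_sum[of i "{..<n}" "\<lambda>i. \<bar>a (g (\<omega> j)) i\<bar>"]) (use i in auto)
        ultimately have "\<bar>a (g (\<omega> j)) i\<bar> \<le> int W" by linarith
        then show "\<bar>int (c ^ j) * a (g (\<omega> j)) i\<bar> \<le> int (c ^ j) * int W"
          unfolding abs_mult abs_of_nat by (intro mult_left_mono) auto
      qed
      also have "\<dots> = int (W * (\<Sum>j<k. c ^ j))" by (simp add: sum_distrib_left mult.commute)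
      also have "\<dots> \<le> int (W * c ^ k)" using sum_powers_le[OF c, of k] by (intro of_nat_mono mult_le_mono2)
      finally show "\<bar>x \<omega> i\<bar> \<le> int (W * c ^ k)" .
    qed
    then obtain \<omega> \<omega>' where ww: "\<omega> \<in> P" "\<omega>' \<in> P" "\<omega> \<noteq> \<omega>'" "\<And>i. i < n \<Longrightarrow> x \<omega> i = x \<omega>' i" by blast
    have EG: "of_nat E * G k \<omega> = (\<Sum>i<n. of_int (x \<omega> i) * \<beta> i)" if w: "\<omega> \<in> P" for \<omega>
    proof -
      have "of_nat E * G k \<omega> = (\<Sum>j<k. C ^ j * (of_nat E * g (\<omega> j)))"
        by (simp add: G_def sum_distrib_left mult.left_commute)
      also have "\<dots> = (\<Sum>j<k. \<Sum>i<n. of_int (int (c ^ j) * a (g (\<omega> j)) i) * \<beta> i)"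
      proof (rule sum.cong)
        fix j assume "j \<in> {..<k}"
        then have "\<omega> j \<in> I" using w by (auto simp: P_def dest: PiE_mem)
        then have *: "of_nat E * g (\<omega> j) = (\<Sum>i<n. of_int (a (g (\<omega> j)) i) * \<beta> i)" by (intro a) auto
        show "C ^ j * (of_nat E * g (\<omega> j)) = (\<Sum>i<n. of_int (int (c ^ j) * a (g (\<omega> j)) i) * \<beta> i)"
          unfolding * by (simp add: C_def sum_distrib_left mult.assoc)
      qed simp
      also have "\<dots> = (\<Sum>i<n. \<Sum>j<k. of_int (int (c ^ j) * a (g (\<omega> j)) i) * \<beta> i)" by (rule sum.swap)
      also have "\<dots> = (\<Sum>i<n. of_int (x \<omega> i) * \<beta> i)"
        unfolding x_def of_int_sum sum_distrib_right ..
      finally show ?thesis .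
    qed
    have "of_nat E * G k \<omega> = of_nat E * G k \<omega>'"
      unfolding EG[OF ww(1)] EG[OF ww(2)] using ww(4) by simp
    then have "G k \<omega> = G k \<omega>'" using E(1) by simp
    with G_inj ww show False by (auto simp: P_def)
  qed
  \<comment> \<open>N^k is at most (3 W)^n (c^n)^k for every k, so letting k grow eliminates the
    constant.\<close>
  have "real N / real c ^ n \<le> 1"
  proof (rule real_power_bounded_imp_le_1[where b = 1 and c = "real ((3 * W) ^ n) + 1"])
    fix k
    have "2 * (W * c ^ k) + 1 \<le> 3 * W * c ^ k"
    proof -
      have "1 \<le> W * c ^ k" using E(2) c by (simp add: Suc_le_eq)
      then show ?thesis by simp
    qed
    then have "(2 * (W * c ^ k) + 1) ^ n \<le> (3 * W * c ^ k) ^ n" by (intro power_mono) auto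
    with bound[of k] have "N ^ k \<le> (3 * W * c ^ k) ^ n" by linarith
    also have "\<dots> = (3 * W) ^ n * (c ^ n) ^ k"
      unfolding power_mult_distrib[of "3 * W"] by (simp only: power_mult[symmetric] mult.commute[of k])
    finally have "real (N ^ k) \<le> real ((3 * W) ^ n * (c ^ n) ^ k)" by (simp only: of_nat_le_iff)
    then have "real N ^ k \<le> real ((3 * W) ^ n) * (real c ^ n) ^ k" by (simp only: of_nat_mult of_nat_power)
    then have "(real N / real c ^ n) ^ k \<le> real ((3 * W) ^ n)"
      using c by (simp only: power_divide) (subst pos_divide_le_eq; simp)
    then show "(real N / real c ^ n) ^ k * 1 < real ((3 * W) ^ n) + 1" by linarith
  qed auto
  then have "real N \<le> real c ^ n" using c by (simp add: divide_le_eq_1)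
  then show ?thesis using N by simp
qed

text \<open>Rational integers suffice as arguments, because the denominators furnished by integer
  relations are of this kind. The case \<bar>z\<bar> = 1 stands apart, as expansions in base c need
  c \<ge> 2.\<close>

lemma places_log_sum:
  assumes K: "complex_subfield_loc K" and sp: "spans n \<beta> K"
    and V: "finite V" "V \<subseteq> finite_places K" and z: "(z::int) \<noteq> 0"
  shows "(\<Sum>v\<in>V. - ln (v (of_int z))) \<le> n * ln \<bar>real_of_int z\<bar>"
proof -
  interpret complex_subfield_loc K by (rule K)
  define c where "c = nat \<bar>z\<bar>"
  have loc: "finite_place K v" if "v \<in> V" for v using that V by (intro finite_placeI[OF K]) auto
  have vz: "v (of_int z) = v (of_nat c)" if "v \<in> V" for v
  proof -
    interpret v: finite_place K v by (rule loc[OF that])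
    have "of_int z = (of_nat c :: complex) \<or> of_int z = - (of_nat c :: complex)"
      by (cases "z \<ge> 0") (auto simp: c_def)
    then show ?thesis using v.v_minus[OF of_nat_mem] by auto
  qed
  have vpos: "v (of_nat c) > 0" if "v \<in> V" for v
  proof -
    interpret v: finite_place K v by (rule loc[OF that])
    show ?thesis using z by (intro v.v_pos of_nat_mem) (simp add: c_def)
  qed
  have cz: "real c = \<bar>real_of_int z\<bar>" by (simp add: c_def)
  show ?thesis
  proof (cases "c = 1")
    case True
    have v1: "v (of_nat c) = 1" if "v \<in> V" for v
      using True finite_place.v_1[OF loc[OF that]] by simp
    have "(\<Sum>v\<in>V. - ln (v (of_int z))) = 0"
    proof (intro sum.neutral ballI)
      fix v assume "v \<in> V"
      then show "- ln (v (of_int z)) = 0" using vz[of v] v1[of v] by simp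
    qed
    then show ?thesis using cz True by simp
  next
    case False
    then have c: "c \<ge> 2" using z by (simp add: c_def)
    have "(\<Sum>v\<in>V. - ln (v (of_int z))) = (\<Sum>v\<in>V. ln (inverse (v (of_nat c))))"
      by (rule sum.cong) (auto simp: vz ln_inverse vpos)
    also have "\<dots> = ln (\<Prod>v\<in>V. inverse (v (of_nat c)))"
      by (rule ln_prod[symmetric]) (use V(1) in \<open>auto dest: vpos\<close>)
    also have "\<dots> \<le> ln (real c ^ n)"
      using places_product_bound[OF K sp V c] c
      by (subst ln_le_cancel_iff) (auto intro!: prod_pos dest: vpos)
    also have "\<dots> = n * ln (real c)" using c by (simp add: ln_realpow)
    finally show ?thesis by (simp add: cz)
  qed
qed

text \<open>The leading coefficient of a relation is a denominator valid at all finite places at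
  once: if v x > 1, the relation bounds the top term by the next lower power of v x.\<close>

lemma int_rel_place:
  assumes K: "complex_subfield_loc K" and x: "x \<in> K" "int_rel m Q x"
  shows "\<exists>z::int. z \<noteq> 0 \<and> \<bar>z\<bar> \<le> int Q \<and> (\<forall>v\<in>finite_places K. v (of_int z) * v x \<le> 1)"
proof -
  interpret complex_subfield_loc K by (rule K)
  from x(2) obtain c :: "nat \<Rightarrow> int" where c: "\<exists>i\<le>m. c i \<noteq> 0" "\<And>i. i \<le> m \<Longrightarrow> \<bar>c i\<bar> \<le> int Q"
    "(\<Sum>i\<le>m. of_int (c i) * x ^ i) = 0" unfolding int_rel_def by blast
  define t where "t = Max {i. i \<le> m \<and> c i \<noteq> 0}"
  have tin: "t \<in> {i. i \<le> m \<and> c i \<noteq> 0}" unfolding t_def by (rule Max_in) (use c(1) in auto)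
  have tmax: "c i = 0" if "i > t" "i \<le> m" for i
    using that Max_ge[of "{i. i \<le> m \<and> c i \<noteq> 0}" i] unfolding t_def by fastforce
  have "(\<Sum>i\<le>m. of_int (c i) * x ^ i) = (\<Sum>i\<le>t. of_int (c i) * x ^ i)"
    by (rule sum.mono_neutral_right) (use tin tmax in auto)
  also have "\<dots> = (\<Sum>i<t. of_int (c i) * x ^ i) + of_int (c t) * x ^ t"
    by (simp flip: lessThan_Suc_atMost)
  finally have eq: "of_int (c t) * x ^ t = - (\<Sum>i<t. of_int (c i) * x ^ i)"
    using c(3) by (simp add: eq_neg_iff_add_eq_0 add.commute)
  have t0: "t > 0" using eq tin by (cases t) auto
  have "v (of_int (c t)) * v x \<le> 1" if v: "v \<in> finite_places K" for v
  proof -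
    interpret v: finite_place K v using K v by (rule finite_placeI)
    show ?thesis
    proof (cases "v x \<le> 1")
      case True
      then show ?thesis using v.v_of_int v.v_nonneg[OF of_int_mem] v.v_nonneg[OF x(1)]
        by (intro mult_le_one) auto
    next
      case False
      have mem: "of_int (c i) * x ^ i \<in> K" for i by (intro mult_mem of_int_mem power_mem x)
      have "v (of_int (c t)) * v x ^ t = v (of_int (c t) * x ^ t)"
        by (simp add: v.v_mult of_int_mem power_mem x v.v_power)
      also have "\<dots> = v (\<Sum>i<t. of_int (c i) * x ^ i)"
        unfolding eq by (intro v.v_minus sum_mem mem)
      also have "\<dots> \<le> v x ^ (t - 1)"
      proof (rule v.v_sum)
        fix i assume i: "i \<in> {..<t}"
        have "v (of_int (c i)) * v x ^ i \<le> 1 * v x ^ (t - 1)"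
          using v.v_of_int v.v_nonneg[OF x(1)] i False by (intro mult_mono power_increasing) auto
        then show "v (of_int (c i) * x ^ i) \<le> v x ^ (t - 1)"
          by (simp add: v.v_mult of_int_mem power_mem x v.v_power)
      qed (use mem False in auto)
      finally have "v (of_int (c t)) * v x * v x ^ (t - 1) \<le> 1 * v x ^ (t - 1)"
        using t0 by (simp add: mult.assoc flip: power_Suc)
      then show ?thesis using False by (subst (asm) mult_le_cancel_right) auto
    qed
  qed
  then show ?thesis using tin c(2)[of t] by (intro exI[of _ "c t"]) auto
qed

section \<open>Heights\<close>

lemma embeddings_closed:
  assumes "\<sigma> \<in> embeddings K" "complex_subfield_loc K"
  shows "\<sigma> 0 = 0" "\<sigma> 1 = 1" "\<And>x y. x \<in> K \<Longrightarrow> y \<in> K \<Longrightarrow> \<sigma> (x + y) = \<sigma> x + \<sigma> y"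
    "\<And>x y. x \<in> K \<Longrightarrow> y \<in> K \<Longrightarrow> \<sigma> (x * y) = \<sigma> x * \<sigma> y"
    "\<And>x n. x \<in> K \<Longrightarrow> \<sigma> (x ^ n) = \<sigma> x ^ n"
    "\<And>n. \<sigma> (of_nat n) = of_nat n" "\<And>z. \<sigma> (of_int z) = of_int z" "\<And>q. \<sigma> (of_rat q) = of_rat q"
    "\<And>(A :: nat set) f. finite A \<Longrightarrow> (\<And>a. a \<in> A \<Longrightarrow> f a \<in> K) \<Longrightarrow> \<sigma> (sum f A) = (\<Sum>a\<in>A. \<sigma> (f a))"
proof -
  interpret complex_subfield_loc K by (rule assms(2))
  show one: "\<sigma> 1 = 1" using assms(1) by (simp add: embeddings_def)
  show add: "\<sigma> (x + y) = \<sigma> x + \<sigma> y" if "x \<in> K" "y \<in> K" for x y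
    using assms(1) that by (simp add: embeddings_def)
  show mult: "\<sigma> (x * y) = \<sigma> x * \<sigma> y" if "x \<in> K" "y \<in> K" for x y
    using assms(1) that by (simp add: embeddings_def)
  show zero: "\<sigma> 0 = 0" using add[OF zero_mem zero_mem] by simp
  show "\<sigma> (x ^ n) = \<sigma> x ^ n" if "x \<in> K" for x n
    by (induction n) (simp_all add: one mult that power_mem)
  show nat: "\<sigma> (of_nat n) = of_nat n" for n
    by (induction n) (simp_all add: zero one add one_mem of_nat_mem)
  show int: "\<sigma> (of_int z) = of_int z" for z
  proof (cases z)
    case (neg n)
    have e: "of_int z = - (of_nat (Suc n) :: complex)" using neg by simp
    have "\<sigma> (of_int z + of_nat (Suc n)) = \<sigma> (of_int z) + \<sigma> (of_nat (Suc n))"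
      by (rule add[OF of_int_mem of_nat_mem])
    moreover have "of_int z + of_nat (Suc n) = (0 :: complex)" by (simp add: e)
    ultimately have "\<sigma> (of_int z) + of_nat (Suc n) = 0" by (simp only: nat zero)
    then show ?thesis unfolding e by (simp only: eq_neg_iff_add_eq_0)
  qed (simp add: nat)
  show "\<sigma> (of_rat q) = of_rat q" for q
  proof (cases q)
    case (Fract a b)
    have "\<sigma> (of_rat q * of_int b) = \<sigma> (of_rat q) * \<sigma> (of_int b)" by (rule mult[OF of_rat_mem of_int_mem])
    moreover have "of_rat q * of_int b = (of_int a :: complex)" using Fract by (simp add: of_rat_rat)
    ultimately have "\<sigma> (of_rat q) * of_int b = of_int a" unfolding int by (simp add: int)
    then show ?thesis using Fract by (simp add: of_rat_rat nonzero_eq_divide_eq)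
  qed
  show "\<sigma> (sum f A) = (\<Sum>a\<in>A. \<sigma> (f a))" if "finite A" "\<And>a. a \<in> A \<Longrightarrow> f a \<in> K" for A :: "nat set" and f
    using that by (induction A rule: finite_induct) (simp_all add: zero add sum_mem)
qed

lemma embedding_int_rel:
  assumes "\<sigma> \<in> embeddings K" "complex_subfield_loc K" "x \<in> K" "int_rel m Q x"
  shows "int_rel m Q (\<sigma> x)"
proof -
  interpret complex_subfield_loc K by (rule assms(2))
  note h = embeddings_closed[OF assms(1,2)]
  from assms(4) obtain c :: "nat \<Rightarrow> int" where c: "\<exists>i\<le>m. c i \<noteq> 0" "\<forall>i\<le>m. \<bar>c i\<bar> \<le> int Q"
    "(\<Sum>i\<le>m. of_int (c i) * x ^ i) = 0" unfolding int_rel_def by blast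
  have "(\<Sum>i\<le>m. of_int (c i) * \<sigma> x ^ i) = (\<Sum>i\<le>m. \<sigma> (of_int (c i) * x ^ i))"
    by (rule sum.cong) (simp_all add: h assms(3) of_int_mem power_mem)
  also have "\<dots> = \<sigma> (\<Sum>i\<le>m. of_int (c i) * x ^ i)"
    by (rule h(9)[symmetric]) (simp_all add: assms(3) mult_mem of_int_mem power_mem)
  also have "\<dots> = 0" using c(3) h(1) by simp
  finally show ?thesis unfolding int_rel_def using c(1,2) by blast
qed

text \<open>A generic element separates finitely many embeddings, which become distinct roots of one
  rational polynomial of degree at most \<open>n\<close>.\<close>

lemma card_embeddings_le:
  assumes K: "complex_subfield_loc K" and sp: "spans n \<beta> K"
  shows "finite (embeddings K) \<and> card (embeddings K) \<le> n"
proof -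
  interpret complex_subfield_loc K by (rule K)
  have sepP: "\<exists>\<theta>\<in>K. \<forall>(\<sigma>, \<tau>)\<in>P. \<sigma> \<theta> \<noteq> \<tau> \<theta>"
    if "finite P" "\<forall>(\<sigma>, \<tau>)\<in>P. \<sigma> \<in> embeddings K \<and> \<tau> \<in> embeddings K \<and> \<sigma> \<noteq> \<tau>" for P
    using that
  proof (induction P rule: finite_induct)
    case (insert p P)
    obtain \<sigma> \<tau> where p: "p = (\<sigma>, \<tau>)" by (cases p)
    from insert obtain \<theta> where \<theta>: "\<theta> \<in> K" "\<forall>(\<sigma>, \<tau>)\<in>P. \<sigma> \<theta> \<noteq> \<tau> \<theta>" by auto
    have st: "\<sigma> \<in> embeddings K" "\<tau> \<in> embeddings K" "\<sigma> \<noteq> \<tau>" using insert.prems p by auto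
    have "\<exists>\<eta>\<in>K. \<sigma> \<eta> \<noteq> \<tau> \<eta>"
    proof (rule ccontr)
      assume "\<not> ?thesis"
      then have "\<sigma> = \<tau>" using st(1,2) by (intro extensionalityI[of \<sigma> K \<tau>]) (auto simp: embeddings_def)
      with st(3) show False by simp
    qed
    then obtain \<eta> where \<eta>: "\<eta> \<in> K" "\<sigma> \<eta> \<noteq> \<tau> \<eta>" by blast
    \<comment> \<open>Two embeddings agree at \<theta> + t \<eta> only if an affine function of t
      that is not identically zero vanishes, hence for at most one t.\<close>
    define bad where "bad = (\<lambda>(\<sigma> :: complex \<Rightarrow> complex, \<tau> :: complex \<Rightarrow> complex). {t::nat. \<sigma> (\<theta> + of_nat t * \<eta>) = \<tau> (\<theta> + of_nat t * \<eta>)})"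
    have fin: "finite (bad r)" if r: "r \<in> insert p P" for r
    proof -
      obtain \<sigma>' \<tau>' where r': "r = (\<sigma>', \<tau>')" by (cases r)
      have e: "\<sigma>' \<in> embeddings K" "\<tau>' \<in> embeddings K" using insert.prems r r' by auto
      have nz: "\<sigma>' \<theta> \<noteq> \<tau>' \<theta> \<or> \<sigma>' \<eta> \<noteq> \<tau>' \<eta>" using r r' p \<theta>(2) \<eta>(2) by auto
      have lin: "\<rho> (\<theta> + of_nat t * \<eta>) = \<rho> \<theta> + of_nat t * \<rho> \<eta>" if "\<rho> \<in> embeddings K" for \<rho> t
        using embeddings_closed(3,4,6)[OF that K] \<theta>(1) \<eta>(1) of_nat_mem mult_mem by simp
      have "t = t'" if t: "t \<in> bad r" "t' \<in> bad r" for t t'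
      proof -
        have eq: "\<sigma>' \<theta> - \<tau>' \<theta> + of_nat s * (\<sigma>' \<eta> - \<tau>' \<eta>) = 0" if "s \<in> bad r" for s
          using that lin[OF e(1), of s] lin[OF e(2), of s] by (simp add: bad_def r' algebra_simps)
        have "(of_nat t - of_nat t') * (\<sigma>' \<eta> - \<tau>' \<eta>) = 0"
        proof -
          have "(of_nat t - of_nat t') * (\<sigma>' \<eta> - \<tau>' \<eta>) = (\<sigma>' \<theta> - \<tau>' \<theta> + of_nat t * (\<sigma>' \<eta> - \<tau>' \<eta>))
              - (\<sigma>' \<theta> - \<tau>' \<theta> + of_nat t' * (\<sigma>' \<eta> - \<tau>' \<eta>))"
            by (simp add: algebra_simps)
          then show ?thesis unfolding eq[OF t(1)] eq[OF t(2)] by simp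
        qed
        moreover have "\<sigma>' \<eta> - \<tau>' \<eta> \<noteq> 0" using eq[OF t(1)] nz by auto
        ultimately show ?thesis by simp
      qed
      then have "bad r = {} \<or> (\<exists>t. bad r = {t})" by blast
      then show ?thesis by auto
    qed
    have "finite (\<Union>r\<in>insert p P. bad r)" using insert.hyps(1) fin by (intro finite_UN_I) auto
    then obtain t where t: "t \<notin> (\<Union>r\<in>insert p P. bad r)" using ex_new_if_finite[OF infinite_UNIV_nat] by blast
    show ?case
    proof (rule bexI[of _ "\<theta> + of_nat t * \<eta>"])
      show "\<forall>(\<sigma>, \<tau>)\<in>insert p P. \<sigma> (\<theta> + of_nat t * \<eta>) \<noteq> \<tau> (\<theta> + of_nat t * \<eta>)"
        using t unfolding bad_def by blast
    qed (intro add_mem mult_mem of_nat_mem \<theta>(1) \<eta>(1))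
  qed (use zero_mem in blast)
  have le: "card E \<le> n" if E: "finite E" "E \<subseteq> embeddings K" for E
  proof -
    have "\<exists>\<theta>\<in>K. \<forall>(\<sigma>, \<tau>)\<in>{(\<sigma>, \<tau>). \<sigma> \<in> E \<and> \<tau> \<in> E \<and> \<sigma> \<noteq> \<tau>}. \<sigma> \<theta> \<noteq> \<tau> \<theta>"
      by (rule sepP) (use E in \<open>auto intro: finite_subset[of _ "E \<times> E"]\<close>)
    then obtain \<theta> where \<theta>: "\<theta> \<in> K" "\<And>\<sigma> \<tau>. \<sigma> \<in> E \<Longrightarrow> \<tau> \<in> E \<Longrightarrow> \<sigma> \<noteq> \<tau> \<Longrightarrow> \<sigma> \<theta> \<noteq> \<tau> \<theta>" by auto
    have inj: "inj_on (\<lambda>\<sigma>. \<sigma> \<theta>) E" using \<theta>(2) by (auto simp: inj_on_def)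
    have span: "y \<in> rat_vs.span (\<beta> ` {..<n})" if "y \<in> K" for y
    proof -
      obtain u :: "nat \<Rightarrow> rat" where "y = (\<Sum>i<n. of_rat (u i) * \<beta> i)" using sp \<open>y \<in> K\<close> unfolding spans_def by blast
      then show ?thesis
        by (simp only:) (intro rat_vs.span_sum rat_vs.span_scale rat_vs.span_base; simp)
    qed
    obtain c :: "nat \<Rightarrow> rat" where c: "\<exists>i\<le>n. c i \<noteq> 0" "(\<Sum>i\<le>n. of_rat (c i) * \<theta> ^ i) = 0"
      using rat_dependent_family[of "\<beta> ` {..<n}" n "\<lambda>i. \<theta> ^ i"] span power_mem[OF \<theta>(1)]
        card_image_le[of "{..<n}" \<beta>] by auto
    have root: "(\<Sum>i\<le>n. of_rat (c i) * \<sigma> \<theta> ^ i) = 0" if s: "\<sigma> \<in> E" for \<sigma>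
    proof -
      have s': "\<sigma> \<in> embeddings K" using s E by auto
      note h = embeddings_closed[OF s' K]
      have "(\<Sum>i\<le>n. of_rat (c i) * \<sigma> \<theta> ^ i) = (\<Sum>i\<le>n. \<sigma> (of_rat (c i) * \<theta> ^ i))"
        by (rule sum.cong) (simp_all add: h \<theta>(1) of_rat_mem power_mem)
      also have "\<dots> = \<sigma> (\<Sum>i\<le>n. of_rat (c i) * \<theta> ^ i)"
        by (rule h(9)[symmetric]) (simp_all add: \<theta>(1) mult_mem of_rat_mem power_mem)
      finally show ?thesis using c(2) h(1) by simp
    qed
    obtain i0 where i0: "i0 \<le> n" "complex_of_rat (c i0) \<noteq> 0" using c(1) by auto
    have "(\<lambda>\<sigma>. \<sigma> \<theta>) ` E \<subseteq> {z. (\<Sum>i\<le>n. of_rat (c i) * z ^ i) = 0}" using root by auto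
    then have "card ((\<lambda>\<sigma>. \<sigma> \<theta>) ` E) \<le> card {z. (\<Sum>i\<le>n. complex_of_rat (c i) * z ^ i) = 0}"
      using polyfun_roots_finite[of "\<lambda>i. of_rat (c i)" i0 n] i0 by (intro card_mono) auto
    also have "\<dots> \<le> n" using polyfun_roots_card[of "\<lambda>i. of_rat (c i)" i0 n] i0 by simp
    finally show ?thesis using card_image[OF inj] by simp
  qed
  have "finite (embeddings K)"
  proof (rule ccontr)
    assume "infinite (embeddings K)"
    then obtain E where "E \<subseteq> embeddings K" "finite E" "card E = Suc n"
      using infinite_arbitrarily_large by blast
    with le[of E] show False by simp
  qed
  with le show ?thesis by blast
qed

section \<open>Comparing the height with integer relations and with one embedding\<close>

lemma rat_adjoin_subfield: "complex_subfield (rat_adjoin X)"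
  unfolding rat_adjoin_def complex_subfield_def by auto

lemma rat_adjoin_subset: "X \<subseteq> rat_adjoin X"
  by (auto simp: rat_adjoin_def)

lemma rat_adjoin_least: "complex_subfield L \<Longrightarrow> X \<subseteq> L \<Longrightarrow> rat_adjoin X \<subseteq> L"
  by (auto simp: rat_adjoin_def)

text \<open>The archimedean terms fall under Cauchy's bound for each conjugate. At a finite place
  the maximum is attained by some coordinate and bounded by its denominator; replacing this unknown
  coordinate by the sum over all of them allows the two sums to be exchanged.\<close>

lemma relative_height_upper:
  assumes K: "complex_subfield_loc K" and sp: "spans n \<beta> K"
    and x: "\<And>i. i \<le> N \<Longrightarrow> x i \<in> K" "x 0 = 1" "\<And>i. i \<le> N \<Longrightarrow> int_rel m Q (x i)" and mQ: "m \<ge> 1" "Q \<ge> 1"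
  shows "relative_height K N x \<le> real n * ln (real (m * Q)) + real (N + 1) * (real n * ln (real Q))"
proof -
  interpret complex_subfield_loc K by (rule K)
  have mQ1: "1 \<le> real m * real Q" using mQ by (metis mult_mono' of_nat_1 of_nat_le_iff mult_1 zero_le_one)
  have emb: "finite (embeddings K)" "card (embeddings K) \<le> n" using card_embeddings_le[OF K sp] by auto
  have "(\<Sum>\<sigma>\<in>embeddings K. ln (Max ((\<lambda>i. cmod (\<sigma> (x i))) ` {..N}))) \<le> (\<Sum>\<sigma>\<in>embeddings K. ln (m * Q))"
  proof (rule sum_mono)
    fix \<sigma> assume s: "\<sigma> \<in> embeddings K"
    let ?M = "Max ((\<lambda>i. cmod (\<sigma> (x i))) ` {..N})"
    have "cmod (\<sigma> (x i)) \<le> real m * real Q" if "i \<le> N" for i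
      using int_rel_bound[OF embedding_int_rel[OF s K x(1)[OF that] x(3)[OF that]]] mQ1 by auto
    then have "?M \<le> real m * real Q" by (subst Max_le_iff) auto
    moreover have "cmod (\<sigma> (x 0)) \<le> ?M" by (rule Max_ge) auto
    then have "1 \<le> ?M" using embeddings_closed(2)[OF s K] x(2) by simp
    ultimately show "ln ?M \<le> ln (real (m * Q))" using mQ1 by (subst ln_le_cancel_iff) auto
  qed
  also have "\<dots> = card (embeddings K) * ln (m * Q)" by simp
  also have "\<dots> \<le> n * ln (m * Q)" using emb(2) mQ1 by (intro mult_right_mono) auto
  finally have 1: "(\<Sum>\<sigma>\<in>embeddings K. ln (Max ((\<lambda>i. cmod (\<sigma> (x i))) ` {..N}))) \<le> n * ln (m * Q)" .
  let ?f = "\<lambda>v. ln (Max ((\<lambda>i. v (x i)) ` {..N}))"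
  have "\<forall>i. \<exists>z::int. i \<le> N \<longrightarrow> z \<noteq> 0 \<and> \<bar>z\<bar> \<le> int Q \<and> (\<forall>v\<in>finite_places K. v (of_int z) * v (x i) \<le> 1)"
    using int_rel_place[OF K x(1) x(3)] by blast
  from choice[OF this] obtain z :: "nat \<Rightarrow> int" where
    z: "\<And>i. i \<le> N \<Longrightarrow> z i \<noteq> 0" "\<And>i. i \<le> N \<Longrightarrow> \<bar>z i\<bar> \<le> int Q"
      "\<And>i v. i \<le> N \<Longrightarrow> v \<in> finite_places K \<Longrightarrow> v (of_int (z i)) * v (x i) \<le> 1" by blast
  have fin: "(\<Sum>v\<in>V. ?f v) \<le> (N + 1) * (n * ln Q)" if V: "finite V" "V \<subseteq> finite_places K" for V
  proof -
    have "(\<Sum>v\<in>V. ?f v) \<le> (\<Sum>v\<in>V. \<Sum>i\<le>N. - ln (v (of_int (z i))))"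
    proof (rule sum_mono)
      fix v assume v: "v \<in> V"
      have vp: "v \<in> finite_places K" using v V by auto
      interpret v: finite_place K v using K vp by (rule finite_placeI)
      let ?M = "Max ((\<lambda>i. v (x i)) ` {..N})"
      have "?M \<in> (\<lambda>i. v (x i)) ` {..N}" by (rule Max_in) auto
      then obtain i where "?M = v (x i)" "i \<in> {..N}" by (rule imageE)
      then have i: "i \<le> N" "?M = v (x i)" by simp_all
      have "v (x 0) \<le> ?M" by (rule Max_ge) auto
      then have M1: "1 \<le> v (x i)" using x(2) i by simp
      have vz: "0 < v (of_int (z l))" "v (of_int (z l)) \<le> 1" if "l \<le> N" for l
        using z(1)[OF that] v.v_of_int by (auto intro!: v.v_pos of_int_mem)
      have "v (x i) \<le> inverse (v (of_int (z i)))"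
        using z(3)[OF i(1) vp] vz(1)[OF i(1)] by (simp add: inverse_eq_divide pos_le_divide_eq mult.commute)
      then have "ln (v (x i)) \<le> ln (inverse (v (of_int (z i))))"
        using M1 vz(1)[OF i(1)] by (subst ln_le_cancel_iff) auto
      also have "\<dots> = - ln (v (of_int (z i)))" using vz(1)[OF i(1)] by (simp add: ln_inverse)
      also have "\<dots> \<le> (\<Sum>i\<le>N. - ln (v (of_int (z i))))"
        by (rule member_le_sum[of i "{..N}" "\<lambda>i. - ln (v (of_int (z i)))"]) (use i vz in auto)
      finally show "?f v \<le> (\<Sum>i\<le>N. - ln (v (of_int (z i))))" unfolding i(2) .
    qed
    also have "\<dots> = (\<Sum>i\<le>N. \<Sum>v\<in>V. - ln (v (of_int (z i))))" by (rule sum.swap)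
    also have "\<dots> \<le> (\<Sum>i\<le>N. n * ln Q)"
    proof (rule sum_mono)
      fix i assume "i \<in> {..N}"
      then have i: "i \<le> N" by simp
      have "(\<Sum>v\<in>V. - ln (v (of_int (z i)))) \<le> n * ln \<bar>real_of_int (z i)\<bar>"
        by (rule places_log_sum[OF K sp V z(1)[OF i]])
      also have "\<dots> \<le> n * ln Q"
      proof (rule mult_left_mono)
        have "real_of_int \<bar>z i\<bar> \<le> real Q" using z(2)[OF i] by linarith
        then show "ln \<bar>real_of_int (z i)\<bar> \<le> ln (real Q)"
          using z(1)[OF i] mQ by (subst ln_le_cancel_iff) auto
      qed simp
      finally show "(\<Sum>v\<in>V. - ln (v (of_int (z i)))) \<le> n * ln Q" .
    qed
    also have "\<dots> = (N + 1) * (n * ln Q)" by simp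
    finally show ?thesis .
  qed
  \<comment> \<open>Where the sum does not exist, \<open>infsum\<close> is 0, which also respects
    the bound.\<close>
  have "infsum ?f (finite_places K) \<le> (N + 1) * (n * ln Q)"
  proof (cases "?f summable_on finite_places K")
    case True
    then show ?thesis by (rule infsum_le_finite_sums) (use fin in auto)
  next
    case False
    then show ?thesis using mQ by (simp add: infsum_not_exists)
  qed
  with 1 show ?thesis unfolding relative_height_def by linarith
qed

text \<open>Since x_0 = 1, every local term is nonnegative, so the contribution of the identity
  embedding alone gives the bound.\<close>

lemma relative_height_lower:
  assumes K: "complex_subfield_loc K" and sp: "spans n \<beta> K"
    and x: "\<And>i. i \<le> N \<Longrightarrow> x i \<in> K" "x 0 = 1" and j: "j \<le> N" "cmod (x j) \<ge> 1"
  shows "relative_height K N x \<ge> ln (cmod (x j))"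
proof -
  interpret complex_subfield_loc K by (rule K)
  have emb: "finite (embeddings K)" using card_embeddings_le[OF K sp] by auto
  let ?id = "restrict (\<lambda>z. z) K"
  have id: "?id \<in> embeddings K" by (auto simp: embeddings_def one_mem add_mem mult_mem)
  have "infsum (\<lambda>v. ln (Max ((\<lambda>i. v (x i)) ` {..N}))) (finite_places K) \<ge> 0"
  proof (rule infsum_nonneg)
    fix v assume v: "v \<in> finite_places K"
    interpret v: finite_place K v using K v by (rule finite_placeI)
    have "v (x 0) \<le> Max ((\<lambda>i. v (x i)) ` {..N})" by (rule Max_ge) auto
    then show "0 \<le> ln (Max ((\<lambda>i. v (x i)) ` {..N}))" using x(2) by simp
  qed
  moreover have "ln (Max ((\<lambda>i. cmod (?id (x i))) ` {..N}))
      \<le> (\<Sum>\<sigma>\<in>embeddings K. ln (Max ((\<lambda>i. cmod (\<sigma> (x i))) ` {..N})))"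
  proof (rule member_le_sum[OF id _ emb])
    fix \<sigma> assume s: "\<sigma> \<in> embeddings K - {?id}"
    have "cmod (\<sigma> (x 0)) \<le> Max ((\<lambda>i. cmod (\<sigma> (x i))) ` {..N})" by (rule Max_ge) auto
    then show "0 \<le> ln (Max ((\<lambda>i. cmod (\<sigma> (x i))) ` {..N}))"
      using embeddings_closed(2)[of \<sigma> K] s K x(2) by simp
  qed
  moreover have "cmod (?id (x j)) \<le> Max ((\<lambda>i. cmod (?id (x i))) ` {..N})" by (rule Max_ge) (use j in auto)
  then have "ln (cmod (x j)) \<le> ln (Max ((\<lambda>i. cmod (?id (x i))) ` {..N}))"
    using j x(1)[OF j(1)] by (subst ln_le_cancel_iff) auto
  ultimately show ?thesis unfolding relative_height_def by linarith
qed

lemma normalized_coords_aff_pt: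
  assumes "1 \<in> K"
  shows "normalized_coords (aff_pt K x) = x(0 := 1)"
  unfolding normalized_coords_def
proof (rule the_equality)
  have L: "(LEAST i. y i \<noteq> 0) = 0" if "y 0 \<noteq> 0" for y :: "nat \<Rightarrow> complex"
    using that by (intro Least_equality) auto
  show "x(0 := 1) \<in> aff_pt K x \<and> (x(0 := 1)) (LEAST i. (x(0 := 1)) i \<noteq> 0) = 1"
    using assms L[of "x(0 := 1)"] by (auto simp: aff_pt_def proj_pt_def intro!: exI[of _ 1])
  fix y assume y: "y \<in> aff_pt K x \<and> y (LEAST i. y i \<noteq> 0) = 1"
  then obtain c where c: "c \<noteq> 0" "y = (\<lambda>i. c * (x(0 := 1)) i)" by (auto simp: aff_pt_def proj_pt_def)
  then have "y 0 = c" by simp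
  with L[of y] c y have "c = 1" by simp
  with c show "y = x(0 := 1)" by (simp add: fun_upd_def)
qed

lemma dim_bounds:
  assumes K: "complex_subfield_loc K" and sp: "spans n \<beta> K"
  shows "1 \<le> rat_vs.dim K" "rat_vs.dim K \<le> n"
proof -
  interpret complex_subfield_loc K by (rule K)
  have span: "K \<subseteq> rat_vs.span (\<beta> ` {..<n})"
  proof
    fix y assume "y \<in> K"
    then obtain u :: "nat \<Rightarrow> rat" where "y = (\<Sum>i<n. of_rat (u i) * \<beta> i)" using sp unfolding spans_def by blast
    then show "y \<in> rat_vs.span (\<beta> ` {..<n})"
      by (simp only:) (intro rat_vs.span_sum rat_vs.span_scale rat_vs.span_base; simp)
  qed
  have "rat_vs.dim K \<le> card (\<beta> ` {..<n})" by (rule rat_vs.dim_le_card[OF span]) simp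
  also have "\<dots> \<le> n" using card_image_le[of "{..<n}" \<beta>] by simp
  finally show "rat_vs.dim K \<le> n" .
  have "number_field K" unfolding number_field_def using subfield span by (auto intro!: exI[of _ "\<beta> ` {..<n}"])
  from number_field_basis[OF this] obtain B where B: "finite B" "K = rat_vs.span B" "card B = rat_vs.dim K" by metis
  have "B \<noteq> {}"
  proof
    assume "B = {}"
    then have "K = {0}" using B(2) by simp
    then show False using one_mem by simp
  qed
  then show "1 \<le> rat_vs.dim K" using B(1,3) by (metis card_gt_0_iff One_nat_def Suc_leI)
qed

text \<open>The field generated by the coordinates changes from point to point, but as a subfield of
  L it has degree between 1 and n; the upper bound uses the former, the lower bound the
  latter.\<close>

lemma standard_height_bounds:
  assumes L: "complex_subfield_loc L" and sp: "spans n \<beta> L" and "1 \<in> K"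
    and x: "\<And>i. i \<in> {1..N} \<Longrightarrow> x i \<in> L"
  shows "m \<ge> 1 \<Longrightarrow> Q \<ge> 1 \<Longrightarrow> (\<And>i. i \<in> {1..N} \<Longrightarrow> int_rel m Q (x i)) \<Longrightarrow>
      standard_height N (aff_pt K x) \<le> real n * ln (real (m * Q)) + real (N + 1) * (real n * ln (real Q))"
    and "j \<in> {1..N} \<Longrightarrow> cmod (x j) \<ge> 1 \<Longrightarrow> standard_height N (aff_pt K x) \<ge> ln (cmod (x j)) / n"
proof -
  interpret L: complex_subfield_loc L by (rule L)
  define y where "y = x(0 := 1)"
  define K' where "K' = rat_adjoin (y ` {..N})"
  have K': "complex_subfield_loc K'" unfolding K'_def by (intro complex_subfield_locI rat_adjoin_subfield)
  have yK': "y i \<in> K'" if "i \<le> N" for i using rat_adjoin_subset[of "y ` {..N}"] that by (auto simp: K'_def)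
  have yL: "y ` {..N} \<subseteq> L" using x L.one_mem by (auto simp: y_def)
  have "K' \<subseteq> L" unfolding K'_def by (rule rat_adjoin_least[OF L.subfield yL])
  then have sp': "spans n \<beta> K'" using sp spans_subset by blast
  note dim = dim_bounds[OF K' sp']
  have y0: "y 0 = 1" by (simp add: y_def)
  have sh: "standard_height N (aff_pt K x) = relative_height K' N y / real (rat_vs.dim K')"
    unfolding standard_height_def normalized_coords_aff_pt[OF assms(3)] Let_def K'_def y_def ..
  have ge0: "relative_height K' N y \<ge> 0"
    using relative_height_lower[OF K' sp', of N y 0] yK' y0 by simp
  {
    assume mQ: "m \<ge> 1" "Q \<ge> 1" and rel: "\<And>i. i \<in> {1..N} \<Longrightarrow> int_rel m Q (x i)"
    \<comment> \<open>Coordinate 0 equals 1 and satisfies 1 - x = 0, a relation that exists because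
      m and Q are at least 1.\<close>
    have r1: "int_rel m Q 1"
      unfolding int_rel_def
    proof (intro exI[of _ "\<lambda>i. if i = 0 then 1 else if i = 1 then - 1 else 0"] conjI)
      have "(\<Sum>i\<le>m. complex_of_int (if i = 0 then 1 else if i = 1 then - 1 else 0) * 1 ^ i)
          = (\<Sum>i\<in>{0, 1}. complex_of_int (if i = 0 then 1 else if i = 1 then - 1 else 0) * 1 ^ i)"
        by (rule sum.mono_neutral_right) (use mQ in auto)
      then show "(\<Sum>i\<le>m. complex_of_int (if i = 0 then 1 else if i = 1 then - 1 else 0) * 1 ^ i) = 0" by simp
    qed (use mQ in auto)
    have "int_rel m Q (y i)" if "i \<le> N" for i
      using rel[of i] r1 that by (cases "i = 0") (auto simp: y_def)
    then have "relative_height K' N y \<le> real n * ln (real (m * Q)) + real (N + 1) * (real n * ln (real Q))"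
      using relative_height_upper[OF K' sp' _ _ _ mQ, of N y] yK' y0 by blast
    moreover have "relative_height K' N y / real (rat_vs.dim K') \<le> relative_height K' N y / 1"
      using dim(1) ge0 by (intro divide_left_mono) auto
    ultimately show "standard_height N (aff_pt K x) \<le> real n * ln (real (m * Q)) + real (N + 1) * (real n * ln (real Q))"
      unfolding sh by simp
  }
  {
    assume j: "j \<in> {1..N}" "cmod (x j) \<ge> 1"
    then have yj: "y j = x j" "j \<le> N" by (auto simp: y_def)
    then have "ln (cmod (x j)) \<le> relative_height K' N y"
      using relative_height_lower[OF K' sp', of N y j] yK' y0 j by simp
    moreover have "ln (cmod (x j)) / n \<le> ln (cmod (x j)) / real (rat_vs.dim K')"
      using dim j(2) by (intro divide_left_mono) auto
    ultimately show "standard_height N (aff_pt K x) \<ge> ln (cmod (x j)) / n"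
      unfolding sh using dim(1) by (smt (verit) divide_right_mono of_nat_0_le_iff)
  }
qed

section \<open>Growth recursions\<close>

primrec growth_bound :: "nat \<Rightarrow> nat \<Rightarrow> (nat \<Rightarrow> nat) \<Rightarrow> nat \<Rightarrow> nat \<Rightarrow> nat" where
  "growth_bound C N d 0 j = C"
| "growth_bound C N d (Suc n) j =
     d j * growth_bound C N d n j + C * (1 + (\<Sum>i\<in>{j<..N}. growth_bound C N d n i))"

text \<open>By descending induction on j: the later sequences are O(\<rho>^n), and a recursion with
  factor d_j < \<rho> and inhomogeneity O(\<rho>^n) stays O(\<rho>^n). Strictness of d_i < \<rho>
  swallows the polynomial factors that equal degrees produce.\<close>

lemma growth_bound_single:
  fixes \<rho> :: real
  assumes "\<rho> > 1" "\<And>i. i \<in> {j..N} \<Longrightarrow> real (d i) < \<rho>" "j \<le> N"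
  shows "\<exists>A\<ge>0. \<forall>n. real (growth_bound C N d n j) \<le> A * \<rho> ^ n"
  using assms(2,3)
proof (induction "N - j" arbitrary: j rule: less_induct)
  case less
  have "\<exists>A\<ge>0. \<forall>n. real (growth_bound C N d n i) \<le> A * \<rho> ^ n" if "i \<in> {j<..N}" for i
    using less(1)[of i] less(2) that by auto
  then have "\<forall>i. \<exists>A. i \<in> {j<..N} \<longrightarrow> A \<ge> 0 \<and> (\<forall>n. real (growth_bound C N d n i) \<le> A * \<rho> ^ n)" by blast
  from choice[OF this] obtain A where
    A: "\<And>i. i \<in> {j<..N} \<Longrightarrow> A i \<ge> 0" "\<And>i n. i \<in> {j<..N} \<Longrightarrow> real (growth_bound C N d n i) \<le> A i * \<rho> ^ n"
    by blast
  define S where "S = (\<Sum>i\<in>{j<..N}. A i)"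
  have S0: "S \<ge> 0" unfolding S_def using A(1) by (intro sum_nonneg) auto
  have dj: "real (d j) < \<rho>" using less(2)[of j] less(3) by simp
  \<comment> \<open>The least B that covers n = 0 and satisfies d_j B + C (1 + S) \<le> \<rho>
    B.\<close>
  define B where "B = max (real C) (real C * (1 + S) / (\<rho> - d j))"
  have B0: "B \<ge> 0" by (simp add: B_def)
  have B1: "real C * (1 + S) \<le> B * (\<rho> - d j)"
  proof -
    have "real C * (1 + S) / (\<rho> - d j) \<le> B" by (simp add: B_def)
    then show ?thesis using dj by (simp add: pos_divide_le_eq)
  qed
  have "real (growth_bound C N d n j) \<le> B * \<rho> ^ n" for n
  proof (induction n)
    case (Suc n)
    have r1: "1 \<le> \<rho> ^ n" using assms(1) by simp
    have "(\<Sum>i\<in>{j<..N}. real (growth_bound C N d n i)) \<le> (\<Sum>i\<in>{j<..N}. A i * \<rho> ^ n)"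
      by (intro sum_mono A(2))
    also have "\<dots> = S * \<rho> ^ n" by (simp add: S_def sum_distrib_right)
    finally have s: "1 + (\<Sum>i\<in>{j<..N}. real (growth_bound C N d n i)) \<le> (1 + S) * \<rho> ^ n"
      using r1 by (simp add: distrib_right)
    have "real (growth_bound C N d (Suc n) j)
        = real (d j) * real (growth_bound C N d n j) + real C * (1 + (\<Sum>i\<in>{j<..N}. real (growth_bound C N d n i)))"
      by (simp add: distrib_left)
    also have "\<dots> \<le> real (d j) * (B * \<rho> ^ n) + real C * ((1 + S) * \<rho> ^ n)"
      by (intro add_mono mult_left_mono Suc s) auto
    also have "\<dots> = (real (d j) * B + real C * (1 + S)) * \<rho> ^ n" by (simp add: algebra_simps)
    also have "\<dots> \<le> (B * \<rho>) * \<rho> ^ n"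
      using B1 r1 by (intro mult_right_mono) (auto simp: algebra_simps)
    finally show ?case by (simp add: mult.assoc)
  qed (simp add: B_def)
  with B0 show ?case by blast
qed

lemma growth_bound_sum:
  fixes \<rho> :: real
  assumes "\<rho> > 1" "\<And>i. i \<in> {j..N} \<Longrightarrow> real (d i) < \<rho>"
  shows "\<exists>A\<ge>0. \<forall>n. (\<Sum>i\<in>{j..N}. real (growth_bound C N d n i)) \<le> A * \<rho> ^ n"
proof -
  have "\<exists>A\<ge>0. \<forall>n. real (growth_bound C N d n i) \<le> A * \<rho> ^ n" if "i \<in> {j..N}" for i
    by (rule growth_bound_single[OF assms(1)]) (use assms(2) that in auto)
  then have "\<forall>i. \<exists>A. i \<in> {j..N} \<longrightarrow> A \<ge> 0 \<and> (\<forall>n. real (growth_bound C N d n i) \<le> A * \<rho> ^ n)" by blast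
  from choice[OF this] obtain A where
    A: "\<And>i. i \<in> {j..N} \<Longrightarrow> A i \<ge> 0" "\<And>i n. i \<in> {j..N} \<Longrightarrow> real (growth_bound C N d n i) \<le> A i * \<rho> ^ n"
    by blast
  show ?thesis
  proof (intro exI[of _ "\<Sum>i\<in>{j..N}. A i"] conjI allI)
    show "0 \<le> (\<Sum>i\<in>{j..N}. A i)" using A(1) by (intro sum_nonneg) auto
    fix n
    show "(\<Sum>i\<in>{j..N}. real (growth_bound C N d n i)) \<le> (\<Sum>i\<in>{j..N}. A i) * \<rho> ^ n"
      unfolding sum_distrib_right by (intro sum_mono A(2))
  qed
qed

lemma lookup_le_tdeg: "lookup m l \<le> tdeg m"
proof (cases "l \<in> keys m")
  case True
  then show ?thesis unfolding tdeg_def by (intro member_le_sum) auto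
qed (simp add: in_keys_iff)

text \<open>The exponent of x_i in f_i enters exactly, through d_i; the exponents of later
  variables, the coefficients and the number of monomials are absorbed in C, which therefore
  multiplies only 1 and the bounds of later coordinates.\<close>

lemma triangular_filtered:
  fixes B :: "nat \<Rightarrow> 'b::comm_semiring_1 \<Rightarrow> bool"
  assumes mono: "\<And>M M' x. B M x \<Longrightarrow> M \<le> M' \<Longrightarrow> B M' x"
    and mult: "\<And>M M' x y. B M x \<Longrightarrow> B M' y \<Longrightarrow> B (M + M') (x * y)"
    and add: "\<And>M x y. B M x \<Longrightarrow> B M y \<Longrightarrow> B (M + 1) (x + y)"
    and zero: "B 0 0"
    and coeffs: "\<And>i m. i \<in> {1..N} \<Longrightarrow> m \<in> keys (f i) \<Longrightarrow> B C0 (\<phi> (lookup (f i) m))"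
    and vars: "\<And>i. i \<in> {1..N} \<Longrightarrow> mp_vars (f i) \<subseteq> {i..N}"
    and start: "\<And>i. i \<in> {1..N} \<Longrightarrow> B C0 (X 0 i)"
    and step: "\<And>n i. i \<in> {1..N} \<Longrightarrow> X (Suc n) i = mp_insertion \<phi> (X n) (f i)"
  shows "\<exists>C. \<forall>n. \<forall>i\<in>{1..N}. B (growth_bound C N (\<lambda>i. mp_degree_in i (f i)) n i) (X n i)"
proof -
  define C where "C = C0 + (\<Sum>i\<in>{1..N}. card (keys (f i)) + (\<Sum>m\<in>keys (f i). tdeg m))"
  let ?d = "\<lambda>i. mp_degree_in i (f i)"
  let ?E = "growth_bound C N ?d"
  have C1: "C0 + card (keys (f i)) \<le> C" and C2: "m \<in> keys (f i) \<Longrightarrow> lookup m l \<le> C"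
    if i: "i \<in> {1..N}" for i m l
  proof -
    have "card (keys (f i)) + (\<Sum>m\<in>keys (f i). tdeg m) \<le> (\<Sum>i\<in>{1..N}. card (keys (f i)) + (\<Sum>m\<in>keys (f i). tdeg m))"
      by (rule member_le_sum[of i "{1..N}" "\<lambda>i. card (keys (f i)) + (\<Sum>m\<in>keys (f i). tdeg m)"]) (use i in auto)
    then have *: "C0 + (card (keys (f i)) + (\<Sum>m\<in>keys (f i). tdeg m)) \<le> C" by (simp add: C_def)
    then show "C0 + card (keys (f i)) \<le> C" by simp
    assume m: "m \<in> keys (f i)"
    have "tdeg m \<le> (\<Sum>m\<in>keys (f i). tdeg m)" by (rule member_le_sum[OF m]) auto
    with * lookup_le_tdeg[of m l] show "lookup m l \<le> C" by linarith
  qed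
  have "\<forall>i\<in>{1..N}. B (?E n i) (X n i)" for n
  proof (induction n)
    case 0
    have "C0 \<le> C" by (simp add: C_def)
    then have "B C (X 0 i)" if "i \<in> {1..N}" for i using mono[OF start[OF that]] by blast
    then show ?case by simp
  next
    case (Suc n)
    show ?case
    proof
      fix i assume i: "i \<in> {1..N}"
      define s where "s = ?E n"
      define T where "T = ?d i * s i + C * (\<Sum>l\<in>{i<..N}. s l) + C0"
      have vi: "mp_vars (f i) \<subseteq> {i..N}" using vars[OF i] .
      have "B (T + card (keys (f i))) (mp_insertion \<phi> (X n) (f i))"
      proof (rule mp_insertion_filtered[where B = B and s = s and C = C0])
        fix m assume m: "m \<in> keys (f i)"
        have km: "keys m \<subseteq> {i..N}" using vi m by (auto simp: mp_vars_def)
        have "(\<Sum>l\<in>keys m. lookup m l * s l) \<le> (\<Sum>l\<in>{i..N}. lookup m l * s l)"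
          using km by (intro sum_mono2) auto
        also have "{i..N} = insert i {i<..N}" using i by auto
        also have "(\<Sum>l\<in>insert i {i<..N}. lookup m l * s l) = lookup m i * s i + (\<Sum>l\<in>{i<..N}. lookup m l * s l)"
          by simp
        also have "\<dots> \<le> ?d i * s i + (\<Sum>l\<in>{i<..N}. C * s l)"
          using mp_degree_in_ge[OF m] C2[OF i m] by (intro add_mono mult_right_mono sum_mono) auto
        finally show "C0 + (\<Sum>l\<in>keys m. lookup m l * s l) \<le> T" by (simp add: T_def sum_distrib_left)
        show "B C0 (\<phi> (lookup (f i) m))" using coeffs[OF i m] .
      next
        fix l assume "l \<in> mp_vars (f i)"
        then have "l \<in> {1..N}" using vi i by auto
        with Suc show "B (s l) (X n l)" by (simp add: s_def)
      qed (use mono mult add zero in auto)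
      then have "B (T + card (keys (f i))) (X (Suc n) i)" using step[OF i] by simp
      moreover have "T + card (keys (f i)) \<le> ?E (Suc n) i" using C1[OF i] by (simp add: T_def s_def)
      ultimately show "B (?E (Suc n) i) (X (Suc n) i)" by (rule mono)
    qed
  qed
  then show ?thesis by blast
qed

lemma dominated_poly_lower:
  fixes b :: "nat \<Rightarrow> complex" and y :: complex
  assumes "e \<ge> 1" "cmod (b e) \<ge> \<epsilon>" "\<And>t. t < e \<Longrightarrow> cmod (b t) \<le> B" "cmod y \<ge> 1"
  shows "cmod (\<Sum>t\<le>e. b t * y ^ t) \<ge> cmod y ^ (e - 1) * (\<epsilon> * cmod y - real e * B)"
proof -
  have split: "(\<Sum>t\<le>e. b t * y ^ t) = (\<Sum>t<e. b t * y ^ t) + b e * y ^ e"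
    by (simp flip: lessThan_Suc_atMost)
  have "cmod (\<Sum>t<e. b t * y ^ t) \<le> (\<Sum>t<e. B * cmod y ^ (e - 1))"
  proof (rule sum_norm_le)
    fix t assume t: "t \<in> {..<e}"
    have "B \<ge> 0" using assms(3)[of t] t by (metis lessThan_iff norm_ge_zero order_trans)
    then show "cmod (b t * y ^ t) \<le> B * cmod y ^ (e - 1)"
      unfolding norm_mult norm_power using t assms by (intro mult_mono power_increasing) auto
  qed
  then have 1: "cmod (\<Sum>t<e. b t * y ^ t) \<le> cmod y ^ (e - 1) * (real e * B)" by (simp add: ac_simps)
  have "cmod y ^ (e - 1) * (\<epsilon> * cmod y) = \<epsilon> * cmod y ^ e"
    using assms(1) by (cases e) (auto simp: ac_simps)
  also have "\<dots> \<le> cmod (b e * y ^ e)"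
    unfolding norm_mult norm_power using assms(2) by (intro mult_right_mono) auto
  also have "\<dots> \<le> cmod (\<Sum>t\<le>e. b t * y ^ t) + cmod (\<Sum>t<e. b t * y ^ t)"
    unfolding split by (metis add_diff_cancel_left' norm_triangle_ineq4)
  finally show ?thesis using 1 by (simp add: right_diff_distrib)
qed

text \<open>The leading coefficient may decay like exp (- C \<rho>^n), but as \<rho> < d the
  accumulated loss is only a constant multiple of d^n in the exponent. The threshold \<kappa> is
  independent of the orbit, so that the growth can be compared for varying starting values; this
  later allows degrees to be read off.\<close>

lemma escape_growth:
  fixes b :: "nat \<Rightarrow> nat \<Rightarrow> complex" and \<rho> C :: real
  assumes d: "d \<ge> 2" and \<rho>: "1 \<le> \<rho>" "\<rho> < real d" and C: "C \<ge> 0"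
    and lead: "\<And>n. cmod (b n d) \<ge> exp (- C * \<rho> ^ n)" and low: "\<And>n t. t < d \<Longrightarrow> cmod (b n t) \<le> exp (C * \<rho> ^ n)"
  shows "\<exists>\<kappa>\<ge>0. \<forall>y. (\<forall>n. y (Suc n) = (\<Sum>t\<le>d. b n t * y n ^ t)) \<longrightarrow> y 0 \<noteq> 0 \<longrightarrow> ln (cmod (y 0)) \<ge> \<kappa> \<longrightarrow>
     (\<forall>n. cmod (y n) \<ge> exp ((ln (cmod (y 0)) - \<kappa>) * real d ^ n))"
proof -
  \<comment> \<open>The first entry pays in each step for the factor exp (- C \<rho>^n) / 2, the
    second makes the leading term at least twice the bound for the lower ones.\<close>
  define \<kappa> where "\<kappa> = max ((C + ln 2) / (real d - \<rho>)) (2 * C + ln (2 * real d))"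
  have k1: "\<kappa> * (real d - \<rho>) \<ge> C + ln 2"
  proof -
    have "(C + ln 2) / (real d - \<rho>) \<le> \<kappa>" by (simp add: \<kappa>_def)
    then show ?thesis using \<rho> by (simp add: pos_divide_le_eq)
  qed
  have k2: "\<kappa> \<ge> 2 * C + ln (2 * real d)" by (simp add: \<kappa>_def)
  have ld: "ln (2 * real d) \<ge> 0" using d by simp
  have k0: "\<kappa> \<ge> 0" using k2 C ld by linarith
  have "cmod (y n) \<ge> exp ((ln (cmod (y 0)) - \<kappa>) * real d ^ n)"
    if rec: "\<And>n. y (Suc n) = (\<Sum>t\<le>d. b n t * y n ^ t)" and y0: "y 0 \<noteq> 0" "ln (cmod (y 0)) \<ge> \<kappa>" for y n
  proof -
    define \<mu> where "\<mu> = ln (cmod (y 0)) - \<kappa>"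
    have \<mu>: "\<mu> \<ge> 0" using y0 by (simp add: \<mu>_def)
    \<comment> \<open>The surplus \<kappa> \<rho>^n is the reserve from which the losses are paid;
      the bare bound exp (\<mu> d^n) would not reproduce itself.\<close>
    have main: "cmod (y n) \<ge> exp (\<mu> * real d ^ n + \<kappa> * \<rho> ^ n)" for n
    proof (induction n)
      case 0
      show ?case using y0 by (simp add: \<mu>_def)
    next
      case (Suc n)
      have r1: "1 \<le> \<rho> ^ n" using \<rho> by simp
      let ?Y = "cmod (y n)"
      have "2 * C * \<rho> ^ n + ln (2 * real d) \<le> (2 * C + ln (2 * real d)) * \<rho> ^ n"
        using r1 ld mult_left_mono[OF r1 ld] by (simp add: distrib_right)
      also have "\<dots> \<le> \<kappa> * \<rho> ^ n" using k2 r1 by (intro mult_right_mono) auto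
      also have "\<dots> \<le> \<mu> * real d ^ n + \<kappa> * \<rho> ^ n" using \<mu> by simp
      finally have "exp (2 * C * \<rho> ^ n + ln (2 * real d)) \<le> exp (\<mu> * real d ^ n + \<kappa> * \<rho> ^ n)" by simp
      with Suc have Y1: "exp (2 * C * \<rho> ^ n + ln (2 * real d)) \<le> ?Y" by linarith
      have "exp 0 \<le> exp (2 * C * \<rho> ^ n + ln (2 * real d))" using C r1 ld by (intro exp_le_cancel_iff[THEN iffD2] add_nonneg_nonneg mult_nonneg_nonneg) auto
      with Y1 have Yge1: "1 \<le> ?Y" unfolding exp_zero by linarith
      have Y2: "2 * real d * exp (2 * C * \<rho> ^ n) \<le> ?Y"
        using Y1 d by (simp add: exp_add mult.commute)
      have "real d * exp (C * \<rho> ^ n) \<le> exp (- C * \<rho> ^ n) * ?Y / 2"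
      proof -
        have "exp (- C * \<rho> ^ n) * (2 * real d * exp (2 * C * \<rho> ^ n)) \<le> exp (- C * \<rho> ^ n) * ?Y"
          using Y2 by (intro mult_left_mono) auto
        moreover have "exp (- C * \<rho> ^ n) * (2 * real d * exp (2 * C * \<rho> ^ n)) = 2 * (real d * exp (C * \<rho> ^ n))"
          by (simp add: mult_exp_exp ac_simps)
        ultimately show ?thesis by linarith
      qed
      then have "exp (- C * \<rho> ^ n) * ?Y / 2 \<le> exp (- C * \<rho> ^ n) * ?Y - real d * exp (C * \<rho> ^ n)"
        by linarith
      then have "?Y ^ (d - 1) * (exp (- C * \<rho> ^ n) * ?Y / 2) \<le> ?Y ^ (d - 1) * (exp (- C * \<rho> ^ n) * ?Y - real d * exp (C * \<rho> ^ n))"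
        by (rule mult_left_mono) simp
      moreover have "cmod (y (Suc n)) \<ge> ?Y ^ (d - 1) * (exp (- C * \<rho> ^ n) * ?Y - real d * exp (C * \<rho> ^ n))"
        unfolding rec by (rule dominated_poly_lower) (use d lead low Yge1 in auto)
      moreover have "?Y ^ (d - 1) * (exp (- C * \<rho> ^ n) * ?Y / 2) = exp (- C * \<rho> ^ n - ln 2) * ?Y ^ d"
        using d by (cases d) (auto simp: exp_diff ac_simps)
      ultimately have "exp (- C * \<rho> ^ n - ln 2) * ?Y ^ d \<le> cmod (y (Suc n))" by linarith
      moreover have "exp (\<mu> * real d ^ n + \<kappa> * \<rho> ^ n) ^ d \<le> ?Y ^ d" using Suc by (intro power_mono) auto
      then have "exp (- C * \<rho> ^ n - ln 2) * exp (\<mu> * real d ^ n + \<kappa> * \<rho> ^ n) ^ d \<le> exp (- C * \<rho> ^ n - ln 2) * ?Y ^ d"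
        by (intro mult_left_mono) auto
      moreover have "exp (- C * \<rho> ^ n - ln 2) * exp (\<mu> * real d ^ n + \<kappa> * \<rho> ^ n) ^ d
          = exp (- C * \<rho> ^ n - ln 2 + real d * (\<mu> * real d ^ n + \<kappa> * \<rho> ^ n))"
        by (simp only: exp_of_nat_mult[symmetric] mult_exp_exp)
      moreover have "\<mu> * real d ^ Suc n + \<kappa> * \<rho> ^ Suc n \<le> - C * \<rho> ^ n - ln 2 + real d * (\<mu> * real d ^ n + \<kappa> * \<rho> ^ n)"
      proof -
        have "(C + ln 2) * \<rho> ^ n \<le> \<kappa> * (real d - \<rho>) * \<rho> ^ n" using k1 r1 by (intro mult_right_mono) auto
        moreover have "ln 2 * 1 \<le> ln 2 * \<rho> ^ n" using r1 by (intro mult_left_mono) auto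
        moreover have "(C + ln 2) * \<rho> ^ n = C * \<rho> ^ n + ln 2 * \<rho> ^ n"
          "\<kappa> * (real d - \<rho>) * \<rho> ^ n = \<kappa> * (real d * \<rho> ^ n) - \<kappa> * \<rho> ^ Suc n"
          "real d * (\<mu> * real d ^ n + \<kappa> * \<rho> ^ n) = \<mu> * real d ^ Suc n + \<kappa> * (real d * \<rho> ^ n)"
          by (simp_all add: algebra_simps)
        ultimately show ?thesis by linarith
      qed
      then have "exp (\<mu> * real d ^ Suc n + \<kappa> * \<rho> ^ Suc n) \<le> exp (- C * \<rho> ^ n - ln 2 + real d * (\<mu> * real d ^ n + \<kappa> * \<rho> ^ n))"
        by (simp only: exp_le_cancel_iff)
      ultimately show ?case by linarith
    qed
    have "\<mu> * real d ^ n \<le> \<mu> * real d ^ n + \<kappa> * \<rho> ^ n" using k0 \<rho> by simp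
    then have "exp (\<mu> * real d ^ n) \<le> exp (\<mu> * real d ^ n + \<kappa> * \<rho> ^ n)" by (simp only: exp_le_cancel_iff)
    with main[of n] show ?thesis unfolding \<mu>_def by linarith
  qed
  with k0 show ?thesis by blast
qed

text \<open>Roots of constants tend to 1, and an upper limit that is at most every \<rho> > \<delta>
  is at most \<delta>; this is why growth bounds slightly above the maximal degree suffice.\<close>

lemma nth_root_squeeze:
  fixes u :: "nat \<Rightarrow> real" and \<delta> c :: real
  assumes "\<delta> \<ge> 1" "c > 0" "\<And>n. u n \<ge> c * \<delta> ^ n" "\<And>\<rho>. \<rho> > \<delta> \<Longrightarrow> \<exists>C. \<forall>n. u n \<le> C * \<rho> ^ n"
  shows "(\<lambda>n. u n powr (1 / real n)) \<longlonglongrightarrow> \<delta>"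
proof -
  have root: "(\<lambda>n. b powr (1 / real n)) \<longlonglongrightarrow> 1" if "b > 0" for b :: real
  proof -
    have "(\<lambda>n. b powr (1 / real n)) \<longlonglongrightarrow> b powr 0"
      using that by (intro tendsto_powr lim_1_over_n tendsto_const) auto
    then show ?thesis using that by simp
  qed
  have pow: "(b * r ^ n) powr (1 / real n) = b powr (1 / real n) * r" if "b > 0" "r > 0" "n > 0" for b r :: real and n
  proof -
    have "(b * r ^ n) powr (1 / real n) = b powr (1 / real n) * (r ^ n) powr (1 / real n)"
      using that by (simp add: powr_mult)
    also have "(r ^ n) powr (1 / real n) = r"
      using that by (simp add: powr_realpow[symmetric] powr_powr)
    finally show ?thesis .
  qed
  have u_pos: "u n > 0" for n
  proof -
    have "0 < c * \<delta> ^ n" using assms(1,2) by simp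
    with assms(3)[of n] show ?thesis by linarith
  qed
  show ?thesis
  proof (rule order_tendstoI)
    fix a assume a: "a < \<delta>"
    have "(\<lambda>n. c powr (1 / real n) * \<delta>) \<longlonglongrightarrow> 1 * \<delta>" by (intro tendsto_mult root tendsto_const assms(2))
    then have "\<forall>\<^sub>F n in sequentially. a < c powr (1 / real n) * \<delta>" using a by (simp add: order_tendsto_iff)
    then show "\<forall>\<^sub>F n in sequentially. a < u n powr (1 / real n)"
      using eventually_gt_at_top[of 0]
    proof eventually_elim
      case (elim n)
      have "(c * \<delta> ^ n) powr (1 / real n) \<le> u n powr (1 / real n)"
        using assms(1,2,3) by (intro powr_mono2) auto
      then show ?case using elim pow[of c \<delta> n] assms(1,2) by simp
    qed
  next
    fix a assume a: "\<delta> < a"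
    define \<rho> where "\<rho> = (\<delta> + a) / 2"
    have \<rho>: "\<rho> > \<delta>" "\<rho> < a" using a by (auto simp: \<rho>_def)
    obtain C where C: "\<And>n. u n \<le> C * \<rho> ^ n" using assms(4)[OF \<rho>(1)] by blast
    have C0: "C > 0" using C[of 0] u_pos[of 0] by simp
    have "(\<lambda>n. C powr (1 / real n) * \<rho>) \<longlonglongrightarrow> 1 * \<rho>" by (intro tendsto_mult root tendsto_const C0)
    then have "\<forall>\<^sub>F n in sequentially. C powr (1 / real n) * \<rho> < a" using \<rho> by (simp add: order_tendsto_iff)
    then show "\<forall>\<^sub>F n in sequentially. u n powr (1 / real n) < a"
      using eventually_gt_at_top[of 0]
    proof eventually_elim
      case (elim n)
      have "u n powr (1 / real n) \<le> (C * \<rho> ^ n) powr (1 / real n)"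
        using C u_pos[of n] by (intro powr_mono2) auto
      then show ?case using elim pow[of C \<rho> n] C0 \<rho> assms(1) by simp
    qed
  qed
qed

section \<open>Orbits of triangular maps\<close>

lemma mp_over_subset: "mp_over k p \<Longrightarrow> k \<subseteq> L \<Longrightarrow> mp_over L p"
  by (auto simp: mp_over_def)

lemma mp_eval_mem:
  assumes "complex_subfield_loc L" "mp_over L p" "\<And>i. i \<in> mp_vars p \<Longrightarrow> x i \<in> L"
  shows "mp_eval p x \<in> L"
proof -
  interpret complex_subfield_loc L by (rule assms(1))
  show ?thesis
    unfolding mp_eval_def
    by (rule mp_insertion_closed)
      (use assms(2,3) in \<open>auto simp: mp_over_def add_mem mult_mem zero_mem one_mem\<close>)
qed

lemma mp_over_mult:
  assumes "complex_subfield_loc L" "mp_over L p" "mp_over L q"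
  shows "mp_over L (p * q)"
  unfolding mp_over_def
proof
  interpret complex_subfield_loc L by (rule assms(1))
  fix m
  have "lookup (p * q) m = (\<Sum>a\<in>keys p. \<Sum>b\<in>keys q. lookup (Poly_Mapping.single (a + b) (lookup p a * lookup q b)) m)"
    by (subst mp_times_singles) (simp add: lookup_sum)
  also have "\<dots> \<in> L"
  proof -
    have "sum F A \<in> L" if "\<And>a. a \<in> A \<Longrightarrow> F a \<in> L" for F :: "(nat \<Rightarrow>\<^sub>0 nat) \<Rightarrow> complex" and A
      using that by (induction A rule: infinite_finite_induct) (auto simp: zero_mem add_mem)
    moreover have "lookup (Poly_Mapping.single (a + b) (lookup p a * lookup q b)) m \<in> L" for a b
      using assms(2,3) by (auto simp: lookup_single when_def mp_over_def mult_mem zero_mem)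
    ultimately show ?thesis by simp
  qed
  finally show "lookup (p * q) m \<in> L" .
qed

lemma mp_over_add: "complex_subfield_loc L \<Longrightarrow> mp_over L p \<Longrightarrow> mp_over L q \<Longrightarrow> mp_over L (p + q)"
  by (simp add: mp_over_def lookup_add complex_subfield_loc.add_mem)

lemma int_rel_mult_bound:
  assumes "int_rel m Q z" "m \<ge> 1" "Q \<ge> 1"
  shows "cmod z \<le> real m * real Q"
proof -
  have "1 * 1 \<le> real m * real Q" using assms(2,3) by (intro mult_mono) auto
  then show ?thesis using int_rel_bound[OF assms(1)] by simp
qed

locale triangular_map =
  fixes k :: "complex set" and N :: nat and f :: "nat \<Rightarrow> mpoly"
  assumes nf: "number_field k" and N1: "N \<ge> 1"
    and over: "\<And>i. i \<in> {1..N} \<Longrightarrow> mp_over k (f i)"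
    and vars: "\<And>i. i \<in> {1..N} \<Longrightarrow> mp_vars (f i) \<subseteq> {i..N}"
begin

abbreviation K where "K \<equiv> alg_closure_of k"

abbreviation d where "d \<equiv> \<lambda>i. mp_degree_in i (f i)"

definition step :: "(nat \<Rightarrow> complex) \<Rightarrow> nat \<Rightarrow> complex" where
  "step x = (\<lambda>i. if i \<in> {1..N} then mp_eval (f i) x else 0)"

definition orb :: "nat \<Rightarrow> (nat \<Rightarrow> complex) \<Rightarrow> nat \<Rightarrow> complex" where
  "orb n x = (step ^^ n) x"

lemma orb_0 [simp]: "orb 0 x = x"
  by (simp add: orb_def)

lemma orb_Suc: "orb (Suc n) x = step (orb n x)"
  by (simp add: orb_def)

lemma orb_Suc_coord: "i \<in> {1..N} \<Longrightarrow> orb (Suc n) x i = mp_eval (f i) (orb n x)"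
  by (simp add: orb_Suc step_def)

lemma k_subfield: "complex_subfield k"
  using nf by (simp add: number_field_def)

lemma k_loc: "complex_subfield_loc k"
  by (rule complex_subfield_locI[OF k_subfield])

lemma K_loc: "complex_subfield_loc K"
  by (rule complex_subfield_locI[OF alg_closure_subfield[OF nf]])

lemma number_field_subset_K: "number_field L \<Longrightarrow> L \<subseteq> K"
  by (rule number_field_subset_alg_closure[OF _ k_subfield])

lemma enlarge:
  assumes "number_field L" "k \<subseteq> L" "finite X" "X \<subseteq> K"
  obtains L' where "number_field L'" "L \<subseteq> L'" "k \<subseteq> L'" "X \<subseteq> L'"
  using number_field_adjoin_finite[OF assms] assms(2) that by auto

lemma orb_mem:
  assumes L: "complex_subfield_loc L" "k \<subseteq> L" and x: "x ` {1..N} \<subseteq> L"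
  shows "i \<in> {1..N} \<Longrightarrow> orb n x i \<in> L"
proof (induction n arbitrary: i)
  case (Suc n)
  have "mp_eval (f i) (orb n x) \<in> L"
  proof (rule mp_eval_mem[OF L(1) mp_over_subset[OF over[OF Suc.prems] L(2)]])
    fix l assume "l \<in> mp_vars (f i)"
    then have "l \<in> {1..N}" using vars[OF Suc.prems] Suc.prems by auto
    then show "orb n x l \<in> L" by (rule Suc.IH)
  qed
  then show ?case using orb_Suc_coord[OF Suc.prems] by simp
qed (use x in auto)

lemma orb_affine:
  assumes L: "complex_subfield_loc L" "k \<subseteq> L" and x: "x \<in> affine_space N L"
  shows "orb n x \<in> affine_space N L"
proof -
  have "orb n x i = 0" if "i \<notin> {1..N}" for i
    using that x by (cases n) (auto simp: affine_space_def orb_Suc step_def)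
  moreover have "orb n x i \<in> L" if "i \<in> {1..N}" for i
    using orb_mem[OF L _ that] x by (force simp: affine_space_def)
  ultimately show ?thesis by (simp add: affine_space_def)
qed

text \<open>As f_i involves only x_i, ..., x_N, earlier coordinates can be altered afterwards
  without disturbing what has been arranged for later ones.\<close>

lemma orb_tail:
  assumes "\<And>i. i \<in> {j..N} \<Longrightarrow> x i = x' i" "j \<ge> 1"
  shows "i \<in> {j..N} \<Longrightarrow> orb n x i = orb n x' i"
proof (induction n arbitrary: i)
  case (Suc n)
  have i: "i \<in> {1..N}" using Suc.prems assms(2) by auto
  have "mp_eval (f i) (orb n x) = mp_eval (f i) (orb n x')"
  proof (rule mp_eval_cong)
    fix l assume "l \<in> mp_vars (f i)"
    then have "l \<in> {j..N}" using vars[OF i] Suc.prems by auto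
    then show "orb n x l = orb n x' l" by (rule Suc.IH)
  qed
  then show ?case using orb_Suc_coord[OF i] by simp
qed (simp add: assms(1))

lemma finite_coords:
  assumes "x \<in> affine_space N K"
  shows "finite (x ` {1..N})" "x ` {1..N} \<subseteq> K"
  using assms by (auto simp: affine_space_def)

text \<open>The finite set Y, in practice the coefficients of a polynomial to be evaluated along the
  orbit, shares the lattice and the denominator with the orbit.\<close>

lemma orbit_size:
  assumes L: "number_field L" "k \<subseteq> L" and x: "x ` {1..N} \<subseteq> L" and Y: "finite Y" "Y \<subseteq> L"
  shows "\<exists>n \<beta> \<gamma> c0 D A C. integral_family n \<beta> \<gamma> c0 \<and> spans n \<beta> L \<and> D > 0 \<and> 2 * D \<le> A \<and>
    (\<forall>y\<in>Y. size_le n \<beta> c0 D A 1 y) \<and>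
    (\<forall>m. \<forall>i\<in>{1..N}. size_le n \<beta> c0 D A (growth_bound C N d m i) (orb m x i))"
proof -
  interpret L: complex_subfield_loc L by (rule number_field_locI[OF L(1)])
  obtain n \<beta> \<gamma> c0 where F: "integral_family n \<beta> \<gamma> c0" "spans n \<beta> L"
    using number_field_integral_family[OF L(1)] by metis
  interpret integral_family n \<beta> \<gamma> c0 by (rule F(1))
  define Z where "Z = Y \<union> x ` {1..N} \<union> (\<Union>i\<in>{1..N}. lookup (f i) ` keys (f i))"
  have Zf: "finite Z" using Y(1) by (simp add: Z_def)
  have ZL: "Z \<subseteq> L" using Y(2) x over L(2) by (auto simp: Z_def mp_over_def)
  from spans_common_denominator[OF F(2) Zf ZL] obtain E :: nat and a :: "complex \<Rightarrow> nat \<Rightarrow> int" and W :: nat where E: "E > 0" "W > 0"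
    "\<forall>x\<in>Z. of_nat E * x = (\<Sum>i<n. of_int (a x i) * \<beta> i)" "\<forall>x\<in>Z. (\<Sum>i<n. \<bar>a x i\<bar>) \<le> int W"
    by (elim exE conjE)
  \<comment> \<open>The three summands serve the addition rule, the bound with c0 and the bound
    without it.\<close>
  define A where "A = 2 * E + c0 * W + W"
  have EA: "2 * E \<le> A" "E \<le> A" by (auto simp: A_def)
  have sz: "size_le n \<beta> c0 E A 1 z" if z: "z \<in> Z" for z
    unfolding size_le_def
  proof (intro exI[of _ "a z"] conjI)
    show "of_nat (E ^ 1) * z = (\<Sum>i<n. of_int (a z i) * \<beta> i)" using E(3) z by simp
    have s: "(\<Sum>i<n. \<bar>a z i\<bar>) \<le> int W" using E(4) z by blast
    then have "int c0 * (\<Sum>i<n. \<bar>a z i\<bar>) \<le> int c0 * int W" by (intro mult_left_mono) auto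
    then show "int c0 * (\<Sum>i<n. \<bar>a z i\<bar>) \<le> int (A ^ 1)" by (simp add: A_def)
    have "int W \<le> int (A ^ 1)" unfolding of_nat_le_iff by (simp add: A_def)
    with s show "(\<Sum>i<n. \<bar>a z i\<bar>) \<le> int (A ^ 1)" by linarith
  qed
  have "\<exists>C. \<forall>m. \<forall>i\<in>{1..N}. size_le n \<beta> c0 E A (growth_bound C N d m i) (orb m x i)"
  proof (rule triangular_filtered[where \<phi> = "\<lambda>c. c" and ?C0.0 = 1])
    show "size_le n \<beta> c0 E A 1 (lookup (f i) m)" if "i \<in> {1..N}" "m \<in> keys (f i)" for i m
      by (rule sz) (use that in \<open>auto simp: Z_def\<close>)
    show "size_le n \<beta> c0 E A 1 (orb 0 x i)" if "i \<in> {1..N}" for i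
      using sz[of "x i"] that by (auto simp: Z_def)
    show "orb (Suc m) x i = mp_insertion (\<lambda>c. c) (orb m x) (f i)" if "i \<in> {1..N}" for m i
      using orb_Suc_coord[OF that] by (simp add: mp_eval_def)
    show "mp_vars (f i) \<subseteq> {i..N}" if "i \<in> {1..N}" for i by (rule vars[OF that])
  qed (fact size_le_mono[OF _ _ EA(2)] size_le_mult size_le_add[OF _ _ EA(1)] size_le_zero)+
  then obtain C where C: "\<forall>m. \<forall>i\<in>{1..N}. size_le n \<beta> c0 E A (growth_bound C N d m i) (orb m x i)"
    by (elim exE)
  have szY: "\<forall>y\<in>Y. size_le n \<beta> c0 E A 1 y" using sz by (simp add: Z_def)
  show ?thesis
    by (rule exI[of _ n], rule exI[of _ \<beta>], rule exI[of _ \<gamma>], rule exI[of _ c0], rule exI[of _ E],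
        rule exI[of _ A], rule exI[of _ C]) (intro conjI F E(1) EA(1) szY C)
qed

text \<open>The value of q has size O(\<rho>^m) and thus satisfies an integer relation with
  coefficients exp (O(\<rho>^m)); reversed, the relation bounds the inverse. Only degrees from index
  j on enter, so \<rho> may lie below the degree of an earlier coordinate.\<close>

lemma orbit_value_bounds:
  fixes \<rho> :: real
  assumes L: "number_field L" "k \<subseteq> L" and x: "x ` {1..N} \<subseteq> L"
    and q: "mp_over L q" "mp_vars q \<subseteq> {j..N}" and j: "j \<ge> 1" and \<rho>: "\<rho> > 1" "\<And>i. i \<in> {j..N} \<Longrightarrow> real (d i) < \<rho>"
  shows "\<exists>C\<ge>0. \<forall>m. cmod (mp_eval q (orb m x)) \<le> exp (C * \<rho> ^ m) \<and>
    (mp_eval q (orb m x) \<noteq> 0 \<longrightarrow> exp (- C * \<rho> ^ m) \<le> cmod (mp_eval q (orb m x)))"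
proof -
  have Yq: "finite (lookup q ` keys q)" "lookup q ` keys q \<subseteq> L" using q(1) by (auto simp: mp_over_def)
  from orbit_size[OF L x Yq] obtain n \<beta> \<gamma> c0 D A C where F: "integral_family n \<beta> \<gamma> c0" "D > 0" "2 * D \<le> A"
    and c': "\<forall>y\<in>lookup q ` keys q. size_le n \<beta> c0 D A 1 y"
    and o': "\<forall>m. \<forall>i\<in>{1..N}. size_le n \<beta> c0 D A (growth_bound C N d m i) (orb m x i)"
    by (elim exE conjE)
  note c = c'[rule_format] and o = o'[rule_format]
  interpret integral_family n \<beta> \<gamma> c0 by (rule F(1))
  have DA: "D \<le> A" "A > 0" using F(2,3) by auto
  obtain A1 where A1: "A1 \<ge> 0" "\<And>m. (\<Sum>i\<in>{j..N}. real (growth_bound C N d m i)) \<le> A1 * \<rho> ^ m"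
    using growth_bound_sum[of \<rho> j N d C] \<rho> by blast
  define W where "W = (\<Sum>m\<in>keys q. tdeg m)"
  define Q0 where "Q0 = (2 * (n + 1)) ^ n * A ^ ((n + 1) * n) * D ^ (n + 1)"
  have Q0: "Q0 \<ge> 1" using F(2) DA(2) by (simp add: Q0_def Suc_le_eq)
  define C1 where "C1 = 2 + real W * A1 + real (card (keys q))"
  define C2 where "C2 = ln (real (n + 1)) + C1 * ln (real Q0)"
  have C1: "C1 \<ge> 0" using A1(1) by (simp add: C1_def)
  have C2: "C2 \<ge> 0" using C1 Q0 by (simp add: C2_def)
  \<comment> \<open>The value and its inverse are treated together, as both satisfy a relation with
    the same coefficient bound.\<close>
  have main: "cmod z \<le> exp (C2 * \<rho> ^ m)" if z: "z = mp_eval q (orb m x) \<or> z = inverse (mp_eval q (orb m x)) \<and> mp_eval q (orb m x) \<noteq> 0" for z m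
  proof -
    let ?s = "growth_bound C N d m"
    define M where "M = 1 + W * (\<Sum>i\<in>{j..N}. ?s i) + card (keys q)"
    have "size_le n \<beta> c0 D A M (mp_eval q (orb m x))"
      unfolding M_def mp_eval_def
    proof (rule mp_insertion_filtered[where C = 1 and s = ?s])
      fix e assume e: "e \<in> keys q"
      have ke: "keys e \<subseteq> {j..N}" using e q(2) by (auto simp: mp_vars_def)
      have tW: "tdeg e \<le> W" unfolding W_def by (rule member_le_sum[OF e]) auto
      have "(\<Sum>i\<in>keys e. lookup e i * ?s i) \<le> (\<Sum>i\<in>keys e. W * ?s i)"
      proof (rule sum_mono)
        fix i
        show "lookup e i * ?s i \<le> W * ?s i" using lookup_le_tdeg[of e i] tW by (intro mult_le_mono1) linarith
      qed
      also have "\<dots> \<le> (\<Sum>i\<in>{j..N}. W * ?s i)" using ke by (intro sum_mono2) auto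
      finally show "1 + (\<Sum>i\<in>keys e. lookup e i * ?s i) \<le> 1 + W * (\<Sum>i\<in>{j..N}. ?s i)"
        by (simp add: sum_distrib_left)
      show "size_le n \<beta> c0 D A 1 (lookup q e)" using c e by blast
    next
      fix i assume "i \<in> mp_vars q"
      then have "i \<in> {1..N}" using q(2) j by auto
      then show "size_le n \<beta> c0 D A (?s i) (orb m x i)" by (rule o)
    next
      show "size_le n \<beta> c0 D A 0 0" by (rule size_le_zero)
    qed (fact size_le_mono[OF _ _ DA(1)] size_le_mult size_le_add[OF _ _ F(3)])+
    from size_le_int_rel[OF this F(2) DA(2)] have rel: "int_rel (n + 1) (Q0 ^ (M + 1)) (mp_eval q (orb m x))"
      by (simp only: Q0_def)
    then have rz: "int_rel (n + 1) (Q0 ^ (M + 1)) z" using z int_rel_inverse by auto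
    have Q1: "Q0 ^ (M + 1) \<ge> 1" using Q0 by (rule one_le_power)
    have r1: "1 \<le> \<rho> ^ m" using \<rho>(1) by simp
    have "cmod z \<le> real (n + 1) * real (Q0 ^ (M + 1))" by (rule int_rel_mult_bound[OF rz _ Q1]) simp
    also have "\<dots> = exp (ln (real (n + 1)) + real (M + 1) * ln (real Q0))"
      using Q0 by (simp add: exp_add exp_of_nat_mult distrib_right)
    also have "\<dots> \<le> exp (C2 * \<rho> ^ m)"
    proof -
      have "real (M + 1) = 2 + real W * (\<Sum>i\<in>{j..N}. real (?s i)) + real (card (keys q))" by (simp add: M_def)
      also have "\<dots> \<le> 2 * \<rho> ^ m + real W * (A1 * \<rho> ^ m) + real (card (keys q)) * \<rho> ^ m"
        using r1 A1(2)[of m] mult_left_mono[OF r1, of "real (card (keys q))"]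
        by (intro add_mono mult_left_mono) auto
      also have "\<dots> = C1 * \<rho> ^ m" by (simp add: C1_def algebra_simps)
      finally have "real (M + 1) * ln (real Q0) \<le> C1 * \<rho> ^ m * ln (real Q0)" using Q0 by (intro mult_right_mono) auto
      moreover have "ln (real (n + 1)) * 1 \<le> ln (real (n + 1)) * \<rho> ^ m" using r1 by (intro mult_left_mono) auto
      moreover have "C2 * \<rho> ^ m = ln (real (n + 1)) * \<rho> ^ m + C1 * \<rho> ^ m * ln (real Q0)" by (simp add: C2_def algebra_simps)
      ultimately have "ln (real (n + 1)) + real (M + 1) * ln (real Q0) \<le> C2 * \<rho> ^ m" by linarith
      then show ?thesis by (simp only: exp_le_cancel_iff)
    qed
    finally show ?thesis .
  qed
  show ?thesis
  proof (intro exI[of _ C2] conjI allI impI C2)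
    fix m
    show "cmod (mp_eval q (orb m x)) \<le> exp (C2 * \<rho> ^ m)" by (rule main) simp
    assume nz: "mp_eval q (orb m x) \<noteq> 0"
    have "cmod (inverse (mp_eval q (orb m x))) \<le> exp (C2 * \<rho> ^ m)" by (rule main) (use nz in simp)
    then have "inverse (exp (C2 * \<rho> ^ m)) \<le> cmod (mp_eval q (orb m x))"
      using le_imp_inverse_le[of "cmod (inverse (mp_eval q (orb m x)))"] nz by (simp add: norm_inverse)
    then show "exp (- C2 * \<rho> ^ m) \<le> cmod (mp_eval q (orb m x))" by (simp add: exp_minus)
  qed
qed

lemma orbit_height_upper:
  fixes \<rho> :: real
  assumes L: "number_field L" "k \<subseteq> L" and x: "x ` {1..N} \<subseteq> L"
    and \<rho>: "\<rho> > 1" "\<And>i. i \<in> {1..N} \<Longrightarrow> real (d i) < \<rho>"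
  shows "\<exists>C. \<forall>m. standard_height N (aff_pt K (orb m x)) \<le> C * \<rho> ^ m"
proof -
  interpret L: complex_subfield_loc L by (rule number_field_locI[OF L(1)])
  interpret K: complex_subfield_loc K by (rule K_loc)
  from orbit_size[OF L x finite.emptyI empty_subsetI]
  obtain n \<beta> \<gamma> c0 D A C where F: "integral_family n \<beta> \<gamma> c0" "D > 0" "2 * D \<le> A" and sp: "spans n \<beta> L"
    and o': "\<forall>m. \<forall>i\<in>{1..N}. size_le n \<beta> c0 D A (growth_bound C N d m i) (orb m x i)"
    by (elim exE conjE)
  note o = o'[rule_format]
  interpret integral_family n \<beta> \<gamma> c0 by (rule F(1))
  have DA: "D \<le> A" "A > 0" using F(2,3) by auto
  obtain A1 where A1: "A1 \<ge> 0" "\<And>m. (\<Sum>i\<in>{1..N}. real (growth_bound C N d m i)) \<le> A1 * \<rho> ^ m"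
    using growth_bound_sum[of \<rho> 1 N d C] \<rho> by blast
  define Q0 where "Q0 = (2 * (n + 1)) ^ n * A ^ ((n + 1) * n) * D ^ (n + 1)"
  have Q0: "Q0 \<ge> 1" using F(2) DA(2) by (simp add: Q0_def Suc_le_eq)
  define C3 where "C3 = real n * ln (real (n + 1)) + real n * real (N + 2) * ((A1 + 1) * ln (real Q0))"
  have "standard_height N (aff_pt K (orb m x)) \<le> C3 * \<rho> ^ m" for m
  proof -
    let ?s = "growth_bound C N d m"
    define M where "M = (\<Sum>i\<in>{1..N}. ?s i)"
    define Q where "Q = Q0 ^ (M + 1)"
    have Q1: "Q \<ge> 1" unfolding Q_def using Q0 by (rule one_le_power)
    have rel: "int_rel (n + 1) Q (orb m x i)" if i: "i \<in> {1..N}" for i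
    proof -
      have "?s i \<le> M" unfolding M_def by (rule member_le_sum[OF i]) auto
      from size_le_mono[OF o[OF i] this DA(1)] have "size_le n \<beta> c0 D A M (orb m x i)" .
      from size_le_int_rel[OF this F(2) DA(2)] show ?thesis by (simp only: Q_def Q0_def)
    qed
    have r1: "1 \<le> \<rho> ^ m" using \<rho>(1) by simp
    have "standard_height N (aff_pt K (orb m x)) \<le> real n * ln (real ((n + 1) * Q)) + real (N + 1) * (real n * ln (real Q))"
      using standard_height_bounds(1)[OF L.complex_subfield_loc_axioms sp K.one_mem, of N "orb m x" "n + 1" Q]
        orb_mem[OF L.complex_subfield_loc_axioms L(2) x] rel Q1 by simp
    also have "\<dots> = real n * ln (real (n + 1)) + real n * real (N + 2) * ln (real Q)"
    proof -
      have "ln (real ((n + 1) * Q)) = ln (real (n + 1)) + ln (real Q)"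
        unfolding of_nat_mult using Q1 by (intro ln_mult_pos) auto
      then show ?thesis by (simp add: algebra_simps)
    qed
    also have "ln (real Q) = real (M + 1) * ln (real Q0)" unfolding Q_def of_nat_power by (rule ln_realpow)
    also have "real n * ln (real (n + 1)) + real n * real (N + 2) * (real (M + 1) * ln (real Q0))
        \<le> real n * ln (real (n + 1)) * \<rho> ^ m + real n * real (N + 2) * (((A1 + 1) * \<rho> ^ m) * ln (real Q0))"
    proof (intro add_mono mult_left_mono mult_right_mono)
      show "real n * ln (real (n + 1)) \<le> real n * ln (real (n + 1)) * \<rho> ^ m"
        using mult_left_mono[OF r1, of "real n * ln (real (n + 1))"] by simp
      show "real (M + 1) \<le> (A1 + 1) * \<rho> ^ m" using A1(2)[of m] r1 by (simp add: M_def algebra_simps)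
    qed (use Q0 in auto)
    also have "\<dots> = C3 * \<rho> ^ m" by (simp add: C3_def algebra_simps)
    finally show ?thesis .
  qed
  then show ?thesis by blast
qed

lemma orbit_height_lower:
  assumes L: "number_field L" "k \<subseteq> L" and x: "x ` {1..N} \<subseteq> L"
  shows "\<exists>n>0. \<forall>m. \<forall>j\<in>{1..N}. cmod (orb m x j) \<ge> 1 \<longrightarrow>
    standard_height N (aff_pt K (orb m x)) \<ge> ln (cmod (orb m x j)) / real n"
proof -
  interpret L: complex_subfield_loc L by (rule number_field_locI[OF L(1)])
  interpret K: complex_subfield_loc K by (rule K_loc)
  obtain n \<beta> \<gamma> c0 where "integral_family n \<beta> \<gamma> c0" and sp: "spans n \<beta> L"
    using number_field_integral_family[OF L(1)] by metis
  have "n > 0" using dim_bounds[OF L.complex_subfield_loc_axioms sp] by linarith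
  moreover have "standard_height N (aff_pt K (orb m x)) \<ge> ln (cmod (orb m x j)) / real n"
    if "j \<in> {1..N}" "cmod (orb m x j) \<ge> 1" for m j
    using standard_height_bounds(2)[OF L.complex_subfield_loc_axioms sp K.one_mem, of N "orb m x" j]
      orb_mem[OF L.complex_subfield_loc_axioms L(2) x] that by blast
  ultimately show ?thesis by blast
qed

end

context triangular_map
begin

text \<open>The coefficients of q in x_j only see later coordinates, so along an orbit they form a
  sequence that does not depend on the starting value of x_j.\<close>

lemma coeff_in_tail:
  assumes j: "j \<in> {1..N}" and q: "mp_vars q \<subseteq> {j..N}" and agree: "\<And>i. i \<in> {j<..N} \<Longrightarrow> x i = x' i"
  shows "mp_eval (mp_coeff_in j t q) (orb n x) = mp_eval (mp_coeff_in j t q) (orb n x')"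
proof (rule mp_eval_cong)
  fix i assume "i \<in> mp_vars (mp_coeff_in j t q)"
  then have "i \<in> {Suc j..N}" using mp_vars_coeff_in[of j t q] q by fastforce
  then show "orb n x i = orb n x' i"
    by (rule orb_tail[rotated 2]) (use agree in auto)
qed

lemma number_field_of_point:
  assumes "x \<in> affine_space N K" "mp_over K q"
  obtains L where "number_field L" "k \<subseteq> L" "x ` {1..N} \<subseteq> L" "mp_over L q"
proof -
  let ?X = "x ` {1..N} \<union> lookup q ` keys q"
  have fin: "finite ?X" by simp
  have sub: "?X \<subseteq> K" using finite_coords[OF assms(1)] assms(2) by (auto simp: mp_over_def)
  obtain L where L: "number_field L" "k \<subseteq> L" "?X \<subseteq> L" by (rule enlarge[OF nf order_refl fin sub])
  interpret L: complex_subfield_loc L by (rule number_field_locI[OF L(1)])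
  have "lookup q m \<in> L" for m using L(3) L.zero_mem by (cases "m \<in> keys q") (auto simp: in_keys_iff)
  then have "mp_over L q" by (simp add: mp_over_def)
  with L show thesis by (intro that) auto
qed

lemma coeff_bounds:
  fixes \<rho> :: real
  assumes x: "x \<in> affine_space N K" and j: "j \<in> {1..N}" and q: "mp_over K q" "mp_vars q \<subseteq> {j..N}"
    and \<rho>: "\<rho> > 1" "\<And>i. i \<in> {j<..N} \<Longrightarrow> real (d i) < \<rho>"
  shows "\<exists>C\<ge>0. \<forall>n. \<forall>t\<le>e. cmod (mp_eval (mp_coeff_in j t q) (orb n x)) \<le> exp (C * \<rho> ^ n) \<and>
    (mp_eval (mp_coeff_in j t q) (orb n x) \<noteq> 0 \<longrightarrow> exp (- C * \<rho> ^ n) \<le> cmod (mp_eval (mp_coeff_in j t q) (orb n x)))"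
proof -
  obtain L where L: "number_field L" "k \<subseteq> L" "x ` {1..N} \<subseteq> L" "mp_over L q"
    by (rule number_field_of_point[OF x q(1)])
  interpret L: complex_subfield_loc L by (rule number_field_locI[OF L(1)])
  have vt: "mp_vars (mp_coeff_in j t q) \<subseteq> {Suc j..N}" for t
    using mp_vars_coeff_in[of j t q] q(2) by fastforce
  have "\<exists>C\<ge>0. \<forall>n. cmod (mp_eval (mp_coeff_in j t q) (orb n x)) \<le> exp (C * \<rho> ^ n) \<and>
    (mp_eval (mp_coeff_in j t q) (orb n x) \<noteq> 0 \<longrightarrow> exp (- C * \<rho> ^ n) \<le> cmod (mp_eval (mp_coeff_in j t q) (orb n x)))" for t
    by (rule orbit_value_bounds[OF L(1-3) mp_over_coeff_in[OF L(4) L.zero_mem] vt _ \<rho>(1)]) (use \<rho>(2) in auto)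
  then have "\<forall>t. \<exists>C. C \<ge> 0 \<and> (\<forall>n. cmod (mp_eval (mp_coeff_in j t q) (orb n x)) \<le> exp (C * \<rho> ^ n) \<and>
    (mp_eval (mp_coeff_in j t q) (orb n x) \<noteq> 0 \<longrightarrow> exp (- C * \<rho> ^ n) \<le> cmod (mp_eval (mp_coeff_in j t q) (orb n x))))"
    by simp
  from choice[OF this] obtain C where C: "\<forall>t. C t \<ge> 0 \<and> (\<forall>n. cmod (mp_eval (mp_coeff_in j t q) (orb n x)) \<le> exp (C t * \<rho> ^ n) \<and>
    (mp_eval (mp_coeff_in j t q) (orb n x) \<noteq> 0 \<longrightarrow> exp (- C t * \<rho> ^ n) \<le> cmod (mp_eval (mp_coeff_in j t q) (orb n x))))"
    by (elim exE)
  define C' where "C' = (\<Sum>t\<le>e. C t)"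
  have C0: "C t \<ge> 0" for t using C by blast
  have le: "C t * \<rho> ^ n \<le> C' * \<rho> ^ n" if "t \<le> e" for t n
  proof (rule mult_right_mono)
    show "C t \<le> C'" unfolding C'_def by (rule member_le_sum) (use that C0 in auto)
  qed (use \<rho>(1) in simp)
  show ?thesis
  proof (intro exI[of _ C'] conjI allI impI)
    show "0 \<le> C'" unfolding C'_def using C0 by (intro sum_nonneg) auto
    fix n t assume t: "t \<le> e"
    have "cmod (mp_eval (mp_coeff_in j t q) (orb n x)) \<le> exp (C t * \<rho> ^ n)" using C by blast
    also have "\<dots> \<le> exp (C' * \<rho> ^ n)" using le[OF t] by simp
    finally show "cmod (mp_eval (mp_coeff_in j t q) (orb n x)) \<le> exp (C' * \<rho> ^ n)" .
    assume nz: "mp_eval (mp_coeff_in j t q) (orb n x) \<noteq> 0"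
    have "exp (- C' * \<rho> ^ n) \<le> exp (- C t * \<rho> ^ n)" using le[OF t, of n] by simp
    also have "\<dots> \<le> cmod (mp_eval (mp_coeff_in j t q) (orb n x))" using C nz by blast
    finally show "exp (- C' * \<rho> ^ n) \<le> cmod (mp_eval (mp_coeff_in j t q) (orb n x))" .
  qed
qed

lemma k_subset_K: "k \<subseteq> K"
  by (rule number_field_subset_K[OF nf])

text \<open>Along the orbit x_j follows a polynomial recursion whose coefficients do not depend on
  its starting value t; hence one threshold \<kappa> serves all t at once.\<close>

lemma coordinate_growth:
  assumes x: "x \<in> affine_space N K" and j: "j \<in> {1..N}" and d: "d j \<ge> 2" "\<And>i. i \<in> {j<..N} \<Longrightarrow> d i < d j"
    and nz: "\<And>n. mp_eval (mp_coeff_in j (d j) (f j)) (orb n x) \<noteq> 0"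
  shows "\<exists>\<kappa>\<ge>0. \<forall>t. t \<noteq> 0 \<longrightarrow> ln (cmod t) \<ge> \<kappa> \<longrightarrow>
    (\<forall>n. cmod (orb n (x(j := t)) j) \<ge> exp ((ln (cmod t) - \<kappa>) * real (d j) ^ n))"
proof -
  \<comment> \<open>Strictly between d_j and the later degrees, which are at most d_j - 1; it
    exceeds 1 because d_j \<ge> 2.\<close>
  define \<rho> where "\<rho> = real (d j) - 1 / 2"
  have \<rho>: "\<rho> > 1" "\<rho> < real (d j)" using d(1) by (auto simp: \<rho>_def)
  have di: "real (d i) < \<rho>" if "i \<in> {j<..N}" for i
  proof -
    have "d i + 1 \<le> d j" using d(2)[OF that] by simp
    then show ?thesis unfolding \<rho>_def by linarith
  qed
  have fK: "mp_over K (f j)" using over[OF j] k_subset_K by (rule mp_over_subset)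
  define b where "b n t = mp_eval (mp_coeff_in j t (f j)) (orb n x)" for n t
  obtain C where C: "C \<ge> 0" "\<And>n t. t \<le> d j \<Longrightarrow> cmod (b n t) \<le> exp (C * \<rho> ^ n)"
    "\<And>n t. t \<le> d j \<Longrightarrow> b n t \<noteq> 0 \<Longrightarrow> exp (- C * \<rho> ^ n) \<le> cmod (b n t)"
    using coeff_bounds[OF x j fK vars[OF j] \<rho>(1) di, of "d j"] unfolding b_def by blast
  have "\<exists>\<kappa>\<ge>0. \<forall>y. (\<forall>n. y (Suc n) = (\<Sum>t\<le>d j. b n t * y n ^ t)) \<longrightarrow> y 0 \<noteq> 0 \<longrightarrow> ln (cmod (y 0)) \<ge> \<kappa> \<longrightarrow>
     (\<forall>n. cmod (y n) \<ge> exp ((ln (cmod (y 0)) - \<kappa>) * real (d j) ^ n))"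
    by (rule escape_growth[OF d(1) _ \<rho>(2) C(1)]) (use \<rho>(1) C nz in \<open>auto simp: b_def\<close>)
  then obtain \<kappa> where \<kappa>: "\<kappa> \<ge> 0" "\<And>y. (\<forall>n. y (Suc n) = (\<Sum>t\<le>d j. b n t * y n ^ t)) \<Longrightarrow> y 0 \<noteq> 0 \<Longrightarrow>
      ln (cmod (y 0)) \<ge> \<kappa> \<Longrightarrow> \<forall>n. cmod (y n) \<ge> exp ((ln (cmod (y 0)) - \<kappa>) * real (d j) ^ n)"
    by blast
  have rec: "orb (Suc n) (x(j := t)) j = (\<Sum>s\<le>d j. b n s * orb n (x(j := t)) j ^ s)" for n t
  proof -
    have "mp_eval (mp_coeff_in j s (f j)) (orb n (x(j := t))) = b n s" for s
      unfolding b_def by (rule coeff_in_tail[OF j vars[OF j]]) auto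
    then show ?thesis
      using mp_eval_coeff_in[of j "f j" "d j" "orb n (x(j := t))"] orb_Suc_coord[OF j] by simp
  qed
  have "\<forall>n. cmod (orb n (x(j := t)) j) \<ge> exp ((ln (cmod t) - \<kappa>) * real (d j) ^ n)"
    if "t \<noteq> 0" "ln (cmod t) \<ge> \<kappa>" for t
    using \<kappa>(2)[of "\<lambda>n. orb n (x(j := t)) j"] rec that by simp
  with \<kappa>(1) show ?thesis by blast
qed

section \<open>The dynamics of the last coordinate\<close>

definition pt :: "complex \<Rightarrow> nat \<Rightarrow> complex" where
  "pt y = (\<lambda>i. if i = N then y else 0)"

definition last_coeff :: "nat \<Rightarrow> complex" where
  "last_coeff t = mp_eval (mp_coeff_in N t (f N)) (\<lambda>_. 0)"

lemma N_mem: "N \<in> {1..N}"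
  using N1 by simp

lemma coeff_in_N_const: "mp_vars q \<subseteq> {N..N} \<Longrightarrow> mp_eval (mp_coeff_in N t q) x = mp_eval (mp_coeff_in N t q) x'"
  by (rule mp_eval_cong) (use mp_vars_coeff_in[of N t q] in auto)

lemma last_coeff_eq: "mp_eval (mp_coeff_in N t (f N)) x = last_coeff t"
  unfolding last_coeff_def by (rule coeff_in_N_const) (use vars[OF N_mem] in auto)

lemma last_coeff_mem: "last_coeff t \<in> k"
proof -
  interpret k: complex_subfield_loc k by (rule k_loc)
  show ?thesis unfolding last_coeff_def
    by (rule mp_eval_mem[OF k_loc mp_over_coeff_in[OF over[OF N_mem] k.zero_mem] k.zero_mem])
qed

lemma orb_last: "orb (Suc n) x N = (\<Sum>t\<le>d N. last_coeff t * orb n x N ^ t)"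
  using mp_eval_coeff_in[of N "f N" "d N" "orb n x"] orb_Suc_coord[OF N_mem] by (simp add: last_coeff_eq)

lemma last_lead_nonzero:
  assumes "d N \<ge> 1"
  shows "last_coeff (d N) \<noteq> 0"
proof -
  have "f N \<noteq> 0" using assms by (auto simp: mp_degree_in_def)
  from mp_nonzero_value[OF infinite_UNIV_char_0 mp_coeff_in_degree_nonzero[OF this, of N]]
  show ?thesis by (auto simp: last_coeff_eq)
qed

text \<open>This bounds the orbit of the conjugate starting value in the comparison below; it is
  uniform over the unit disc because that value depends on the choice of y.\<close>

lemma orb_last_bounded:
  assumes "d N \<ge> 2"
  shows "\<exists>S\<ge>1. \<forall>x n. cmod (x N) \<le> 1 \<longrightarrow> cmod (orb n x N) \<le> S ^ (2 * d N ^ n)"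
proof -
  define S where "S = 1 + (\<Sum>t\<le>d N. cmod (last_coeff t))"
  have S1: "S \<ge> 1" unfolding S_def by (simp add: sum_nonneg)
  \<comment> \<open>For d \<ge> 2 the exponent e_n = 2 d^n - 1 satisfies 1 + d e_n \<le> e_(n+1),
    where the extra 1 pays for the coefficients.\<close>
  have "cmod (orb n x N) \<le> S ^ (2 * d N ^ n - 1)" if x: "cmod (x N) \<le> 1" for x n
  proof (induction n)
    case 0
    show ?case using x S1 by simp
  next
    case (Suc n)
    define e where "e = 2 * d N ^ n - 1"
    have "d N ^ n \<ge> 1" using assms by simp
    then have e: "2 * d N ^ n = Suc e" by (simp add: e_def)
    have Se: "1 \<le> S ^ e" using S1 by (rule one_le_power)
    have "cmod (orb (Suc n) x N) \<le> (\<Sum>t\<le>d N. cmod (last_coeff t) * (S ^ e) ^ d N)"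
      unfolding orb_last
    proof (rule sum_norm_le)
      fix t assume t: "t \<in> {..d N}"
      have "cmod (orb n x N) ^ t \<le> (S ^ e) ^ t" using Suc by (intro power_mono) (auto simp: e_def)
      also have "\<dots> \<le> (S ^ e) ^ d N" using t Se by (intro power_increasing) auto
      finally show "cmod (last_coeff t * orb n x N ^ t) \<le> cmod (last_coeff t) * (S ^ e) ^ d N"
        unfolding norm_mult norm_power by (intro mult_left_mono) auto
    qed
    also have "\<dots> \<le> S * (S ^ e) ^ d N"
      unfolding sum_distrib_right[symmetric] using Se by (intro mult_right_mono) (auto simp: S_def)
    also have "\<dots> = S ^ (1 + e * d N)" by (simp add: power_mult)
    also have "\<dots> \<le> S ^ (2 * d N ^ Suc n - 1)"
    proof (rule power_increasing[OF _ S1])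
      have "2 * d N ^ Suc n = (2 * d N ^ n) * d N" by simp
      also have "\<dots> = e * d N + d N" by (simp only: e mult_Suc add.commute)
      finally show "1 + e * d N \<le> 2 * d N ^ Suc n - 1" using assms by linarith
    qed
    finally show ?case .
  qed
  moreover have "S ^ (2 * d N ^ n - 1) \<le> S ^ (2 * d N ^ n)" for n using S1 by (intro power_increasing) auto
  ultimately have "cmod (orb n x N) \<le> S ^ (2 * d N ^ n)" if "cmod (x N) \<le> 1" for x n
    using that order_trans by blast
  with S1 show ?thesis by blast
qed

text \<open>
  With \<open>\<surd>w \<notin> L\<close>, the orbit of \<open>y = u + m\<surd>w\<close> avoids \<open>L\<close>: otherwise it would meet the orbit of
  the conjugate \<open>y' = u - m\<surd>w\<close> after equally many steps, but \<open>y\<close> is large and \<open>\<bar>y'\<bar> \<le> 1\<close>.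
\<close>

lemma last_coordinate:
  assumes dN: "d N \<ge> 1" and L: "number_field L" "k \<subseteq> L"
  shows "\<exists>y\<in>K. (\<forall>n. orb n (pt y) N \<notin> L) \<and>
    (d N \<ge> 2 \<longrightarrow> (\<exists>\<mu>>0. \<forall>n. cmod (orb n (pt y) N) \<ge> exp (\<mu> * real (d N) ^ n)))"
proof -
  interpret L: complex_subfield_loc L by (rule number_field_locI[OF L(1)])
  interpret K: complex_subfield_loc K by (rule K_loc)
  obtain w :: nat where w: "w > 0" "complex_of_real (sqrt (real w)) \<notin> L"
    using sqrt_not_in_number_field[OF L(1)] by blast
  define s where "s = complex_of_real (sqrt (real w))"
  have s2: "s\<^sup>2 = of_nat w" by (simp add: s_def flip: of_real_power)
  have sL: "s \<notin> L" using w(2) by (simp add: s_def)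
  have sK: "s \<in> K"
  proof -
    let ?p = "[:- of_nat w, 0, 1:] :: complex poly"
    have "\<exists>L'. number_field L' \<and> k \<subseteq> L' \<and> s \<in> L'"
    proof (rule number_field_adjoin[OF nf])
      interpret k: complex_subfield_loc k by (rule k_loc)
      show "?p \<noteq> 0" by simp
      show "coeff ?p i \<in> k" for i
        by (auto simp: coeff_pCons k.zero_mem k.one_mem intro!: k.uminus_mem k.of_nat_mem split: nat.split)
      show "poly ?p s = 0" using s2 by (simp add: power2_eq_square algebra_simps)
    qed
    then show ?thesis using number_field_subset_K by blast
  qed
  \<comment> \<open>The graph of the conjugation of L(s) over L, handled as a relation compatible
    with sums and products.\<close>
  define conj where "conj = {(a + b * s, a - b * s) | a b. a \<in> L \<and> b \<in> L}"
  have cI: "(a + b * s, a - b * s) \<in> conj" if "a \<in> L" "b \<in> L" for a b using that by (auto simp: conj_def)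
  have c_add: "(z + y, z' + y') \<in> conj" if zy: "(z, z') \<in> conj" "(y, y') \<in> conj" for z z' y y'
  proof -
    obtain a b a' b' where ab: "z = a + b * s" "z' = a - b * s" "y = a' + b' * s" "y' = a' - b' * s" "a \<in> L" "b \<in> L" "a' \<in> L" "b' \<in> L"
      using zy unfolding conj_def by blast
    have e: "z + y = (a + a') + (b + b') * s" "z' + y' = (a + a') - (b + b') * s"
      unfolding ab by (simp_all add: algebra_simps)
    show ?thesis unfolding e by (intro cI L.add_mem ab(5-8))
  qed
  have c_mult: "(z * y, z' * y') \<in> conj" if zy: "(z, z') \<in> conj" "(y, y') \<in> conj" for z z' y y'
  proof -
    obtain a b a' b' where ab: "z = a + b * s" "z' = a - b * s" "y = a' + b' * s" "y' = a' - b' * s" "a \<in> L" "b \<in> L" "a' \<in> L" "b' \<in> L"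
      using zy unfolding conj_def by blast
    have e: "z * y = (a * a' + b * b' * of_nat w) + (a * b' + b * a') * s"
      "z' * y' = (a * a' + b * b' * of_nat w) - (a * b' + b * a') * s"
      unfolding ab s2[symmetric] by (simp_all add: algebra_simps power2_eq_square)
    show ?thesis unfolding e by (intro cI L.add_mem L.mult_mem L.of_nat_mem ab(5-8))
  qed
  have c_const: "(c, c) \<in> conj" if "c \<in> L" for c using cI[OF that L.zero_mem] by simp
  have c_pow: "(z ^ n, z' ^ n) \<in> conj" if "(z, z') \<in> conj" for z z' n
    by (induction n) (use that c_mult c_const[OF L.one_mem] in auto)
  have c_sum: "(sum g A, sum g' A) \<in> conj" if "\<And>a. a \<in> A \<Longrightarrow> (g a, g' a) \<in> conj" for g g' :: "nat \<Rightarrow> complex" and A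
    using that by (induction A rule: infinite_finite_induct) (auto simp: c_add c_const[OF L.zero_mem])
  have orb_conj: "(orb n (pt y) N, orb n (pt y') N) \<in> conj" if "(y, y') \<in> conj" for n y y'
  proof (induction n)
    case 0
    show ?case using that by (simp add: pt_def)
  next
    case (Suc n)
    show ?case unfolding orb_last
      by (intro c_sum c_mult c_pow c_const Suc) (use last_coeff_mem L(2) in auto)
  qed
  \<comment> \<open>If z = a + b s differs from its conjugate, then b \<noteq> 0, and z in L would
    put s into L.\<close>
  have avoid: "z \<notin> L" if zz: "(z, z') \<in> conj" "z \<noteq> z'" for z z'
  proof
    assume "z \<in> L"
    obtain a b where ab: "z = a + b * s" "z' = a - b * s" "a \<in> L" "b \<in> L" using zz(1) unfolding conj_def by blast
    have "b \<noteq> 0" using zz(2) ab by auto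
    then have "s = (z - a) / b" using ab by simp
    also have "\<dots> \<in> L" using \<open>z \<in> L\<close> ab by (intro L.divide_mem L.diff_mem)
    finally show False using sL by simp
  qed
  \<comment> \<open>Rounding places the conjugate u m - m s in the unit disc, while y m has absolute
    value at least m.\<close>
  define u where "u m = nat \<lfloor>real m * sqrt (real w)\<rfloor>" for m
  define y where "y m = of_nat (u m) + of_nat m * s" for m :: nat
  define y' where "y' m = of_nat (u m) - of_nat m * s" for m :: nat
  have yy: "(y m, y' m) \<in> conj" for m unfolding y_def y'_def by (rule cI[OF L.of_nat_mem L.of_nat_mem])
  have yK: "y m \<in> K" for m unfolding y_def by (intro K.add_mem K.mult_mem K.of_nat_mem sK)
  have u: "real (u m) \<le> real m * sqrt (real w)" "real m * sqrt (real w) \<le> real (u m) + 1" for m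
    unfolding u_def by (auto simp: of_nat_nat)
  have y'1: "cmod (y' m) \<le> 1" for m
  proof -
    have "y' m = complex_of_real (real (u m) - real m * sqrt (real w))" by (simp add: y'_def s_def)
    then have "cmod (y' m) = \<bar>real (u m) - real m * sqrt (real w)\<bar>" by (simp only: norm_of_real)
    then show ?thesis using u[of m] by linarith
  qed
  have ym: "cmod (y m) \<ge> real m" for m
  proof -
    have "y m = complex_of_real (real (u m) + real m * sqrt (real w))" by (simp add: y_def s_def)
    then have "cmod (y m) = \<bar>real (u m) + real m * sqrt (real w)\<bar>" by (simp only: norm_of_real)
    also have "\<dots> \<ge> real m * sqrt (real w)" by simp
    also have "real m * sqrt (real w) \<ge> real m * 1" using w(1) by (intro mult_left_mono) auto
    finally show ?thesis by simp
  qed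
  show ?thesis
  proof (cases "d N \<ge> 2")
    case False
    then have d1: "d N = 1" using dN by simp
    \<comment> \<open>In degree 1 the map is affine and injective, so the two orbits never meet at
      equal times, without any growth.\<close>
    have "orb n (pt (y 1)) N \<noteq> orb n (pt (y' 1)) N" for n
    proof (induction n)
      case 0
      have "s \<noteq> 0" using sL L.zero_mem by auto
      then show ?case by (simp add: pt_def y_def y'_def)
    next
      case (Suc n)
      have "orb (Suc n) x N = last_coeff 0 + last_coeff 1 * orb n x N" for x
        unfolding orb_last d1 by simp
      then show ?case using Suc last_lead_nonzero[OF dN] by (simp add: d1)
    qed
    then have "\<forall>n. orb n (pt (y 1)) N \<notin> L" using avoid[OF orb_conj[OF yy]] by blast
    with False yK show ?thesis by blast
  next
    case True
    obtain S where S: "S \<ge> 1" "\<And>x n. cmod (x N) \<le> 1 \<Longrightarrow> cmod (orb n x N) \<le> S ^ (2 * d N ^ n)"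
      using orb_last_bounded[OF True] by blast
    have z_aff: "(\<lambda>_. 0) \<in> affine_space N K" by (simp add: affine_space_def K.zero_mem)
    have "\<exists>\<kappa>\<ge>0. \<forall>t. t \<noteq> 0 \<longrightarrow> ln (cmod t) \<ge> \<kappa> \<longrightarrow>
      (\<forall>n. cmod (orb n ((\<lambda>_. 0)(N := t)) N) \<ge> exp ((ln (cmod t) - \<kappa>) * real (d N) ^ n))"
      by (rule coordinate_growth[OF z_aff N_mem True])
        (use last_lead_nonzero[OF dN] in \<open>auto simp: last_coeff_eq\<close>)
    moreover have "(\<lambda>_. 0)(N := t) = pt t" for t by (auto simp: pt_def)
    ultimately obtain \<kappa> where \<kappa>: "\<kappa> \<ge> 0" "\<And>t n. t \<noteq> 0 \<Longrightarrow> ln (cmod t) \<ge> \<kappa> \<Longrightarrow>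
      cmod (orb n (pt t) N) \<ge> exp ((ln (cmod t) - \<kappa>) * real (d N) ^ n)" by auto
    \<comment> \<open>Just enough for exp (\<mu> d^n) to exceed the bound S^(2 d^n) for the
      conjugate orbit.\<close>
    define \<mu> where "\<mu> = 2 * ln S + 1"
    have \<mu>: "\<mu> > 0" using S(1) by (simp add: \<mu>_def add_nonneg_pos)
    obtain m :: nat where m: "real m \<ge> exp (\<kappa> + \<mu>)" using real_arch_simple by blast
    have ypos: "cmod (y m) \<ge> exp (\<kappa> + \<mu>)" using m ym[of m] by linarith
    then have y0: "cmod (y m) > 0" using exp_gt_zero less_le_trans by blast
    have "ln (exp (\<kappa> + \<mu>)) \<le> ln (cmod (y m))" using ypos y0 by (subst ln_le_cancel_iff) auto
    then have ly: "ln (cmod (y m)) \<ge> \<kappa> + \<mu>" by simp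
    have big: "cmod (orb n (pt (y m)) N) \<ge> exp (\<mu> * real (d N) ^ n)" for n
    proof -
      have "exp (\<mu> * real (d N) ^ n) \<le> exp ((ln (cmod (y m)) - \<kappa>) * real (d N) ^ n)"
        using ly by (simp add: mult_right_mono)
      also have "\<dots> \<le> cmod (orb n (pt (y m)) N)" using \<kappa>(2)[of "y m" n] y0 ly \<mu> by auto
      finally show ?thesis .
    qed
    have "orb n (pt (y m)) N \<noteq> orb n (pt (y' m)) N" for n
    proof
      assume eq: "orb n (pt (y m)) N = orb n (pt (y' m)) N"
      have "cmod (orb n (pt (y' m)) N) \<le> S ^ (2 * d N ^ n)" by (rule S(2)) (simp add: pt_def y'1)
      also have "\<dots> = exp (2 * ln S * real (d N) ^ n)"
        using S(1) by (simp add: powr_realpow[symmetric] powr_def mult_ac)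
      also have "\<dots> < exp (\<mu> * real (d N) ^ n)" using dN by (simp add: \<mu>_def)
      finally show False using big[of n] eq by simp
    qed
    then have "\<forall>n. orb n (pt (y m)) N \<notin> L" using avoid[OF orb_conj[OF yy]] by blast
    with big \<mu> yK show ?thesis by blast
  qed
qed

end

lemma strict_chain_less:
  fixes g :: "nat \<Rightarrow> nat"
  assumes "\<And>i. i \<in> {j..<N} \<Longrightarrow> g (i + 1) < g i" "j < l" "l \<le> N"
  shows "g l < g j"
  using assms(2,3)
proof (induction l)
  case (Suc l)
  show ?case
  proof (cases "l = j")
    case False
    then have "g l < g j" using Suc by simp
    moreover have "g (l + 1) < g l" using assms(1)[of l] Suc.prems by simp
    ultimately show ?thesis by simp
  qed (use assms(1)[of j] Suc.prems in simp)
qed simp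

section \<open>Points with prescribed growth and non-vanishing\<close>

context triangular_map
begin

lemma pt_affine: "y \<in> K \<Longrightarrow> pt y \<in> affine_space N K"
  using N1 complex_subfield_loc.zero_mem[OF K_loc] by (auto simp: affine_space_def pt_def)

text \<open>As a polynomial in x_N alone, q has finitely many roots, all of them algebraic. They are
  added to the field that the orbit has to avoid, so the non-vanishing of q is a by-product of the
  avoidance.\<close>

lemma good_point_last:
  assumes dN: "d N \<ge> 1" and q: "q \<noteq> 0" "mp_over K q" "mp_vars q \<subseteq> {N..N}" and L: "number_field L" "k \<subseteq> L"
  shows "\<exists>x\<in>affine_space N K. (\<forall>n. orb n x N \<notin> L) \<and> (\<forall>n. mp_eval q (orb n x) \<noteq> 0) \<and>
    (d N \<ge> 2 \<longrightarrow> (\<exists>\<mu>>0. \<forall>n. cmod (orb n x N) \<ge> exp (\<mu> * real (d N) ^ n)))"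
proof -
  define c where "c t = mp_eval (mp_coeff_in N t q) (\<lambda>_. 0)" for t
  define e where "e = mp_degree_in N q"
  have c: "mp_eval (mp_coeff_in N t q) x = c t" for t x unfolding c_def by (rule coeff_in_N_const[OF q(3)])
  have ce: "c e \<noteq> 0"
    using mp_nonzero_value[OF infinite_UNIV_char_0 mp_coeff_in_degree_nonzero[OF q(1), of N]]
    by (auto simp: c e_def)
  define Z where "Z = {z. (\<Sum>t\<le>e. c t * z ^ t) = 0}"
  have Zf: "finite Z" unfolding Z_def by (rule polyfun_roots_finite[of c e e]) (use ce in auto)
  have Xf: "finite (lookup q ` keys q)" by simp
  have XK: "lookup q ` keys q \<subseteq> K" using q(2) by (auto simp: mp_over_def)
  obtain L1 where L1: "number_field L1" "k \<subseteq> L1" "lookup q ` keys q \<subseteq> L1"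
    by (rule enlarge[OF nf order_refl Xf XK])
  interpret L1: complex_subfield_loc L1 by (rule number_field_locI[OF L1(1)])
  have "lookup q m \<in> L1" for m using L1(3) L1.zero_mem by (cases "m \<in> keys q") (auto simp: in_keys_iff)
  then have qL1: "mp_over L1 q" by (simp add: mp_over_def)
  have cL1: "c t \<in> L1" for t unfolding c_def
    by (rule mp_eval_mem[OF L1.complex_subfield_loc_axioms mp_over_coeff_in[OF qL1 L1.zero_mem] L1.zero_mem])
  define p :: "complex poly" where "p = (\<Sum>t\<le>e. monom (c t) t)"
  have cf: "coeff p t = (if t \<le> e then c t else 0)" for t by (simp add: p_def coeff_sum)
  have "p \<noteq> 0" using ce cf[of e] by auto
  have ZK: "Z \<subseteq> K"
  proof
    fix z assume "z \<in> Z"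
    then have "poly p z = 0" by (simp add: Z_def p_def poly_sum poly_monom)
    moreover have "coeff p t \<in> L1" for t using cf cL1 L1.zero_mem by simp
    ultimately obtain L2 where "number_field L2" "z \<in> L2"
      using number_field_adjoin[OF L1(1) \<open>p \<noteq> 0\<close>, of z] by blast
    then show "z \<in> K" using number_field_subset_K by blast
  qed
  obtain L3 where L3: "number_field L3" "L \<subseteq> L3" "k \<subseteq> L3" "Z \<subseteq> L3" by (rule enlarge[OF L Zf ZK])
  obtain y where y: "y \<in> K" "\<And>n. orb n (pt y) N \<notin> L3"
    "d N \<ge> 2 \<longrightarrow> (\<exists>\<mu>>0. \<forall>n. cmod (orb n (pt y) N) \<ge> exp (\<mu> * real (d N) ^ n))"
    using last_coordinate[OF dN L3(1,3)] by blast
  have "mp_eval q (orb n (pt y)) \<noteq> 0" for n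
  proof
    assume "mp_eval q (orb n (pt y)) = 0"
    then have "orb n (pt y) N \<in> Z"
      using mp_eval_coeff_in[of N q e "orb n (pt y)"] by (simp add: e_def c Z_def)
    then show False using y(2) L3(4) by blast
  qed
  then show ?thesis using pt_affine[OF y(1)] y(2,3) L3(2) by blast
qed

text \<open>The leading coefficients in x_j of q and of f_j are multiplied into one polynomial in
  the later variables, which the induction keeps nonzero along the orbit of the tail. A large
  integer x_j then escapes beyond the roots of q in x_j at every time, since growth with d_j^n beats
  the decay of the coefficients.\<close>

lemma good_point:
  assumes "j \<le> N" "1 \<le> j" and "\<And>i. i \<in> {j..<N} \<Longrightarrow> d (i + 1) < d i" and dN: "d N \<ge> 1"
    and "q \<noteq> 0" "mp_over K q" "mp_vars q \<subseteq> {j..N}" and L: "number_field L" "k \<subseteq> L"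
  shows "\<exists>x\<in>affine_space N K. (\<forall>n. orb n x N \<notin> L) \<and> (\<forall>n. mp_eval q (orb n x) \<noteq> 0) \<and>
    (d j \<ge> 2 \<longrightarrow> (\<exists>\<mu>>0. \<forall>n. cmod (orb n x j) \<ge> exp (\<mu> * real (d j) ^ n)))"
  using assms(1,2,3,5,6,7)
proof (induction j arbitrary: q rule: inc_induct)
  case base
  then show ?case by (intro good_point_last[OF dN _ _ _ L]) auto
next
  case (step j)
  interpret K: complex_subfield_loc K by (rule K_loc)
  have j: "j \<in> {1..N}" using step.hyps step.prems(1) by simp
  have dl: "d l < d j" if "l \<in> {j<..N}" for l
    using strict_chain_less[of j N d l] step.prems(2) that by auto
  \<comment> \<open>Automatic before the last coordinate, as d_j > d_N \<ge> 1; escape is thus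
    always available in the induction step.\<close>
  have dj: "d j \<ge> 2" using dl[of N] step.hyps dN by simp
  define e where "e = mp_degree_in j q"
  let ?qe = "mp_coeff_in j e q" and ?a = "mp_coeff_in j (d j) (f j)"
  have fK: "mp_over K (f j)" using over[OF j] k_subset_K by (rule mp_over_subset)
  have fj0: "f j \<noteq> 0" using dj by (auto simp: mp_degree_in_def)
  have v: "mp_vars ?qe \<subseteq> {Suc j..N}" "mp_vars ?a \<subseteq> {Suc j..N}"
    using mp_vars_coeff_in[of j e q] mp_vars_coeff_in[of j "d j" "f j"] step.prems(5) vars[OF j] by fastforce+
  have nz: "?qe * ?a \<noteq> 0"
    using mp_coeff_in_degree_nonzero[OF step.prems(3), of j] mp_coeff_in_degree_nonzero[OF fj0, of j]
    by (simp add: e_def)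
  have ov: "mp_over K (?qe * ?a)"
    by (intro mp_over_mult K_loc mp_over_coeff_in step.prems(4) fK K.zero_mem)
  have vv: "mp_vars (?qe * ?a) \<subseteq> {Suc j..N}" using mp_vars_times[of ?qe ?a] v by blast
  have "\<exists>x\<in>affine_space N K. (\<forall>n. orb n x N \<notin> L) \<and> (\<forall>n. mp_eval (?qe * ?a) (orb n x) \<noteq> 0) \<and>
      (d (Suc j) \<ge> 2 \<longrightarrow> (\<exists>\<mu>>0. \<forall>n. cmod (orb n x (Suc j)) \<ge> exp (\<mu> * real (d (Suc j)) ^ n)))"
    by (rule step.IH[OF _ _ nz ov vv]) (use step.prems(2) in auto)
  then obtain x where x: "x \<in> affine_space N K" "\<And>n. orb n x N \<notin> L" "\<And>n. mp_eval (?qe * ?a) (orb n x) \<noteq> 0"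
    by blast
  have qe: "mp_eval ?qe (orb n x) \<noteq> 0" and a: "mp_eval ?a (orb n x) \<noteq> 0" for n
    using x(3)[of n] by (auto simp: mp_eval_mult)
  obtain \<kappa> where \<kappa>: "\<kappa> \<ge> 0" "\<And>t n. t \<noteq> 0 \<Longrightarrow> ln (cmod t) \<ge> \<kappa> \<Longrightarrow>
      cmod (orb n (x(j := t)) j) \<ge> exp ((ln (cmod t) - \<kappa>) * real (d j) ^ n)"
    using coordinate_growth[OF x(1) j dj dl a] by blast
  define \<rho> where "\<rho> = real (d j) - 1 / 2"
  have \<rho>: "\<rho> > 1" "\<rho> < real (d j)" using dj by (auto simp: \<rho>_def)
  have di: "real (d i) < \<rho>" if "i \<in> {j<..N}" for i
  proof -
    have "d i + 1 \<le> d j" using dl[OF that] by simp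
    then show ?thesis unfolding \<rho>_def by linarith
  qed
  define b where "b n t = mp_eval (mp_coeff_in j t q) (orb n x)" for n t
  obtain C where C: "C \<ge> 0" "\<And>n t. t \<le> e \<Longrightarrow> cmod (b n t) \<le> exp (C * \<rho> ^ n)"
    "\<And>n t. t \<le> e \<Longrightarrow> b n t \<noteq> 0 \<Longrightarrow> exp (- C * \<rho> ^ n) \<le> cmod (b n t)"
    using coeff_bounds[OF x(1) j step.prems(4,5) \<rho>(1) di, of e] unfolding b_def by blast
  \<comment> \<open>With this growth exponent the leading term of q in x_j beats the e lower terms,
    whose coefficients may be larger by a factor exp (2 C \<rho>^n).\<close>
  define M where "M = real e + 2 * C + 1"
  have M0: "M > 0" using C(1) by (simp add: M_def)
  obtain t :: nat where t: "real t \<ge> exp (\<kappa> + M)" using real_arch_simple by blast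
  then have t0: "real t > 0" using exp_gt_zero less_le_trans by blast
  have "ln (exp (\<kappa> + M)) \<le> ln (real t)" using t t0 by (subst ln_le_cancel_iff) auto
  then have lt: "ln (real t) \<ge> \<kappa> + M" by simp
  define x' where "x' = x(j := of_nat t)"
  have x': "x' \<in> affine_space N K" using x(1) j K.of_nat_mem by (auto simp: x'_def affine_space_def)
  have big: "cmod (orb n x' j) \<ge> exp (M * real (d j) ^ n)" for n
  proof -
    have "exp (M * real (d j) ^ n) \<le> exp ((ln (real t) - \<kappa>) * real (d j) ^ n)"
      using lt by (simp add: mult_right_mono)
    also have "\<dots> \<le> cmod (orb n x' j)" using \<kappa>(2)[of "of_nat t" n] t0 lt M0 by (simp add: x'_def)
    finally show ?thesis .
  qed
  have "orb n x' N = orb n x N" for n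
    by (rule orb_tail[of "Suc j"]) (use step.hyps in \<open>auto simp: x'_def\<close>)
  then have 1: "orb n x' N \<notin> L" for n using x(2) by simp
  have 2: "mp_eval q (orb n x') \<noteq> 0" for n
  proof -
    have cb: "mp_eval (mp_coeff_in j s q) (orb n x') = b n s" for s
      unfolding b_def x'_def by (rule coeff_in_tail[OF j step.prems(5)]) auto
    have ev: "mp_eval q (orb n x') = (\<Sum>s\<le>e. b n s * orb n x' j ^ s)"
      using mp_eval_coeff_in[of j q e "orb n x'"] by (simp add: e_def cb)
    show ?thesis
    proof (cases "e = 0")
      case True
      then show ?thesis using ev qe[of n] by (simp add: b_def)
    next
      case False
      let ?Y = "cmod (orb n x' j)"
      have r1: "1 \<le> \<rho> ^ n" using \<rho>(1) by simp
      have rd: "\<rho> ^ n \<le> real (d j) ^ n" using \<rho> by (intro power_mono) auto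
      have "M * \<rho> ^ n \<le> M * real (d j) ^ n" using rd M0 by (intro mult_left_mono) auto
      moreover have "real e * 1 + 2 * C * \<rho> ^ n < M * \<rho> ^ n"
      proof -
        have "real e * 1 \<le> real e * \<rho> ^ n" using r1 by (intro mult_left_mono) auto
        moreover have "M * \<rho> ^ n = real e * \<rho> ^ n + 2 * C * \<rho> ^ n + \<rho> ^ n" by (simp add: M_def algebra_simps)
        ultimately show ?thesis using r1 by linarith
      qed
      ultimately have "exp (real e + 2 * C * \<rho> ^ n) < exp (M * real (d j) ^ n)" by simp
      with big[of n] have Y: "exp (real e + 2 * C * \<rho> ^ n) < ?Y" by linarith
      have "1 \<le> exp (real e + 2 * C * \<rho> ^ n)" using C(1) r1 by simp
      with Y have Y1: "1 \<le> ?Y" by linarith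
      have "real e \<le> exp (real e)" using exp_ge_add_one_self[of "real e"] by linarith
      then have "real e * exp (2 * C * \<rho> ^ n) \<le> exp (real e) * exp (2 * C * \<rho> ^ n)" by (intro mult_right_mono) auto
      then have "real e * exp (2 * C * \<rho> ^ n) < ?Y" using Y unfolding exp_add by linarith
      then have "exp (- C * \<rho> ^ n) * (real e * exp (2 * C * \<rho> ^ n)) < exp (- C * \<rho> ^ n) * ?Y"
        by (intro mult_strict_left_mono) auto
      moreover have "exp (- C * \<rho> ^ n) * (real e * exp (2 * C * \<rho> ^ n)) = real e * exp (C * \<rho> ^ n)"
        by (simp add: mult_exp_exp ac_simps)
      ultimately have pos: "0 < exp (- C * \<rho> ^ n) * ?Y - real e * exp (C * \<rho> ^ n)" by linarith
      have "0 < ?Y ^ (e - 1) * (exp (- C * \<rho> ^ n) * ?Y - real e * exp (C * \<rho> ^ n))"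
        by (intro mult_pos_pos zero_less_power pos) (use Y1 in linarith)
      also have "\<dots> \<le> cmod (\<Sum>s\<le>e. b n s * orb n x' j ^ s)"
        by (rule dominated_poly_lower) (use False C(2,3) qe[of n] Y1 in \<open>auto simp: b_def\<close>)
      finally show ?thesis unfolding ev by auto
    qed
  qed
  show ?case using x' 1 2 big M0 by blast
qed

subsection \<open>Degrees of the iterates\<close>

primrec aff_iter :: "nat \<Rightarrow> nat \<Rightarrow> mpoly" where
  "aff_iter 0 = (\<lambda>i. if i \<in> {1..N} then mp_var i else 0)"
| "aff_iter (Suc n) = (\<lambda>i. if i \<in> {1..N} then mp_subst (f i) (aff_iter n) else 0)"

lemma mp_eval_aff_iter: "i \<in> {1..N} \<Longrightarrow> mp_eval (aff_iter n i) x = orb n x i"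
proof (induction n arbitrary: i)
  case (Suc n)
  have "mp_eval (f i) (\<lambda>l. mp_eval (aff_iter n l) x) = mp_eval (f i) (orb n x)"
  proof (rule mp_eval_cong)
    fix l assume "l \<in> mp_vars (f i)"
    then have "l \<in> {1..N}" using vars[OF Suc.prems] Suc.prems by auto
    then show "mp_eval (aff_iter n l) x = orb n x l" by (rule Suc.IH)
  qed
  then show ?case using Suc.prems orb_Suc_coord[OF Suc.prems] by (simp add: mp_eval_subst)
qed (simp add: mp_eval_var)

lemma mp_vars_aff_iter: "i \<in> {1..N} \<Longrightarrow> mp_vars (aff_iter n i) \<subseteq> {1..N}"
proof (induction n arbitrary: i)
  case 0
  then show ?case by (auto simp: mp_vars_def mp_var_def)
next
  case (Suc n)
  have "mp_vars (mp_subst (f i) (aff_iter n)) \<subseteq> {1..N}"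
  proof (rule mp_vars_subst)
    fix l assume "l \<in> mp_vars (f i)"
    then have "l \<in> {1..N}" using vars[OF Suc.prems] Suc.prems by auto
    then show "mp_vars (aff_iter n l) \<subseteq> {1..N}" by (rule Suc.IH)
  qed
  then show ?case using Suc.prems by simp
qed

definition Dn :: "nat \<Rightarrow> nat" where
  "Dn n = Max (insert 0 (\<Union>i\<in>{1..N}. tdeg ` keys (aff_iter n i)))"

lemma Dn_ge: "i \<in> {1..N} \<Longrightarrow> m \<in> keys (aff_iter n i) \<Longrightarrow> tdeg m \<le> Dn n"
  unfolding Dn_def by (rule Max_ge) auto

lemma Dn_attained:
  assumes "Dn n \<ge> 1"
  obtains i m where "i \<in> {1..N}" "m \<in> keys (aff_iter n i)" "tdeg m = Dn n"
proof -
  have "Dn n \<in> insert 0 (\<Union>i\<in>{1..N}. tdeg ` keys (aff_iter n i))"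
    unfolding Dn_def by (rule Max_in) auto
  with assms show thesis using that by auto
qed

text \<open>Total degree is a filtration in the sense of \<open>triangular_filtered\<close>; the
  unit charged for each addition is generous here but does not affect the growth rate.\<close>

lemma Dn_upper:
  fixes \<rho> :: real
  assumes "\<rho> > 1" "\<And>i. i \<in> {1..N} \<Longrightarrow> real (d i) < \<rho>"
  shows "\<exists>C. \<forall>n. real (Dn n) \<le> C * \<rho> ^ n"
proof -
  let ?B = "\<lambda>M (p :: mpoly). \<forall>m\<in>keys p. tdeg m \<le> M"
  have "\<exists>C. \<forall>n. \<forall>i\<in>{1..N}. ?B (growth_bound C N d n i) (aff_iter n i)"
  proof (rule triangular_filtered[where \<phi> = mp_const and ?C0.0 = 1])
    show "?B M' p" if "?B M p" "M \<le> M'" for M M' and p :: mpoly using that by force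
    show "?B (M + M') (p * q)" if "?B M p" "?B M' q" for M M' and p q :: mpoly
    proof
      fix m assume "m \<in> keys (p * q)"
      then obtain a b where "m = a + b" "a \<in> keys p" "b \<in> keys q" using keys_times_subset[of p q] by blast
      with that show "tdeg m \<le> M + M'" by (simp add: tdeg_add add_mono)
    qed
    show "?B (M + 1) (p + q)" if "?B M p" "?B M q" for M and p q :: mpoly
    proof
      fix m assume "m \<in> keys (p + q)"
      then have "m \<in> keys p \<or> m \<in> keys q" using keys_add[of p q] by blast
      with that show "tdeg m \<le> M + 1" by fastforce
    qed
    show "?B 1 (mp_const c)" for c by (simp add: mp_const_def tdeg_def)
    show "?B 1 (aff_iter 0 i)" if "i \<in> {1..N}" for i using that by (simp add: mp_var_def)
    show "aff_iter (Suc n) i = mp_insertion mp_const (aff_iter n) (f i)" if "i \<in> {1..N}" for n i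
      using that by (simp add: mp_subst_def)
    show "mp_vars (f i) \<subseteq> {i..N}" if "i \<in> {1..N}" for i by (rule vars[OF that])
  qed simp
  then obtain C where C: "\<forall>n. \<forall>i\<in>{1..N}. ?B (growth_bound C N d n i) (aff_iter n i)" by (elim exE)
  obtain A1 where A1: "A1 \<ge> 0" "\<And>m. (\<Sum>i\<in>{1..N}. real (growth_bound C N d m i)) \<le> A1 * \<rho> ^ m"
    using growth_bound_sum[of \<rho> 1 N d C] assms by blast
  have "real (Dn n) \<le> A1 * \<rho> ^ n" for n
  proof -
    have "Dn n \<le> (\<Sum>i\<in>{1..N}. growth_bound C N d n i)"
      unfolding Dn_def
    proof (subst Max_le_iff, goal_cases)
      case 3
      show ?case
      proof
        fix a assume "a \<in> insert 0 (\<Union>i\<in>{1..N}. tdeg ` keys (aff_iter n i))"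
        then consider "a = 0" | i m where "i \<in> {1..N}" "m \<in> keys (aff_iter n i)" "a = tdeg m" by blast
        then show "a \<le> (\<Sum>i\<in>{1..N}. growth_bound C N d n i)"
        proof cases
          case 2
          then have "a \<le> growth_bound C N d n i" using C by blast
          also have "\<dots> \<le> (\<Sum>i\<in>{1..N}. growth_bound C N d n i)" by (rule member_le_sum[OF 2(1)]) auto
          finally show ?thesis .
        qed simp
      qed
    qed auto
    then have "real (Dn n) \<le> real (\<Sum>i\<in>{1..N}. growth_bound C N d n i)" by (simp only: of_nat_le_iff)
    also have "\<dots> = (\<Sum>i\<in>{1..N}. real (growth_bound C N d n i))" by simp
    finally show ?thesis using A1(2)[of n] by linarith
  qed
  then show ?thesis by blast
qed

text \<open>The degree is read off from growth: for x_j = t large and the other coordinates fixed,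
  coordinate j of the n-th iterate is at least a constant times t^(d_j^n), whereas a polynomial of
  degree D' in x_j is O(t^D').\<close>

lemma Dn_lower:
  assumes x: "x \<in> affine_space N K" and j: "j \<in> {1..N}" and d: "d j \<ge> 2" "\<And>i. i \<in> {j<..N} \<Longrightarrow> d i < d j"
    and nz: "\<And>n. mp_eval (mp_coeff_in j (d j) (f j)) (orb n x) \<noteq> 0"
  shows "d j ^ n \<le> Dn n"
proof -
  obtain \<kappa> where \<kappa>: "\<kappa> \<ge> 0" "\<And>t n. t \<noteq> 0 \<Longrightarrow> ln (cmod t) \<ge> \<kappa> \<Longrightarrow>
      cmod (orb n (x(j := t)) j) \<ge> exp ((ln (cmod t) - \<kappa>) * real (d j) ^ n)"
    using coordinate_growth[OF x j d nz] by blast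
  define p where "p = aff_iter n j"
  define D' where "D' = mp_degree_in j p"
  define e where "e = d j ^ n"
  have D'Dn: "D' \<le> Dn n"
  proof (cases "p = 0")
    case True
    then show ?thesis by (simp add: D'_def mp_degree_in_def)
  next
    case False
    then obtain m where m: "m \<in> keys p" "lookup m j = D'" unfolding D'_def by (rule mp_degree_in_attained)
    have "D' \<le> tdeg m" using lookup_le_tdeg[of m j] m(2) by simp
    also have "\<dots> \<le> Dn n" using Dn_ge[OF j, of m n] m(1) by (simp add: p_def)
    finally show ?thesis .
  qed
  define c where "c s = mp_eval (mp_coeff_in j s p) x" for s
  define W where "W = (\<Sum>s\<le>D'. cmod (c s))"
  have up: "cmod (orb n (x(j := of_nat t)) j) \<le> W * real t ^ D'" if "t \<ge> 1" for t :: nat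
  proof -
    have "mp_eval (mp_coeff_in j s p) (x(j := of_nat t)) = c s" for s
      unfolding c_def by (rule mp_eval_cong) (use mp_vars_coeff_in[of j s p] in auto)
    then have "orb n (x(j := of_nat t)) j = (\<Sum>s\<le>D'. c s * of_nat t ^ s)"
      using mp_eval_coeff_in[of j p D' "x(j := of_nat t)"] mp_eval_aff_iter[OF j, of n "x(j := of_nat t)"]
      by (simp add: D'_def p_def)
    also have "cmod \<dots> \<le> (\<Sum>s\<le>D'. cmod (c s) * real t ^ D')"
    proof (rule sum_norm_le)
      fix s assume "s \<in> {..D'}"
      then show "cmod (c s * of_nat t ^ s) \<le> cmod (c s) * real t ^ D'"
        unfolding norm_mult norm_power norm_of_nat using that by (intro mult_left_mono power_increasing) auto
    qed
    also have "\<dots> = W * real t ^ D'" by (simp add: W_def sum_distrib_right)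
    finally show ?thesis .
  qed
  have "e \<le> D'"
  proof (rule ccontr)
    assume "\<not> e \<le> D'"
    then have eD: "D' + 1 \<le> e" by simp
    \<comment> \<open>Beyond this threshold escape applies, and one factor t outweighs the constant
      W exp (\<kappa> e).\<close>
    obtain t :: nat where t: "real t > max (exp \<kappa>) (W * exp (\<kappa> * real e))" using reals_Archimedean2 by blast
    have t1: "real t \<ge> exp \<kappa>" "real t > W * exp (\<kappa> * real e)" using t by auto
    have "1 \<le> exp \<kappa>" using \<kappa>(1) by simp
    with t1 have t2: "real t \<ge> 1" by linarith
    have "ln (exp \<kappa>) \<le> ln (real t)" using t1 t2 by (subst ln_le_cancel_iff) auto
    then have lt: "ln (real t) \<ge> \<kappa>" by simp
    have re: "real (d j) ^ n = real e" by (simp add: e_def)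
    have "exp ((ln (real t) - \<kappa>) * real e) \<le> cmod (orb n (x(j := of_nat t)) j)"
      using \<kappa>(2)[of "of_nat t" n] lt t2 by (simp only: re) auto
    also have "\<dots> \<le> W * real t ^ D'" using up[of t] t2 by simp
    finally have 1: "exp ((ln (real t) - \<kappa>) * real e) \<le> W * real t ^ D'" .
    have "real t ^ e = exp (ln (real t) * real e)"
      using t2 by (simp add: powr_realpow[symmetric] powr_def mult.commute)
    also have "\<dots> = exp ((ln (real t) - \<kappa>) * real e) * exp (\<kappa> * real e)"
      by (simp add: mult_exp_exp algebra_simps)
    also have "\<dots> \<le> W * real t ^ D' * exp (\<kappa> * real e)" using 1 by (intro mult_right_mono) auto
    also have "\<dots> = (W * exp (\<kappa> * real e)) * real t ^ D'" by simp
    also have "\<dots> < real t * real t ^ D'" using t1 t2 by (intro mult_strict_right_mono) auto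
    also have "\<dots> = real t ^ (D' + 1)" by simp
    also have "\<dots> \<le> real t ^ e" using eD t2 by (intro power_increasing) auto
    finally show False by simp
  qed
  with D'Dn show ?thesis by (simp add: e_def)
qed

text \<open>If the last coordinate of the n-th iterate were constant, it would equal its value at
  the origin, which lies in k; but some orbit has its last coordinate outside k at all
  times.\<close>

lemma Dn_ge_1:
  assumes "d N \<ge> 1"
  shows "Dn n \<ge> 1"
proof (rule ccontr)
  assume "\<not> Dn n \<ge> 1"
  then have D0: "Dn n = 0" by simp
  have "mp_vars (aff_iter n N) = {}"
  proof -
    have "keys m = {}" if "m \<in> keys (aff_iter n N)" for m
    proof -
      have "tdeg m = 0" using Dn_ge[OF N_mem that] D0 by simp
      then have "lookup m l = 0" for l using lookup_le_tdeg[of m l] by simp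
      then show ?thesis by (metis equals0I in_keys_iff)
    qed
    then show ?thesis by (auto simp: mp_vars_def)
  qed
  then have const: "mp_eval (aff_iter n N) x = mp_eval (aff_iter n N) x'" for x x'
    by (intro mp_eval_cong) simp
  interpret k: complex_subfield_loc k by (rule k_loc)
  obtain y where "orb n (pt y) N \<notin> k" using last_coordinate[OF assms nf order_refl] by blast
  moreover have "orb n (pt y) N = orb n (\<lambda>_. 0) N"
    using const[of "pt y" "\<lambda>_. 0"] mp_eval_aff_iter[OF N_mem] by simp
  moreover have "orb n (\<lambda>_. 0) N \<in> k" by (rule orb_mem[OF k_loc order_refl _ N_mem]) (use k.zero_mem in auto)
  ultimately show False by simp
qed

end

section \<open>Countability of the algebraic closure\<close>

lemma countable_number_field:
  assumes "number_field L"
  shows "countable L"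
proof -
  obtain n \<beta> \<gamma> c0 where "integral_family n \<beta> \<gamma> c0" and sp: "spans n \<beta> L"
    using number_field_integral_family[OF assms] by metis
  let ?g = "\<lambda>l :: rat list. \<Sum>i<n. of_rat (l ! i) * \<beta> i"
  have "L \<subseteq> range ?g"
  proof
    fix x assume "x \<in> L"
    then obtain u :: "nat \<Rightarrow> rat" where "x = (\<Sum>i<n. of_rat (u i) * \<beta> i)" using sp unfolding spans_def by blast
    then have "x = ?g (map u [0..<n])" by simp
    then show "x \<in> range ?g" by blast
  qed
  then show ?thesis by (rule countable_subset) simp
qed

lemma countable_alg_closure:
  assumes "number_field k"
  shows "countable (alg_closure_of k)"
proof -
  let ?P = "Poly ` lists k - {0}"
  have "countable ?P" using countable_number_field[OF assms] by (intro countable_Diff countable_image countable_lists)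
  then have "countable (\<Union>p\<in>?P. {z. poly p z = 0})"
    by (rule countable_UN) (auto intro!: countable_finite poly_roots_finite)
  moreover have "alg_closure_of k \<subseteq> (\<Union>p\<in>?P. {z. poly p z = 0})"
  proof
    fix z assume "z \<in> alg_closure_of k"
    then obtain p where p: "p \<noteq> 0" "\<forall>i. coeff p i \<in> k" "poly p z = 0" by (auto simp: alg_closure_of_def)
    have "coeffs p \<in> lists k" using p(2) by (auto simp: coeffs_def)
    then have "p \<in> Poly ` lists k" by (metis Poly_coeffs image_eqI)
    with p show "z \<in> (\<Union>p\<in>?P. {z. poly p z = 0})" by blast
  qed
  ultimately show ?thesis by (rule countable_subset[rotated])
qed

lemma countable_poly_mappings:
  fixes A :: "'a set" and C :: "'b::comm_monoid_add set"
  assumes "countable A" "countable C"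
  shows "countable {p :: 'a \<Rightarrow>\<^sub>0 'b. keys p \<subseteq> A \<and> lookup p ` keys p \<subseteq> C}"
proof -
  let ?g = "\<lambda>l. sum_list (map (\<lambda>(m, c). Poly_Mapping.single m c) l) :: 'a \<Rightarrow>\<^sub>0 'b"
  have "{p :: 'a \<Rightarrow>\<^sub>0 'b. keys p \<subseteq> A \<and> lookup p ` keys p \<subseteq> C} \<subseteq> ?g ` lists (A \<times> C)"
  proof
    fix p :: "'a \<Rightarrow>\<^sub>0 'b" assume "p \<in> {p. keys p \<subseteq> A \<and> lookup p ` keys p \<subseteq> C}"
    then have p: "keys p \<subseteq> A" "lookup p ` keys p \<subseteq> C" by (simp_all only: mem_Collect_eq)
    obtain l where l: "set l = keys p" "distinct l" 
      using finite_distinct_list[OF finite_keys[of p]] by (elim exE conjE)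
    have "?g (map (\<lambda>m. (m, lookup p m)) l) = sum_list (map (\<lambda>m. Poly_Mapping.single m (lookup p m)) l)"
      by (simp add: comp_def)
    also have "\<dots> = (\<Sum>m\<in>keys p. Poly_Mapping.single m (lookup p m))"
      using l by (simp add: sum_list_distinct_conv_sum_set)
    also have "\<dots> = p" by (rule mp_sum_singles[symmetric])
    finally have "p = ?g (map (\<lambda>m. (m, lookup p m)) l)" by (rule sym)
    moreover have "map (\<lambda>m. (m, lookup p m)) l \<in> lists (A \<times> C)" using p l(1) by (force simp: lists_eq_set)
    ultimately show "p \<in> ?g ` lists (A \<times> C)" by (rule image_eqI)
  qed
  then show ?thesis
    by (rule countable_subset) (intro countable_image countable_lists countable_SIGMA assms)
qed

lemma countable_mp_over:
  assumes "countable K"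
  shows "countable {p. mp_over K p}"
proof -
  have "{p :: nat \<Rightarrow>\<^sub>0 nat. keys p \<subseteq> UNIV \<and> lookup p ` keys p \<subseteq> UNIV} = UNIV" by simp
  then have "countable (UNIV :: (nat \<Rightarrow>\<^sub>0 nat) set)"
    using countable_poly_mappings[of "UNIV :: nat set" "UNIV :: nat set"] by simp
  from countable_poly_mappings[OF this assms]
  show ?thesis by (rule countable_subset[rotated]) (auto simp: mp_over_def)
qed

section \<open>Dehomogenization\<close>

definition dehomogenize :: "mpoly \<Rightarrow> mpoly" where
  "dehomogenize p = mp_subst p (\<lambda>i. if i = 0 then 1 else mp_var i)"

lemma mp_eval_dehomogenize: "mp_eval (dehomogenize p) x = mp_eval p (x(0 := 1))"
proof -
  have "mp_eval 1 x = 1" by (simp add: mp_eval_def mp_eval_hom.ins_1)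
  then have "(\<lambda>i. mp_eval (if i = 0 then 1 else mp_var i) x) = x(0 := 1)"
    by (auto simp: mp_eval_var)
  then show ?thesis by (simp add: dehomogenize_def mp_eval_subst)
qed

lemma mp_vars_dehomogenize: "mp_vars p \<subseteq> {..N} \<Longrightarrow> mp_vars (dehomogenize p) \<subseteq> {1..N}"
  unfolding dehomogenize_def by (rule mp_vars_subst) (auto simp: mp_vars_def mp_var_def)

lemma mp_over_dehomogenize:
  assumes "complex_subfield_loc K" "mp_over K p"
  shows "mp_over K (dehomogenize p)"
proof -
  interpret complex_subfield_loc K by (rule assms(1))
  have "mp_subst p (\<lambda>i. if i = 0 then 1 else mp_var i) \<in> {r. mp_over K r}"
    unfolding mp_subst_def
    by (rule mp_insertion_closed)
      (use assms(2) in \<open>auto simp: mp_over_add[OF assms(1)] mp_over_mult[OF assms(1)], auto simp: mp_over_def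
        mp_const_def mp_var_def lookup_single lookup_one when_def zero_mem one_mem\<close>)
  then show ?thesis by (simp add: dehomogenize_def)
qed

text \<open>Homogeneity is essential, as x_0 - 1 dehomogenizes to 0. It allows a point with nonzero
  coordinates at which p does not vanish to be rescaled to x_0 = 1.\<close>

lemma dehomogenize_nonzero:
  assumes "mp_homogeneous e p" "p \<noteq> 0"
  shows "dehomogenize p \<noteq> 0"
proof
  assume 0: "dehomogenize p = 0"
  have "infinite (UNIV - {0 :: complex})" by (simp add: infinite_UNIV_char_0)
  from mp_nonzero_value[OF this assms(2)] obtain y where y: "\<forall>i. y i \<noteq> 0" "mp_eval p y \<noteq> 0" by auto
  have "(\<lambda>i. y 0 * ((\<lambda>i. y i / y 0)(0 := 1)) i) = y" using y(1) by auto
  then have "mp_eval p y = y 0 ^ e * mp_eval p ((\<lambda>i. y i / y 0)(0 := 1))"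
    using mp_eval_homogeneous[OF assms(1), of "y 0" "(\<lambda>i. y i / y 0)(0 := 1)"] by simp
  also have "\<dots> = 0" using mp_eval_dehomogenize[of p "\<lambda>i. y i / y 0"] 0 by simp
  finally show False using y(2) by simp
qed

section \<open>The rational map\<close>

locale triangular_rational_map = triangular_map k N f for k N f +
  fixes F :: "nat \<Rightarrow> mpoly"
  assumes affine: "\<And>x. x \<in> affine_space N K \<Longrightarrow> rat_app K F (aff_pt K x) = aff_pt K (step x)"
    and F_vars: "\<And>i. i \<le> N \<Longrightarrow> mp_vars (F i) \<subseteq> {..N}"
begin

lemma rat_app_iterate:
  assumes "x \<in> affine_space N K"
  shows "(rat_app K F ^^ n) (aff_pt K x) = aff_pt K (orb n x)"
proof (induction n)
  case (Suc n)
  then show ?case using affine[OF orb_affine[OF K_loc k_subset_K assms, of n]] by (simp add: orb_Suc)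
qed simp

lemma aff_pt_in_proj_space:
  assumes "x \<in> affine_space N K"
  shows "aff_pt K x \<in> proj_space N K"
  unfolding aff_pt_def proj_space_def
  by (rule imageI) (use assms complex_subfield_loc.one_mem[OF K_loc] in \<open>auto simp: affine_space_def intro: exI[of _ 0]\<close>)

text \<open>A common factor in the iterated substitution only contributes to the scalar c at a given
  point. The coordinates of y lie in K because the map is given on points over K.\<close>

lemma unreduced_iterate_eval:
  assumes "\<And>i. y i \<in> K" "y 0 \<noteq> 0"
  shows "\<exists>c. c \<in> K \<and> c \<noteq> 0 \<and> (\<forall>i. mp_eval (unreduced_iterate N F n i) y =
    c * ((orb n (\<lambda>i. if i \<in> {1..N} then y i / y 0 else 0))(0 := 1)) i)"
proof -
  interpret K: complex_subfield_loc K by (rule K_loc)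
  define x where "x = (\<lambda>i. if i \<in> {1..N} then y i / y 0 else 0)"
  have x: "x \<in> affine_space N K" using assms by (auto simp: x_def affine_space_def K.divide_mem)
  have "\<exists>c. c \<in> K \<and> c \<noteq> 0 \<and> (\<forall>i. mp_eval (unreduced_iterate N F n i) y = c * ((orb n x)(0 := 1)) i)"
  proof (induction n)
    case 0
    have "mp_eval (unreduced_iterate N F 0 i) y = y 0 * ((orb 0 x)(0 := 1)) i" for i
      using assms(2) by (auto simp: x_def mp_eval_var)
    then show ?case using assms by blast
  next
    case (Suc n)
    then obtain c where c: "c \<in> K" "c \<noteq> 0"
      "\<And>i. mp_eval (unreduced_iterate N F n i) y = c * ((orb n x)(0 := 1)) i" by blast
    define z where "z = (\<lambda>i. mp_eval (unreduced_iterate N F n i) y)"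
    have "z \<in> aff_pt K (orb n x)" unfolding aff_pt_def proj_pt_def z_def using c by auto
    moreover have "(\<lambda>i. mp_eval (F i) z) \<in> proj_pt K (\<lambda>i. mp_eval (F i) z)"
      unfolding proj_pt_def using K.one_mem by (auto intro!: exI[of _ 1])
    ultimately have "(\<lambda>i. mp_eval (F i) z) \<in> rat_app K F (aff_pt K (orb n x))"
      unfolding rat_app_def by blast
    also have "\<dots> = aff_pt K (orb (Suc n) x)"
      using affine[OF orb_affine[OF K_loc k_subset_K x, of n]] by (simp add: orb_Suc)
    finally obtain c' where c': "c' \<in> K" "c' \<noteq> 0" "(\<lambda>i. mp_eval (F i) z) = (\<lambda>i. c' * ((orb (Suc n) x)(0 := 1)) i)"
      unfolding aff_pt_def proj_pt_def by blast
    have "mp_eval (unreduced_iterate N F (Suc n) i) y = c' * ((orb (Suc n) x)(0 := 1)) i" for i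
      using fun_cong[OF c'(3), of i] by (simp add: mp_eval_subst z_def)
    with c' show ?case by blast
  qed
  then show ?thesis by (simp add: x_def)
qed

text \<open>Test values for polynomial identities: infinitely many, nonzero so that x_0 can be
  divided out, and inside K.\<close>

definition pos_nats :: "complex set" where "pos_nats = of_nat ` {1..}"

lemma pos_nats: "infinite pos_nats" "0 \<notin> pos_nats" "pos_nats \<subseteq> K"
proof -
  have "inj_on complex_of_nat {1..}" by (auto simp: inj_on_def)
  then show "infinite pos_nats" unfolding pos_nats_def by (simp add: finite_image_iff infinite_Ici)
  show "0 \<notin> pos_nats" by (auto simp: pos_nats_def)
  show "pos_nats \<subseteq> K" using complex_subfield_loc.of_nat_mem[OF K_loc] by (auto simp: pos_nats_def)
qed

lemma iterate_degree_eq: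
  assumes "Dn n \<ge> 1"
  shows "iterate_degree N F n = Dn n"
proof -
  obtain i0 m0 where at: "i0 \<in> {1..N}" "m0 \<in> keys (aff_iter n i0)" "tdeg m0 = Dn n" using Dn_attained[OF assms] .
  show ?thesis
  proof (rule iterate_degree_eqI[where A = "aff_iter n" and X = pos_nats and ?i0.0 = i0 and ?m0.0 = m0])
    show "mp_vars (aff_iter n i) \<subseteq> {1..N}" if "i \<in> {1..N}" for i by (rule mp_vars_aff_iter[OF that])
    show "tdeg m \<le> Dn n" if "i \<in> {1..N}" "m \<in> keys (aff_iter n i)" for i m by (rule Dn_ge[OF that])
  next
    fix y :: "nat \<Rightarrow> complex" assume y: "\<forall>i. y i \<in> pos_nats"
    have yK: "y i \<in> K" for i using y pos_nats(3) by blast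
    have y0: "y 0 \<noteq> 0" using y pos_nats(2) by metis
    define x where "x = (\<lambda>i. if i \<in> {1..N} then y i / y 0 else 0)"
    obtain c where c: "c \<noteq> 0" "\<And>i. mp_eval (unreduced_iterate N F n i) y = c * ((orb n x)(0 := 1)) i"
      using unreduced_iterate_eval[of y n] yK y0 unfolding x_def by blast
    have "mp_eval (aff_iter n i) (\<lambda>i. y i / y 0) = orb n x i" if i: "i \<in> {1..N}" for i
      unfolding mp_eval_aff_iter[OF i] by (rule orb_tail[of 1]) (use i in \<open>auto simp: x_def\<close>)
    then show "\<exists>c. c \<noteq> 0 \<and> mp_eval (unreduced_iterate N F n 0) y = c \<and>
      (\<forall>i\<in>{1..N}. mp_eval (unreduced_iterate N F n i) y = c * mp_eval (aff_iter n i) (\<lambda>i. y i / y 0))"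
      using c by (intro exI[of _ c]) auto
  qed (fact at pos_nats)+
qed

text \<open>Were f_N a constant c, the image would lie in the hyperplane x_N = c x_0, against
  dominance.\<close>

lemma last_degree_pos:
  assumes dom: "dominant N K F"
  shows "d N \<ge> 1"
proof (rule ccontr)
  interpret K: complex_subfield_loc K by (rule K_loc)
  assume "\<not> d N \<ge> 1"
  then have d0: "d N = 0" by simp
  define c where "c = last_coeff 0"
  have cK: "c \<in> K" using last_coeff_mem k_subset_K by (auto simp: c_def)
  have fN: "orb (Suc n) x N = c" for n x unfolding orb_last d0 by (simp add: c_def)
  \<comment> \<open>An identity of polynomials is needed, since dominance also takes points outside
    the affine space into account.\<close>
  have "F N - mp_const c * F 0 = 0"
  proof (rule ccontr)
    assume "F N - mp_const c * F 0 \<noteq> 0"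
    then obtain y where y: "\<forall>i. y i \<in> pos_nats" "mp_eval (F N - mp_const c * F 0) y \<noteq> 0"
      using mp_nonzero_value[OF pos_nats(1)] by blast
    have yK: "y i \<in> K" for i using y pos_nats(3) by blast
    have y0: "y 0 \<noteq> 0" using y pos_nats(2) by metis
    define x where "x = (\<lambda>i. if i \<in> {1..N} then y i / y 0 else 0)"
    obtain a where a: "\<And>i. mp_eval (unreduced_iterate N F 1 i) y = a * ((orb 1 x)(0 := 1)) i"
      using unreduced_iterate_eval[of y 1] yK y0 unfolding x_def by blast
    have U: "mp_eval (unreduced_iterate N F 1 i) y = mp_eval (F i) y" if "i \<le> N" for i
    proof -
      have "mp_eval (F i) (\<lambda>l. mp_eval (unreduced_iterate N F 0 l) y) = mp_eval (F i) y"
        by (rule mp_eval_cong) (use F_vars[OF that] in \<open>auto simp: mp_eval_var\<close>)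
      then show ?thesis by (simp add: mp_eval_subst)
    qed
    have "mp_eval (F 0) y = a" using a[of 0] U[of 0] by simp
    moreover have "mp_eval (F N) y = a * c" using a[of N] U[of N] fN[of 0 x] N1 by simp
    ultimately show False using y(2) by (simp add: mp_eval_diff mp_eval_mult mp_eval_const)
  qed
  then have FN: "mp_eval (F N) z = c * mp_eval (F 0) z" for z
    by (metis eq_iff_diff_eq_0 mp_eval_const mp_eval_mult)
  define r :: mpoly where "r = Poly_Mapping.single (Poly_Mapping.single N 1) 1 + Poly_Mapping.single (Poly_Mapping.single 0 1) (- c)"
  have r_eval: "mp_eval r z = z N - c * z 0" for z
    by (simp add: r_def mp_eval_add mp_eval_single mon_eval_single)
  define Z where "Z = {P \<in> proj_space N K. \<forall>p\<in>{r}. \<forall>x\<in>P. mp_eval p x = 0}"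
  have r_keys: "keys r \<subseteq> {Poly_Mapping.single N 1, Poly_Mapping.single 0 1}"
    unfolding r_def using keys_add by (rule order_trans) auto
  have "zariski_closed N K Z"
    unfolding zariski_closed_def Z_def
  proof (rule exI[of _ "{r}"], intro conjI ballI refl)
    fix p assume "p \<in> {r}"
    then have p: "p = r" by simp
    show "mp_over K p" unfolding p r_def
      by (intro mp_over_add[OF K_loc]) (auto simp: mp_over_def lookup_single when_def K.zero_mem K.one_mem K.uminus_mem cK)
    show "mp_vars p \<subseteq> {..N}" unfolding p mp_vars_def using r_keys by fastforce
    show "\<exists>e. mp_homogeneous e p" unfolding p mp_homogeneous_iff_tdeg using r_keys by (intro exI[of _ 1]) fastforce
  qed
  moreover have "rat_app K F ` (proj_space N K - indeterminacy_locus N K F) \<subseteq> Z"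
  proof
    fix Q assume Q: "Q \<in> rat_app K F ` (proj_space N K - indeterminacy_locus N K F)"
    then have "Q \<in> proj_space N K" using dom by (auto simp: dominant_def zariski_dense_def)
    moreover have "mp_eval r z = 0" if "z \<in> Q" for z
    proof -
      from Q that obtain w b where "z = (\<lambda>i. b * mp_eval (F i) w)" by (auto simp: rat_app_def proj_pt_def)
      then show ?thesis using FN[of w] by (simp add: r_eval)
    qed
    ultimately show "Q \<in> Z" by (simp add: Z_def)
  qed
  ultimately have "Z = proj_space N K" using dom unfolding dominant_def zariski_dense_def by blast
  moreover define x where "x = pt (c + 1)"
  have xa: "x \<in> affine_space N K" unfolding x_def by (intro pt_affine K.add_mem cK K.one_mem)
  ultimately have "aff_pt K x \<in> Z" using aff_pt_in_proj_space by simp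
  moreover have "x(0 := 1) \<in> aff_pt K x"
    unfolding aff_pt_def proj_pt_def using K.one_mem by (auto intro!: exI[of _ 1])
  ultimately have "mp_eval r (x(0 := 1)) = 0" by (auto simp: Z_def)
  then show False using N1 by (simp add: r_eval x_def pt_def)
qed

text \<open>For d_j = 1 no growth is required, as the truncated height is at least 1. For the same
  reason the bounded ambiguity C of a Weil height is harmless: C \<le> C u n.\<close>

lemma arithmetic_degree:
  assumes x: "x \<in> affine_space N K" and h: "hyperplane_weil_height N K h"
    and j: "j \<in> {1..N}" "d j \<ge> 1" "\<And>i. i \<in> {1..N} \<Longrightarrow> d i \<le> d j"
    and grow: "d j \<ge> 2 \<longrightarrow> (\<exists>\<mu>>0. \<forall>n. cmod (orb n x j) \<ge> exp (\<mu> * real (d j) ^ n))"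
  shows "has_arithmetic_degree K h F (aff_pt K x) (real (d j))"
proof -
  have Xf: "finite (x ` {1..N})" and XK: "x ` {1..N} \<subseteq> K" using finite_coords[OF x] by auto
  obtain L where L: "number_field L" "k \<subseteq> L" "x ` {1..N} \<subseteq> L" by (rule enlarge[OF nf order_refl Xf XK])
  obtain C0 where C0: "\<And>P. P \<in> proj_space N K \<Longrightarrow> \<bar>h P - standard_height N P\<bar> \<le> C0"
    using h unfolding hyperplane_weil_height_def by blast
  define C where "C = \<bar>C0\<bar>"
  have C: "\<bar>h (aff_pt K (orb n x)) - standard_height N (aff_pt K (orb n x))\<bar> \<le> C" for n
    using C0[OF aff_pt_in_proj_space[OF orb_affine[OF K_loc k_subset_K x, of n]]] by (simp add: C_def)
  have C_nn: "C \<ge> 0" by (simp add: C_def)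
  define u where "u n = max (h (aff_pt K (orb n x))) 1" for n
  define \<delta> where "\<delta> = real (d j)"
  have \<delta>1: "\<delta> \<ge> 1" using j(2) by (simp add: \<delta>_def)
  have "\<exists>c>0. \<forall>n. u n \<ge> c * \<delta> ^ n"
  proof (cases "d j \<ge> 2")
    case False
    then have "\<delta> = 1" using j(2) by (simp add: \<delta>_def)
    then show ?thesis by (intro exI[of _ 1]) (simp add: u_def)
  next
    case True
    then obtain \<mu> where \<mu>: "\<mu> > 0" "\<And>n. cmod (orb n x j) \<ge> exp (\<mu> * \<delta> ^ n)" using grow unfolding \<delta>_def by blast
    obtain n0 :: nat where n0: "n0 > 0" "\<And>m i. i \<in> {1..N} \<Longrightarrow> cmod (orb m x i) \<ge> 1 \<Longrightarrow>
        standard_height N (aff_pt K (orb m x)) \<ge> ln (cmod (orb m x i)) / real n0"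
      using orbit_height_lower[OF L] by blast
    define a where "a = \<mu> / real n0"
    have a: "a > 0" using \<mu>(1) n0(1) by (simp add: a_def)
    have "u n \<ge> a / (1 + C) * \<delta> ^ n" for n
    proof -
      have e1: "1 \<le> exp (\<mu> * \<delta> ^ n)" using \<mu>(1) \<delta>1 by simp
      have g1: "1 \<le> cmod (orb n x j)" using e1 \<mu>(2)[of n] by linarith
      have "ln (exp (\<mu> * \<delta> ^ n)) \<le> ln (cmod (orb n x j))"
        using \<mu>(2)[of n] g1 by (subst ln_le_cancel_iff) auto
      then have "\<mu> * \<delta> ^ n / real n0 \<le> ln (cmod (orb n x j)) / real n0" using n0(1) by (intro divide_right_mono) auto
      also have "\<dots> \<le> standard_height N (aff_pt K (orb n x))" by (rule n0(2)[OF j(1) g1])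
      finally have "a * \<delta> ^ n \<le> standard_height N (aff_pt K (orb n x))" by (simp add: a_def)
      then have "a * \<delta> ^ n \<le> u n + C * 1" using C[of n] by (simp add: u_def)
      also have "\<dots> \<le> u n + C * u n" using C_nn by (intro add_left_mono mult_left_mono) (auto simp: u_def)
      finally have "a * \<delta> ^ n \<le> (1 + C) * u n" by (simp add: algebra_simps)
      then show ?thesis using C_nn by (simp add: pos_divide_le_eq mult.commute)
    qed
    then show ?thesis using a C_nn by (intro exI[of _ "a / (1 + C)"]) auto
  qed
  then obtain c where c: "c > 0" "\<And>n. u n \<ge> c * \<delta> ^ n" by blast
  have "(\<lambda>n. u n powr (1 / real n)) \<longlonglongrightarrow> \<delta>"
  proof (rule nth_root_squeeze[OF \<delta>1 c])
    fix \<rho> :: real assume \<rho>: "\<rho> > \<delta>"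
    have \<rho>1: "\<rho> > 1" using \<rho> \<delta>1 by linarith
    have dr: "real (d i) < \<rho>" if "i \<in> {1..N}" for i
    proof -
      have "real (d i) \<le> \<delta>" using j(3)[OF that] by (simp add: \<delta>_def)
      then show ?thesis using \<rho> by linarith
    qed
    obtain C1 where C1: "\<And>m. standard_height N (aff_pt K (orb m x)) \<le> C1 * \<rho> ^ m"
      using orbit_height_upper[OF L \<rho>1 dr] by blast
    have "u n \<le> (\<bar>C1\<bar> + C + 1) * \<rho> ^ n" for n
    proof -
      have r1: "1 \<le> \<rho> ^ n" using \<rho>1 by simp
      have "C1 * \<rho> ^ n \<le> \<bar>C1\<bar> * \<rho> ^ n" using r1 by (intro mult_right_mono) auto
      moreover have "C * 1 \<le> C * \<rho> ^ n" using C_nn r1 by (intro mult_left_mono) auto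
      moreover have "0 \<le> \<bar>C1\<bar> * \<rho> ^ n" using r1 by simp
      moreover have "(\<bar>C1\<bar> + C + 1) * \<rho> ^ n = \<bar>C1\<bar> * \<rho> ^ n + C * \<rho> ^ n + \<rho> ^ n" by (simp add: algebra_simps)
      ultimately show ?thesis using C[of n] C1[of n] r1 C_nn unfolding u_def by linarith
    qed
    then show "\<exists>C. \<forall>n. u n \<le> C * \<rho> ^ n" by blast
  qed
  then show ?thesis unfolding has_arithmetic_degree_def rat_app_iterate[OF x] u_def \<delta>_def .
qed

lemma dynamical_degree_eq:
  assumes j: "j \<in> {1..N}" "d j \<ge> 1" "\<And>i. i \<in> {1..N} \<Longrightarrow> d i \<le> d j" and low: "\<And>n. d j ^ n \<le> Dn n"
  shows "dynamical_degree N F = real (d j)"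
proof -
  have D1: "Dn n \<ge> 1" for n
  proof -
    have "1 \<le> d j ^ n" using j(2) by simp
    then show ?thesis using low[of n] by linarith
  qed
  have "(\<lambda>n. real (Dn n) powr (1 / real n)) \<longlonglongrightarrow> real (d j)"
  proof (rule nth_root_squeeze[where c = 1])
    show "1 * real (d j) ^ n \<le> real (Dn n)" for n
      using low[of n] by (metis mult_1 of_nat_le_iff of_nat_power)
    fix \<rho> :: real assume \<rho>: "\<rho> > real (d j)"
    have \<rho>1: "\<rho> > 1" using \<rho> j(2) by linarith
    have dr: "real (d i) < \<rho>" if "i \<in> {1..N}" for i
    proof -
      have "real (d i) \<le> real (d j)" using j(3)[OF that] by simp
      then show ?thesis using \<rho> by linarith
    qed
    show "\<exists>C. \<forall>n. real (Dn n) \<le> C * \<rho> ^ n" by (rule Dn_upper[OF \<rho>1 dr])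
  qed (use j(2) in auto)
  then show ?thesis unfolding dynamical_degree_def iterate_degree_eq[OF D1] by (rule limI)
qed

end

section \<open>Generic points and lower bounds for the degrees\<close>

context triangular_map
begin

lemma generic_point_decreasing:
  assumes dec: "\<And>i. i \<in> {1..<N} \<Longrightarrow> d (i + 1) < d i" and dN: "d N \<ge> 1"
    and q: "q \<noteq> 0" "mp_over K q" "mp_vars q \<subseteq> {1..N}" and L: "number_field L" "k \<subseteq> L"
  shows "\<exists>x\<in>affine_space N K. mp_eval q x \<noteq> 0 \<and> (\<forall>n. orb n x N \<notin> L) \<and>
    (d 1 \<ge> 2 \<longrightarrow> (\<exists>\<mu>>0. \<forall>n. cmod (orb n x 1) \<ge> exp (\<mu> * real (d 1) ^ n)))"
proof -
  obtain x where x: "x \<in> affine_space N K" "\<forall>n. orb n x N \<notin> L" "\<forall>n. mp_eval q (orb n x) \<noteq> 0"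
    "d 1 \<ge> 2 \<longrightarrow> (\<exists>\<mu>>0. \<forall>n. cmod (orb n x 1) \<ge> exp (\<mu> * real (d 1) ^ n))"
    using good_point[OF N1 order_refl dec dN q L] by blast
  have "mp_eval q x \<noteq> 0" using x(3)[rule_format, of 0] by simp
  with x show ?thesis by blast
qed

text \<open>Growth and avoidance are properties of the last coordinate; x_1 only has to make q
  nonzero at the starting point itself, which excludes finitely many values.\<close>

lemma generic_point_two:
  assumes N2: "N = 2" and dN: "d N \<ge> 1"
    and q: "q \<noteq> 0" "mp_over K q" "mp_vars q \<subseteq> {1..N}" and L: "number_field L" "k \<subseteq> L"
  shows "\<exists>x\<in>affine_space N K. mp_eval q x \<noteq> 0 \<and> (\<forall>n. orb n x N \<notin> L) \<and>
    (d N \<ge> 2 \<longrightarrow> (\<exists>\<mu>>0. \<forall>n. cmod (orb n x N) \<ge> exp (\<mu> * real (d N) ^ n)))"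
proof -
  interpret K: complex_subfield_loc K by (rule K_loc)
  define e where "e = mp_degree_in 1 q"
  let ?qe = "mp_coeff_in 1 e q"
  have nz: "?qe \<noteq> 0" unfolding e_def by (rule mp_coeff_in_degree_nonzero[OF q(1)])
  have ov: "mp_over K ?qe" by (rule mp_over_coeff_in[OF q(2) K.zero_mem])
  have "{1..N} - {1} = {N..N}" using N2 by auto
  then have vv: "mp_vars ?qe \<subseteq> {N..N}" using mp_vars_coeff_in[of 1 e q] q(3) by blast
  obtain x where x: "x \<in> affine_space N K" "\<And>n. orb n x N \<notin> L" "\<And>n. mp_eval ?qe (orb n x) \<noteq> 0"
    "d N \<ge> 2 \<longrightarrow> (\<exists>\<mu>>0. \<forall>n. cmod (orb n x N) \<ge> exp (\<mu> * real (d N) ^ n))"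
    using good_point_last[OF dN nz ov vv L] by blast
  define b where "b s = mp_eval (mp_coeff_in 1 s q) x" for s
  have be: "b e \<noteq> 0" using x(3)[of 0] by (simp add: b_def)
  have "finite {z. (\<Sum>s\<le>e. b s * z ^ s) = 0}" by (rule polyfun_roots_finite[of b e e]) (use be in auto)
  moreover have "infinite (range complex_of_nat)" by (intro range_inj_infinite) (simp add: inj_def)
  ultimately obtain z where z: "z \<in> range complex_of_nat" "(\<Sum>s\<le>e. b s * z ^ s) \<noteq> 0"
    by (metis (mono_tags, lifting) finite_subset mem_Collect_eq subsetI)
  define x' where "x' = x(1 := z)"
  have zK: "z \<in> K" using z(1) K.of_nat_mem by auto
  have x': "x' \<in> affine_space N K" using x(1) zK N1 by (auto simp: x'_def affine_space_def)
  have same: "orb n x' N = orb n x N" for n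
    by (rule orb_tail[of 2]) (use N2 in \<open>auto simp: x'_def\<close>)
  have "mp_eval q x' \<noteq> 0"
  proof -
    have "mp_eval (mp_coeff_in 1 s q) x' = b s" for s
      unfolding b_def x'_def by (rule mp_eval_cong) (use mp_vars_coeff_in[of 1 s q] in auto)
    moreover have "x' 1 = z" by (simp add: x'_def)
    ultimately have "mp_eval q x' = (\<Sum>s\<le>e. b s * z ^ s)"
      using mp_eval_coeff_in[of 1 q e x'] by (simp add: e_def)
    then show ?thesis using z(2) by simp
  qed
  then show ?thesis using x(2,4) by (intro bexI[OF _ x']) (simp add: same)
qed

lemma Dn_lower_last:
  assumes "d N \<ge> 1"
  shows "d N ^ n \<le> Dn n"
proof (cases "d N \<ge> 2")
  case True
  interpret K: complex_subfield_loc K by (rule K_loc)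
  have "(\<lambda>_. 0) \<in> affine_space N K" by (simp add: affine_space_def K.zero_mem)
  then show ?thesis
    by (rule Dn_lower[OF _ N_mem True]) (use last_lead_nonzero[OF assms] in \<open>auto simp: last_coeff_eq\<close>)
next
  case False
  then have "d N = 1" using assms by simp
  then show ?thesis using Dn_ge_1[OF assms] by simp
qed

text \<open>A tail from x_2 on keeps the leading coefficient of f_1 nonzero along its orbit, and
  growth in x_1 gives the degree. For N = 1 there is no tail, so that case is separate.\<close>

lemma Dn_lower_decreasing:
  assumes dec: "\<And>i. i \<in> {1..<N} \<Longrightarrow> d (i + 1) < d i" and dN: "d N \<ge> 1"
  shows "d 1 ^ n \<le> Dn n"
proof (cases "N = 1")
  case True
  then show ?thesis using Dn_lower_last[OF dN] by simp
next
  case False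
  then have N2: "2 \<le> N" using N1 by simp
  have one: "1 \<in> {1..N}" using N1 by simp
  interpret K: complex_subfield_loc K by (rule K_loc)
  have dl: "d l < d 1" if "l \<in> {1<..N}" for l using strict_chain_less[of 1 N d l] dec that by auto
  have d1: "d 1 \<ge> 2" using dl[of N] N2 dN by simp
  have f1: "f 1 \<noteq> 0" using d1 by (auto simp: mp_degree_in_def)
  let ?a = "mp_coeff_in 1 (d 1) (f 1)"
  have nz: "?a \<noteq> 0" by (rule mp_coeff_in_degree_nonzero[OF f1])
  have ov: "mp_over K ?a"
    by (rule mp_over_coeff_in[OF mp_over_subset[OF over[OF one] k_subset_K] K.zero_mem])
  have vv: "mp_vars ?a \<subseteq> {2..N}" using mp_vars_coeff_in[of 1 "d 1" "f 1"] vars[OF one] by fastforce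
  have dec2: "d (i + 1) < d i" if "i \<in> {2..<N}" for i using dec that by simp
  obtain x where x: "x \<in> affine_space N K" "\<forall>n. mp_eval ?a (orb n x) \<noteq> 0"
    using good_point[OF N2 _ dec2 dN nz ov vv nf order_refl] by auto
  show ?thesis by (rule Dn_lower[OF x(1) one d1 dl]) (use x(2) in auto)
qed

end

context triangular_rational_map
begin

text \<open>Each choice carries a number field containing the coordinates of the new point and all
  earlier fields. As f is defined over k, whole earlier orbits remain in that field, so a single
  condition on the next point separates it from all of them.\<close>

lemma dense_disjoint_orbits:
  assumes h: "hyperplane_weil_height N K h"
    and j: "j \<in> {1..N}" "d j \<ge> 1" "\<And>i. i \<in> {1..N} \<Longrightarrow> d i \<le> d j" and low: "\<And>n. d j ^ n \<le> Dn n"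
    and gen: "\<And>q L. q \<noteq> 0 \<Longrightarrow> mp_over K q \<Longrightarrow> mp_vars q \<subseteq> {1..N} \<Longrightarrow> number_field L \<Longrightarrow> k \<subseteq> L \<Longrightarrow>
      \<exists>x\<in>affine_space N K. mp_eval q x \<noteq> 0 \<and> (\<forall>n. orb n x N \<notin> L) \<and>
        (d j \<ge> 2 \<longrightarrow> (\<exists>\<mu>>0. \<forall>n. cmod (orb n x j) \<ge> exp (\<mu> * real (d j) ^ n)))"
  shows "\<exists>S. S \<subseteq> {P \<in> aff_pt K ` affine_space N K. has_arithmetic_degree K h F P (dynamical_degree N F)} \<and>
    zariski_dense N K S \<and> pairwise (\<lambda>P Q. disjnt (forward_orbit K F P) (forward_orbit K F Q)) S"
proof -
  interpret K: complex_subfield_loc K by (rule K_loc)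
  define Ps where "Ps = {p. p \<noteq> 0 \<and> mp_over K p \<and> mp_vars p \<subseteq> {..N} \<and> (\<exists>e. mp_homogeneous e p)}"
  have cnt: "countable Ps"
    by (rule countable_subset[OF _ countable_mp_over[OF countable_alg_closure[OF nf]]]) (auto simp: Ps_def)
  \<comment> \<open>The enumeration by \<open>from_nat_into\<close> needs a nonempty set; x_0 is a
    member.\<close>
  have "mp_over K (mp_var 0)"
    by (simp add: mp_over_def mp_var_def lookup_single when_def K.zero_mem K.one_mem)
  moreover have "mp_vars (mp_var 0) \<subseteq> {..N}" by (simp add: mp_vars_def mp_var_def)
  moreover have "mp_homogeneous 1 (mp_var 0)" by (simp add: mp_homogeneous_iff_tdeg mp_var_def)
  ultimately have "mp_var 0 \<in> Ps" unfolding Ps_def using mp_var_nonzero by blast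
  then have ne: "Ps \<noteq> {}" by blast
  define q where "q = from_nat_into Ps"
  have q_mem: "q i \<in> Ps" for i unfolding q_def by (rule from_nat_into[OF ne])
  have q_surj: "\<exists>i. p = q i" if "p \<in> Ps" for p
    unfolding q_def using from_nat_into_surj[OF cnt that] by metis
  define good where "good i x \<longleftrightarrow> x \<in> affine_space N K \<and> mp_eval (q i) (x(0 := 1)) \<noteq> 0 \<and>
      (d j \<ge> 2 \<longrightarrow> (\<exists>\<mu>>0. \<forall>n. cmod (orb n x j) \<ge> exp (\<mu> * real (d j) ^ n)))" for i x
  have ex: "\<exists>x. good i x \<and> (\<forall>n. orb n x N \<notin> L)" if L: "number_field L" "k \<subseteq> L" for i L
  proof -
    from q_mem[of i] obtain e where qi: "q i \<noteq> 0" "mp_over K (q i)" "mp_vars (q i) \<subseteq> {..N}" "mp_homogeneous e (q i)"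
      unfolding Ps_def by blast
    from gen[OF dehomogenize_nonzero[OF qi(4,1)] mp_over_dehomogenize[OF K_loc qi(2)] mp_vars_dehomogenize[OF qi(3)] L]
    show ?thesis unfolding good_def mp_eval_dehomogenize by blast
  qed
  define stage where "stage i s \<longleftrightarrow> good i (fst s) \<and> number_field (snd s) \<and> k \<subseteq> snd s \<and> fst s ` {1..N} \<subseteq> snd s"
    for i and s :: "(nat \<Rightarrow> complex) \<times> complex set"
  have grow_field: "\<exists>s. stage i s \<and> L \<subseteq> snd s \<and> (\<forall>n. orb n (fst s) N \<notin> L)"
    if L: "number_field L" "k \<subseteq> L" for i L
  proof -
    obtain x where x: "good i x" "\<forall>n. orb n x N \<notin> L" using ex[OF L] by blast
    then have xa: "x \<in> affine_space N K" by (simp add: good_def)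
    obtain L' where L': "number_field L'" "L \<subseteq> L'" "k \<subseteq> L'" "x ` {1..N} \<subseteq> L'"
      by (rule enlarge[OF L finite_coords[OF xa]])
    show ?thesis by (rule exI[of _ "(x, L')"]) (use x L' in \<open>simp add: stage_def\<close>)
  qed
  have "\<exists>s. \<forall>i. stage i (s i) \<and> (snd (s i) \<subseteq> snd (s (Suc i)) \<and> (\<forall>n. orb n (fst (s (Suc i))) N \<notin> snd (s i)))"
  proof (rule dependent_nat_choice)
    show "\<exists>s. stage 0 s" using grow_field[OF nf order_refl] by blast
    fix s i assume "stage i s"
    then show "\<exists>t. stage (Suc i) t \<and> snd s \<subseteq> snd t \<and> (\<forall>n. orb n (fst t) N \<notin> snd s)"
      by (intro grow_field) (simp_all add: stage_def)
  qed
  then obtain s where s: "\<And>i. stage i (s i)" "\<And>i. snd (s i) \<subseteq> snd (s (Suc i))"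
    "\<And>i n. orb n (fst (s (Suc i))) N \<notin> snd (s i)" by blast
  define x where "x i = fst (s i)" for i
  have good: "good i (x i)" for i using s(1)[of i] by (simp add: stage_def x_def)
  have xa: "x i \<in> affine_space N K" for i using good[of i] by (simp add: good_def)
  have mono: "snd (s a) \<subseteq> snd (s b)" if "a \<le> b" for a b using s(2) that by (rule lift_Suc_mono_le)
  have in_L: "orb n (x a) N \<in> snd (s a)" for n a
    using s(1)[of a] orb_mem[OF number_field_locI _ _ N_mem, of "snd (s a)" "x a" n] by (simp add: stage_def x_def)
  have orbits: "orb n (x a) \<noteq> orb m (x b)" if "a < b" for a b n m
  proof -
    obtain b' where b': "b = Suc b'" using less_imp_Suc_add[OF \<open>a < b\<close>] by blast
    have "orb n (x a) N \<in> snd (s b')" using in_L[of n a] mono[of a b'] \<open>a < b\<close> b' by auto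
    moreover have "orb m (x b) N \<notin> snd (s b')" using s(3)[of m b'] by (simp add: x_def b')
    ultimately show ?thesis by auto
  qed
  define S where "S = range (\<lambda>i. aff_pt K (x i))"
  have fo: "forward_orbit K F (aff_pt K (x i)) = range (\<lambda>n. aff_pt K (orb n (x i)))" for i
    unfolding forward_orbit_def rat_app_iterate[OF xa] by auto
  \<comment> \<open>Affine points have coordinate 0 equal to 0, normalized homogeneous coordinates
    have it equal to 1; all other coordinates agree.\<close>
  have inj: "orb n (x a) = orb m (x b)" if "aff_pt K (orb n (x a)) = aff_pt K (orb m (x b))" for n m a b
  proof -
    have "(orb n (x a))(0 := 1) = (orb m (x b))(0 := 1)"
      using arg_cong[OF that, of normalized_coords] by (simp only: normalized_coords_aff_pt[OF K.one_mem])
    moreover have "orb n (x a) 0 = 0" "orb m (x b) 0 = 0"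
      using orb_affine[OF K_loc k_subset_K xa, of n a] orb_affine[OF K_loc k_subset_K xa, of m b]
      by (auto simp: affine_space_def)
    ultimately show ?thesis by (metis fun_upd_triv fun_upd_upd)
  qed
  have "pairwise (\<lambda>P Q. disjnt (forward_orbit K F P) (forward_orbit K F Q)) S"
  proof (rule pairwiseI)
    fix P Q assume "P \<in> S" "Q \<in> S" "P \<noteq> Q"
    then obtain a b where ab: "P = aff_pt K (x a)" "Q = aff_pt K (x b)" "a \<noteq> b" unfolding S_def by blast
    have "orb n (x a) \<noteq> orb m (x b)" for n m
    proof (cases "a < b")
      case False
      then have "b < a" using ab(3) by simp
      then show ?thesis using orbits[of b a m n] by auto
    qed (rule orbits)
    then have "aff_pt K (orb n (x a)) \<noteq> aff_pt K (orb m (x b))" for n m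
      using inj[of n a m b] by blast
    then show "disjnt (forward_orbit K F P) (forward_orbit K F Q)"
      unfolding disjnt_def ab(1,2) fo by auto
  qed
  moreover
  have dyn: "dynamical_degree N F = real (d j)"
    by (rule dynamical_degree_eq[OF j(1,2)]) (use j(3) low in auto)
  have "S \<subseteq> {P \<in> aff_pt K ` affine_space N K. has_arithmetic_degree K h F P (dynamical_degree N F)}"
  proof
    fix P assume "P \<in> S"
    then obtain i where i: "P = aff_pt K (x i)" unfolding S_def by blast
    have "has_arithmetic_degree K h F P (real (d j))"
      unfolding i by (rule arithmetic_degree[OF xa h j]) (use good[of i] in \<open>simp_all add: good_def\<close>)
    then show "P \<in> {P \<in> aff_pt K ` affine_space N K. has_arithmetic_degree K h F P (dynamical_degree N F)}"
      unfolding dyn using i xa by blast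
  qed
  moreover have "zariski_dense N K S"
    unfolding zariski_dense_def
  proof (intro conjI allI impI)
    show "S \<subseteq> proj_space N K" unfolding S_def using aff_pt_in_proj_space[OF xa] by blast
    fix Z assume Z: "zariski_closed N K Z \<and> S \<subseteq> Z"
    then obtain I where I: "\<forall>p\<in>I. mp_over K p \<and> mp_vars p \<subseteq> {..N} \<and> (\<exists>e. mp_homogeneous e p)"
      "Z = {P \<in> proj_space N K. \<forall>p\<in>I. \<forall>x\<in>P. mp_eval p x = 0}" unfolding zariski_closed_def by blast
    \<comment> \<open>A nonzero equation of Z would be some q i, but the i-th point was chosen off
      its zero set; hence Z has only trivial equations.\<close>
    have "p = 0" if p: "p \<in> I" for p
    proof (rule ccontr)
      assume "p \<noteq> 0"
      then have "p \<in> Ps" using I(1) p by (simp add: Ps_def)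
      then obtain i where i: "p = q i" using q_surj by blast
      have "aff_pt K (x i) \<in> Z" using Z by (auto simp: S_def)
      moreover have "(x i)(0 := 1) \<in> aff_pt K (x i)"
        unfolding aff_pt_def proj_pt_def using K.one_mem by (auto intro!: exI[of _ 1])
      ultimately have "mp_eval p ((x i)(0 := 1)) = 0" using p I(2) by blast
      then show False using good[of i] i by (simp add: good_def del: fun_upd_apply)
    qed
    then have "mp_eval p w = 0" if "p \<in> I" for p w using that by (metis mp_eval_0)
    then show "Z = proj_space N K" unfolding I(2) by simp
  qed
  ultimately show ?thesis by blast
qed

end

theorem theorem1p5:
  fixes k K :: "complex set" and N d :: nat and F f :: "nat \<Rightarrow> mpoly"
    and h :: "(nat \<Rightarrow> complex) set \<Rightarrow> real"
  assumes "number_field k" and "K = alg_closure_of k" and "N \<ge> 1"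
    and "hyperplane_weil_height N K h"
    and "rational_self_map N d F" and "\<forall>i\<le>N. mp_over k (F i)" and "dominant N K F"
    and "\<forall>i\<in>{1..N}. mp_over k (f i) \<and> mp_vars (f i) \<subseteq> {i..N}"
    and "\<forall>x\<in>affine_space N K.
           rat_app K F (aff_pt K x) =
           aff_pt K (\<lambda>i. if i \<in> {1..N} then mp_eval (f i) x else 0)"
    and "(\<forall>i\<in>{1..<N}. mp_degree_in i (f i) > mp_degree_in (i + 1) (f (i + 1))) \<or> N = 2"
  shows "\<exists>S. S \<subseteq> {P \<in> aff_pt K ` affine_space N K.
                  has_arithmetic_degree K h F P (dynamical_degree N F)} \<and>
             zariski_dense N K S \<and>
             pairwise (\<lambda>P Q. disjnt (forward_orbit K F P) (forward_orbit K F Q)) S"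
proof -
  note K = assms(2)
  interpret T: triangular_map k N f by unfold_locales (use assms(1,3,8) in auto)
  interpret T: triangular_rational_map k N f F
  proof unfold_locales
    show "rat_app T.K F (aff_pt T.K x) = aff_pt T.K (T.step x)" if "x \<in> affine_space N T.K" for x
      using assms(9) that unfolding K T.step_def by blast
  qed (use assms(5) in \<open>auto simp: rational_self_map_def\<close>)
  have h: "hyperplane_weil_height N T.K h" using assms(4) unfolding K .
  have dN: "T.d N \<ge> 1" using T.last_degree_pos assms(7) unfolding K by blast
  show ?thesis
  \<comment> \<open>The split is by strict decrease rather than by the two hypotheses: for N = 2
    with d_2 < d_1 the argument for decreasing degrees is the one that applies, and otherwise d_1
    \<le> d_2, so that the last coordinate has maximal degree.\<close>
  proof (cases "\<forall>i\<in>{1..<N}. T.d (i + 1) < T.d i")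
    case True
    then have dec: "\<And>i. i \<in> {1..<N} \<Longrightarrow> T.d (i + 1) < T.d i" by blast
    have le: "T.d i \<le> T.d 1" if "i \<in> {1..N}" for i
      using strict_chain_less[of 1 N T.d i] dec that by (cases "i = 1") (auto simp: less_imp_le)
    have one: "1 \<in> {1..N}" using assms(3) by simp
    have d1: "T.d 1 \<ge> 1" using le[OF T.N_mem] dN by linarith
    show ?thesis unfolding K
      by (rule T.dense_disjoint_orbits[OF h one d1 le T.Dn_lower_decreasing[OF dec dN]
            T.generic_point_decreasing[OF dec dN]])
  next
    case False
    then have N2: "N = 2" using assms(10) by auto
    have le: "T.d i \<le> T.d N" if "i \<in> {1..N}" for i
    proof (cases "i = N")
      case False
      then have "i = 1" using that N2 by auto
      moreover have "\<not> T.d 2 < T.d 1" using \<open>\<not> (\<forall>i\<in>{1..<N}. T.d (i + 1) < T.d i)\<close> N2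
        by (auto simp: numeral_2_eq_2)
      ultimately show ?thesis using N2 by simp
    qed simp
    show ?thesis unfolding K
      by (rule T.dense_disjoint_orbits[OF h T.N_mem dN le T.Dn_lower_last[OF dN] T.generic_point_two[OF N2 dN]])
  qed
qed

end
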